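(* Let $k$ be a nonnegative integer, $m_1,m_2,\ldots,m_p$ positive integers, $\mathbf m=(m_1,\ldots,m_p)$, and $x\in[0,1]$ real. Put $|\mathbf m|=m_1+\cdots+m_p$, $c_1:=(-1)^p2^{|\mathbf m|+2-p}$ and $c_2:=(-1)^p2\log(2)$. Then $$\sum_{n=1}^\infty\frac{\zeta_n^\star(\mathbf m^\vee;x)}{n^{k+2}4^n}\binom{2n}{n}-\sum_{j=1}^p(-1)^{p-j}\operatorname{Li}_{m_p,\ldots,m_{j+1}}(1-x)\sum_{n=1}^\infty\frac{\zeta_n^\star\bigl((m_1,\ldots,m_j)^\vee\bigr)}{n^{k+2}4^n}\binom{2n}{n}$$ $$+(-1)^p\sum_{\substack{i+j=k\\ i\ge1,\,j\ge0}}(-1)^i\left\{\sum_{n=1}^\infty\frac{\binom{2n}{n}}{n^{j+2}4^n}\right\}\operatorname{Li}_{m_p,\ldots,m_2,m_1+1,1_{i-1}}(1-x)$$ $$=c_1\sum_{\substack{i+j=k\\ i,j\ge0}}(-1)^i A_{i,j}\bigl(\sqrt{1-x}\bigr)+c_2\sum_{\substack{i+j=k\\ i,j\ge0}}(-1)^i B_{i,j}(1-x),$$ where $A_{i,j}(z)$ and $B_{i,j}(z)$ are the poset integrals defined in the context.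
   Context: Multiple harmonic star sums: $\zeta_n^\star(k_1,\ldots,k_r)=\sum_{n\ge n_1\ge\cdots\ge n_r\ge1}\frac{1}{n_1^{k_1}\cdots n_r^{k_r}}$; parametric version: $\zeta_n^\star(k_1,\ldots,k_r;x)=\sum_{n\ge n_1\ge\cdots\ge n_r\ge1}\frac{x^{n_r}}{n_1^{k_1}\cdots n_r^{k_r}}$. One-variable multiple polylogarithm: $\operatorname{Li}_{k_1,\ldots,k_r}(z)=\sum_{n_1>\cdots>n_r>0}\frac{z^{n_1}}{n_1^{k_1}\cdots n_r^{k_r}}$, $\operatorname{Li}_\emptyset=1$. $1_d$ denotes $d$ repetitions of $1$. Hoffman dual: for a composition $\mathbf m=(m_1,\ldots,m_p)$ (positive integers), $\mathbf m^\vee=(m_1',\ldots,m'_{p'})$ is the unique composition of the same weight $|\mathbf m|$ such that $\{1,\ldots,|\mathbf m|-1\}$ is the disjoint union of $\{\sum_{i=1}^j m_i\}_{j=1}^{p-1}$ and $\{\sum_{i=1}^j m'_i\}_{j=1}^{p'-1}$. 1-forms: $\mathtt x_{-2}(t)=\frac{2t\,dt}{1-t^2}$, $\mathtt x_{-1}(t)=\frac{-dt}{1+t}$, $\mathtt x_0(t)=\frac{dt}{t}$, $\mathtt x_1(t)=\frac{dt}{1-t}$, $\mathtt x_2(t)=\frac{2\,dt}{1-t^2}$. Poset integrals: for a finite poset $X$ with a label map $\delta:X\to\{-2,-1,0,1,2\}$ and $z\in[0,1]$, $I_z(X)=\int_{\Delta_X}\prod_{a\in X}\mathtt x_{\delta(a)}(t_a)$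 with $\Delta_X=\{(t_a)_a\in[0,z]^X: t_a<t_b\text{ if }a<b\}$, where the product of the coefficient functions is integrated against Lebesgue measure. Definition of $A_{i,j}(z)$: it is $I_z(X)$ for the poset $X$ with elements $u_1,\ldots,u_j$; $w$; $v$; $s_1,\ldots,s_i$; $\tau_1,\ldots,\tau_{|\mathbf m|}$, order generated by $$u_1<\cdots<u_j<v,\qquad w<v,\qquad v<\tau_1,\qquad s_1<\cdots<s_i<\tau_1,\qquad \tau_1<\tau_2<\cdots<\tau_{|\mathbf m|},$$ and labels: all $u_l$, all $s_l$ and $v$ have label $-2$; $w$ has label $-1$; the labels of $\tau_1,\ldots,\tau_{|\mathbf m|}$ are, in this order, the sequence $(0)^{m_1},-2,(0)^{m_2-1},-2,(0)^{m_3-1},\ldots,-2,(0)^{m_p-1}$ (where $(0)^d$ means $d$ zeros). Definition of $B_{i,j}(z)$: it is $I_z(Y)$ where $Y$ is obtained from $X$ by deleting the element $w$ and replacing every label $-2$ by $1$. If $j=0$ there are no elements $u_l$; if $i=0$ there are no elements $s_l$.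
   Formalization: The case x = 0 with p ≥ 2 and m_p = 1 is excluded: there the term j = p−1 contains the divergent Li_1(1), and the integrals A_{i,j}(1), B_{i,j}(1) diverge, so the identity has no meaning. *)

theory Defs
  imports "HOL-Analysis.Analysis"
begin

text \<open>A composition \<open>(m\<^sub>1,\<dots>,m\<^sub>p)\<close> is a list of positive naturals; \<open>m\<^sub>i\<close> is \<open>ms ! (i - 1)\<close>.\<close>

definition composition :: "nat list \<Rightarrow> bool" where
  "composition ms \<longleftrightarrow> (\<forall>m\<in>set ms. 0 < m)"

definition proper_partial_sums :: "nat list \<Rightarrow> nat set" where
  "proper_partial_sums ms = (\<lambda>j. sum_list (take j ms)) ` {1..<length ms}"

definition hoffman_dual :: "nat list \<Rightarrow> nat list" where
  "hoffman_dual ms = (THE ms'. composition ms' \<and> sum_list ms' = sum_list ms \<and>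
     proper_partial_sums ms \<inter> proper_partial_sums ms' = {} \<and>
     proper_partial_sums ms \<union> proper_partial_sums ms' = {1..<sum_list ms})"

definition monomial_denom :: "nat list \<Rightarrow> nat list \<Rightarrow> real" where
  "monomial_denom ks ns = (\<Prod>i<length ks. real (ns ! i) ^ (ks ! i))"

definition star_indices :: "nat \<Rightarrow> nat \<Rightarrow> nat list set" where
  "star_indices r n = {ns. length ns = r \<and> sorted_wrt (\<ge>) ns \<and> set ns \<subseteq> {1..n}}"

definition zeta_star :: "nat \<Rightarrow> nat list \<Rightarrow> real" where
  "zeta_star n ks = (\<Sum>ns\<in>star_indices (length ks) n. 1 / monomial_denom ks ns)"

text \<open>The exponent of \<open>x\<close> is the smallest index \<open>n\<^sub>r\<close>, so the following is meaningful only for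
  \<open>ks \<noteq> []\<close>.\<close>

definition zeta_star_param :: "nat \<Rightarrow> nat list \<Rightarrow> real \<Rightarrow> real" where
  "zeta_star_param n ks x =
     (\<Sum>ns\<in>star_indices (length ks) n. x ^ last ns / monomial_denom ks ns)"

text \<open>Used only for \<open>z \<in> [0,1]\<close>, where all terms are nonnegative and unconditional summation
  agrees with any iterated summation. A divergent value (\<open>z = 1\<close>, first index \<open>1\<close>) is \<open>0\<close> by
  the convention of \<^const>\<open>infsum\<close> and has no mathematical meaning.\<close>

definition multi_polylog :: "nat list \<Rightarrow> real \<Rightarrow> real" where
  "multi_polylog ks z = (if ks = [] then 1 else
     (\<Sum>\<^sub>\<infinity>ns\<in>{ns. length ns = length ks \<and> sorted_wrt (>) ns \<and> (\<forall>n\<in>set ns. 0 < n)}.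
        z ^ hd ns / monomial_denom ks ns))"

text \<open>The coefficient function of the 1-form with the given label. The values that division by
  zero produces at \<open>t = 0\<close> and \<open>t = 1\<close> only matter on null sets.\<close>

definition form_coeff :: "int \<Rightarrow> real \<Rightarrow> real" where
  "form_coeff d t =
     (if d = -2 then 2 * t / (1 - t\<^sup>2)
      else if d = -1 then - 1 / (1 + t)
      else if d = 0 then 1 / t
      else if d = 1 then 1 / (1 - t)
      else if d = 2 then 2 / (1 - t\<^sup>2)
      else 0)"

text \<open>The finite poset is given by its carrier \<open>X\<close> and a strict order relation \<open>R\<close>, of which only
  the restriction to \<open>X\<close> is used.\<close>

definition poset_domain :: "real \<Rightarrow> 'a set \<Rightarrow> ('a \<times> 'a) set \<Rightarrow> ('a \<Rightarrow> real) set" where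
  "poset_domain z X R = {t \<in> X \<rightarrow>\<^sub>E {0..z}. \<forall>a\<in>X. \<forall>b\<in>X. (a, b) \<in> R \<longrightarrow> t a < t b}"

definition poset_integral :: "real \<Rightarrow> 'a set \<Rightarrow> ('a \<times> 'a) set \<Rightarrow> ('a \<Rightarrow> int) \<Rightarrow> real" where
  "poset_integral z X R \<delta> =
     (LINT t : poset_domain z X R | (\<Pi>\<^sub>M a\<in>X. lborel). (\<Prod>a\<in>X. form_coeff (\<delta> a) (t a)))"

datatype node = U nat | W | V | S nat | T nat

definition X_carrier :: "nat \<Rightarrow> nat \<Rightarrow> nat list \<Rightarrow> node set" where
  "X_carrier i j ms = U ` {1..j} \<union> {W, V} \<union> S ` {1..i} \<union> T ` {1..sum_list ms}"

definition X_order :: "nat \<Rightarrow> nat \<Rightarrow> nat list \<Rightarrow> (node \<times> node) set" where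
  "X_order i j ms =
     ({(U l, U (Suc l)) | l. 1 \<le> l \<and> l < j} \<union> {(U l, V) | l. 1 \<le> l \<and> l = j}
      \<union> {(W, V), (V, T 1)}
      \<union> {(S l, S (Suc l)) | l. 1 \<le> l \<and> l < i} \<union> {(S l, T 1) | l. 1 \<le> l \<and> l = i}
      \<union> {(T l, T (Suc l)) | l. 1 \<le> l \<and> l < sum_list ms})\<^sup>+"

definition T_labels :: "nat list \<Rightarrow> int list" where
  "T_labels ms =
     replicate (hd ms) 0 @ concat (map (\<lambda>m. -2 # replicate (m - 1) 0) (tl ms))"

fun X_label :: "nat list \<Rightarrow> node \<Rightarrow> int" where
  "X_label ms (U l) = -2"
| "X_label ms W = -1"
| "X_label ms V = -2"
| "X_label ms (S l) = -2"
| "X_label ms (T l) = T_labels ms ! (l - 1)"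

definition A_integral :: "nat list \<Rightarrow> nat \<Rightarrow> nat \<Rightarrow> real \<Rightarrow> real" where
  "A_integral ms i j z = poset_integral z (X_carrier i j ms) (X_order i j ms) (X_label ms)"

definition B_integral :: "nat list \<Rightarrow> nat \<Rightarrow> nat \<Rightarrow> real \<Rightarrow> real" where
  "B_integral ms i j z = poset_integral z (X_carrier i j ms - {W}) (X_order i j ms)
     (\<lambda>a. if X_label ms a = -2 then 1 else X_label ms a)"

end

theory Submission
  imports Defs
begin

text \<open>
  Put \<open>y = 1 - x\<close>. All terms of the identity come from functions of one variable \<open>s\<close> by one and the
  same linear functional \<open>I\<close>: an iterated integral up to \<open>y\<close> with one integration for each element of
  the chain \<open>\<tau>\<^sub>1 < \<tau>\<^sub>2 < \<dots>\<close>, against \<open>dt/t\<close> for a label \<open>0\<close> and against \<open>dt/(1-t)\<close> for a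
  label \<open>-2\<close>. Write \<open>g\<^sub>i(s) = (-log (1-s))\<^sup>i / i!\<close>.

  \<^item> For fixed \<open>n\<close>, the combination of \<open>\<zeta>\<^sub>n\<^sup>\<star>(m\<^sup>\<or>;x)\<close> with the products
    \<open>Li(y) \<zeta>\<^sub>n\<^sup>\<star>((m\<^sub>1,\<dots>,m\<^sub>j)\<^sup>\<or>)\<close> is \<open>(-1)\<^sup>p I(1 - (1-s)\<^sup>n)\<close>. Taking the last unit of
    weight off \<open>m\<close> changes the dual, and hence the star sum, exactly as differentiation in \<open>x\<close> does;
    the polylogarithms correct for the values at \<open>y = 0\<close>
    (\<open>iter_int_star_remainder\<close>).
  \<^item> For \<open>i \<ge> 1\<close>, \<open>I(g\<^sub>i)\<close> is the polylogarithm with indices \<open>m\<^sub>p,\<dots>,m\<^sub>2,m\<^sub>1+1,1\<^bsub>i-1\<^esub>\<close>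
    (\<open>iter_int_log_power\<close>).
  \<^item> In the poset integrals the part below \<open>\<tau>\<^sub>1\<close> falls into two unrelated pieces. With
    \<open>s = t\<^sup>2\<close> in the first of the two integrals, this gives
    \<open>A\<^sub>i\<^sub>j = -2\<^sup>-\<^sup>e I(g\<^sub>i P\<^sub>j)\<close> with \<open>e = |m| + 1 - p\<close>, and
    \<open>B\<^sub>i\<^sub>j = I(g\<^sub>i g\<^sub>j\<^sub>+\<^sub>1)\<close>, where \<open>P\<^sub>j(s)\<close> is the integral of
    \<open>g\<^sub>j(r) log (1 + sqrt r) / (1-r)\<close> from \<open>0\<close> to \<open>s\<close> (\<open>A_integral_eq\<close>, \<open>B_integral_eq\<close>).

  The theorem is therefore the image under \<open>I\<close> of an identity between functions of \<open>s\<close>, in which the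
  numbers \<open>c\<^sub>j\<close> are the values at \<open>1\<close> of the central binomial series
  \<open>\<Sum>\<^sub>n binom(2n,n) 4\<^sup>-\<^sup>n q\<^sup>n / n\<^sup>j\<close>:
  the series with \<open>j = k+2\<close> at \<open>q = 1-s\<close> equals
  \<open>\<Sum> (-1)\<^sup>i g\<^sub>i (c\<^bsub>k-i+2\<^esub> + 2 P\<^bsub>k-i\<^esub> - 2 log 2 g\<^bsub>k-i+1\<^esub>)\<close>, summed over \<open>0 \<le> i \<le> k\<close>
  (\<open>central_polylog_expansion\<close>). Its difference from the value at \<open>s = 0\<close> is what \<open>I\<close> is applied
  to (\<open>sums_one_minus_power\<close>). The identity follows by repeated differentiation in \<open>s\<close> from the
  closed form \<open>2 log 2 - 2 log (1 + sqrt (1-q))\<close> of the series with \<open>j = 1\<close>, which is where the factor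
  \<open>log 2\<close> and the extra form \<open>dt/(1+t)\<close> of the first poset come from.

  All integrals are computed in \<open>[0,\<infinity>]\<close>, where Tonelli's theorem and monotone convergence apply
  without integrability conditions, and \<open>I\<close> is integration against a measure
  (\<open>iter_int_measure\<close>). The end point \<open>x = 0\<close>, where the integrands are unbounded, is thus treated
  together with the other values of \<open>x\<close>.
\<close>

section \<open>Hoffman duality\<close>

text \<open>The defining property of the Hoffman dual as a relation, so that a candidate can be tested without
  the definite description.\<close>

definition hoffman_dual_pair :: "nat list \<Rightarrow> nat list \<Rightarrow> bool" where
  "hoffman_dual_pair ms ms' \<longleftrightarrow> composition ms' \<and> sum_list ms' = sum_list ms \<and>
     proper_partial_sums ms \<inter> proper_partial_sums ms' = {} \<and>
     proper_partial_sums ms \<union> proper_partial_sums ms' = {1..<sum_list ms}"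

lemma proper_partial_sums_singleton: "proper_partial_sums [m] = {}"
  by (simp add: proper_partial_sums_def)

lemma proper_partial_sums_snoc:
  assumes "ms \<noteq> []"
  shows "proper_partial_sums (ms @ [m]) = insert (sum_list ms) (proper_partial_sums ms)"
proof -
  have "{1..<length (ms @ [m])} = insert (length ms) {1..<length ms}"
    using assms by (cases ms) auto
  then show ?thesis by (auto simp: proper_partial_sums_def)
qed

lemma proper_partial_sums_less:
  assumes "composition ms" "s \<in> proper_partial_sums ms" shows "s < sum_list ms"
  using assms
proof (induction ms rule: rev_induct)
  case (snoc m ms)
  show ?case
  proof (cases "ms = []")
    case False
    with snoc show ?thesis
      by (auto simp: proper_partial_sums_snoc composition_def intro: trans_less_add1)
  qed (use snoc in \<open>auto simp: proper_partial_sums_def\<close>)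
qed (auto simp: proper_partial_sums_def)

lemma composition_sum_pos: "composition ms \<Longrightarrow> ms \<noteq> [] \<Longrightarrow> 0 < sum_list ms"
  by (cases ms) (auto simp: composition_def)

text \<open>The largest proper partial sum is the sum of all parts but the last. It determines the last part,
  and the remaining parts follow by induction.\<close>

lemma composition_eqI:
  assumes "composition ms" "composition ns" "sum_list ms = sum_list ns"
    and "proper_partial_sums ms = proper_partial_sums ns"
  shows "ms = ns"
  using assms
proof (induction ms arbitrary: ns rule: rev_induct)
  case Nil
  then have "sum_list ns = 0" by simp
  with Nil.prems(2) composition_sum_pos[of ns] show ?case by (cases "ns = []") simp_all
next
  case (snoc m ms)
  have "ns \<noteq> []"
    using snoc.prems composition_sum_pos[of "ms @ [m]"] by auto
  then obtain n ns' where ns: "ns = ns' @ [n]" by (metis rev_exhaust)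
  have c: "composition ms" "composition ns'" using snoc.prems ns by (auto simp: composition_def)
  have "ms = [] \<longleftrightarrow> ns' = []"
    using snoc.prems(4) ns proper_partial_sums_snoc[of ms m] proper_partial_sums_snoc[of ns' n]
    by (metis append_Nil insert_not_empty proper_partial_sums_singleton)
  then consider "ms = []" "ns' = []" | "ms \<noteq> []" "ns' \<noteq> []" by blast
  then show ?case
  proof cases
    case 2
    have eq: "insert (sum_list ms) (proper_partial_sums ms) = insert (sum_list ns') (proper_partial_sums ns')"
      using snoc.prems(4) ns 2 by (simp add: proper_partial_sums_snoc)
    have less: "\<forall>s\<in>proper_partial_sums ms. s < sum_list ms" "\<forall>s\<in>proper_partial_sums ns'. s < sum_list ns'"
      using proper_partial_sums_less c by blast+
    have s: "sum_list ms = sum_list ns'"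
      using eq less by (metis insertE insertI1 less_asym)
    then have "proper_partial_sums ms = proper_partial_sums ns'"
      using eq less by (metis insert_ident less_irrefl)
    with s snoc.IH[OF c] snoc.prems(3) ns show ?thesis by simp
  next
    case 1
    with snoc.prems(3) ns show ?thesis by simp
  qed
qed

lemma hoffman_dualI: "hoffman_dual_pair ms ms' \<Longrightarrow> hoffman_dual ms = ms'"
  unfolding hoffman_dual_def hoffman_dual_pair_def
proof (rule the_equality, assumption)
  fix ns
  assume ms': "composition ms' \<and> sum_list ms' = sum_list ms \<and>
      proper_partial_sums ms \<inter> proper_partial_sums ms' = {} \<and>
      proper_partial_sums ms \<union> proper_partial_sums ms' = {1..<sum_list ms}"
    and ns: "composition ns \<and> sum_list ns = sum_list ms \<and>
      proper_partial_sums ms \<inter> proper_partial_sums ns = {} \<and>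
      proper_partial_sums ms \<union> proper_partial_sums ns = {1..<sum_list ms}"
  have "proper_partial_sums ns = proper_partial_sums ms'" using ms' ns by blast
  with ms' ns show "ns = ms'" by (intro composition_eqI) simp_all
qed

lemma hoffman_dual_pair_one: "hoffman_dual_pair [1] [1]"
  by (auto simp: hoffman_dual_pair_def composition_def proper_partial_sums_def)

text \<open>The old weight becomes an inner point that is no partial sum of the raised composition. The dual
  has to break there, so it gains a last part \<open>1\<close>.\<close>

lemma hoffman_dual_pair_raise:
  assumes "hoffman_dual_pair (ms @ [Suc m]) ms'" "ms' \<noteq> []"
  shows "hoffman_dual_pair (ms @ [Suc (Suc m)]) (ms' @ [1])"
proof -
  have *: "proper_partial_sums (ms @ [Suc (Suc m)]) = proper_partial_sums (ms @ [Suc m])"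
    by (cases "ms = []") (auto simp: proper_partial_sums_singleton proper_partial_sums_snoc)
  have "s < sum_list ms + Suc m" if "s \<in> proper_partial_sums (ms @ [Suc m])" for s
  proof -
    have "s \<in> {1..<sum_list (ms @ [Suc m])}"
      using assms that unfolding hoffman_dual_pair_def by blast
    then show ?thesis by simp
  qed
  moreover have "{1..<sum_list (ms @ [Suc (Suc m)])} = insert (sum_list ms + Suc m) {1..<sum_list (ms @ [Suc m])}"
    by auto
  ultimately show ?thesis
    using assms unfolding hoffman_dual_pair_def *
    by (auto simp: proper_partial_sums_snoc composition_def)
qed

text \<open>The old weight becomes a partial sum of the longer composition. The dual must not break there, so
  its last part grows by one.\<close>

lemma hoffman_dual_pair_append:
  assumes "hoffman_dual_pair ms (ms' @ [m])" "composition ms" "ms \<noteq> []"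
  shows "hoffman_dual_pair (ms @ [1]) (ms' @ [Suc m])"
proof -
  have *: "proper_partial_sums (ms' @ [Suc m]) = proper_partial_sums (ms' @ [m])"
    by (cases "ms' = []") (auto simp: proper_partial_sums_singleton proper_partial_sums_snoc)
  have lt: "s < sum_list ms" if "s \<in> proper_partial_sums (ms' @ [m])" for s
    using assms that proper_partial_sums_less[of "ms' @ [m]" s]
    unfolding hoffman_dual_pair_def by auto
  have "{1..<sum_list (ms @ [1])} = insert (sum_list ms) {1..<sum_list ms}"
    using composition_sum_pos[OF assms(2,3)] by auto
  then show ?thesis
    using assms lt unfolding hoffman_dual_pair_def *
    by (auto simp: proper_partial_sums_snoc composition_def)
qed

text \<open>Every nonempty composition arises from \<open>(1)\<close> by raising the last part and by appending a part
  \<open>1\<close>. On iterated integrals these steps add an outermost form \<open>dt/t\<close> or \<open>dt/(1-t)\<close>, so the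
  inductions on the weight all take this shape.\<close>

lemma composition_induct [consumes 2, case_names one raise append]:
  assumes "composition ms" "ms \<noteq> []"
    and "P [1]"
    and raise: "\<And>ms m. composition (ms @ [Suc m]) \<Longrightarrow> P (ms @ [Suc m]) \<Longrightarrow> P (ms @ [Suc (Suc m)])"
    and append: "\<And>ms. composition ms \<Longrightarrow> ms \<noteq> [] \<Longrightarrow> P ms \<Longrightarrow> P (ms @ [1])"
  shows "P ms"
  using assms(1,2)
proof (induction ms rule: rev_induct)
  case (snoc m ms)
  have m: "m > 0" and ms: "composition ms" using snoc.prems by (auto simp: composition_def)
  have base: "P (ms @ [1])"
    using snoc.IH ms append assms(3) by (cases "ms = []") auto
  have "P (ms @ [Suc m'])" for m'
  proof (induction m')
    case 0 then show ?case using base by simp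
  next
    case (Suc m') then show ?case using raise[of ms m'] ms by (auto simp: composition_def)
  qed
  from this[of "m - 1"] m show ?case by simp
qed simp

lemma hoffman_dual_pair_exists:
  assumes "composition ms" "ms \<noteq> []"
  shows "\<exists>ms' m. hoffman_dual_pair ms (ms' @ [Suc m])"
  using assms
proof (induction rule: composition_induct)
  case one
  then show ?case using hoffman_dual_pair_one by (metis append_Nil One_nat_def)
next
  case (raise ms m)
  then obtain ms' m' where "hoffman_dual_pair (ms @ [Suc m]) (ms' @ [Suc m'])" by blast
  then have "hoffman_dual_pair (ms @ [Suc (Suc m)]) ((ms' @ [Suc m']) @ [Suc 0])"
    using hoffman_dual_pair_raise by fastforce
  then show ?case by blast
next
  case (append ms)
  then obtain ms' m' where "hoffman_dual_pair ms (ms' @ [Suc m'])" by blast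
  then have "hoffman_dual_pair (ms @ [1]) (ms' @ [Suc (Suc m')])"
    using hoffman_dual_pair_append append.hyps by blast
  then show ?case by blast
qed

lemma hoffman_dual_pair_hoffman_dual:
  assumes "composition ms" "ms \<noteq> []" shows "hoffman_dual_pair ms (hoffman_dual ms)"
proof -
  obtain ms' where "hoffman_dual_pair ms ms'" using hoffman_dual_pair_exists[OF assms] by blast
  with hoffman_dualI[OF this] show ?thesis by simp
qed

lemma hoffman_dual_nonempty:
  assumes "composition ms" "ms \<noteq> []" shows "hoffman_dual ms \<noteq> []"
proof -
  obtain ms' m where "hoffman_dual_pair ms (ms' @ [Suc m])"
    using hoffman_dual_pair_exists[OF assms] by blast
  from hoffman_dualI[OF this] show ?thesis by simp
qed

lemma composition_hoffman_dual:
  assumes "composition ms" "ms \<noteq> []" shows "composition (hoffman_dual ms)"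
  using hoffman_dual_pair_hoffman_dual[OF assms] by (simp add: hoffman_dual_pair_def)

lemma hoffman_dual_one: "hoffman_dual [1] = [1]"
  by (rule hoffman_dualI[OF hoffman_dual_pair_one])

lemma hoffman_dual_raise:
  assumes "composition (ms @ [Suc m])"
  shows "hoffman_dual (ms @ [Suc (Suc m)]) = hoffman_dual (ms @ [Suc m]) @ [1]"
  using assms
  by (intro hoffman_dualI hoffman_dual_pair_raise hoffman_dual_pair_hoffman_dual hoffman_dual_nonempty) auto

lemma hoffman_dual_append:
  assumes "composition ms" "ms \<noteq> []"
  obtains ks k where "hoffman_dual ms = ks @ [Suc k]" "hoffman_dual (ms @ [1]) = ks @ [Suc (Suc k)]"
proof -
  obtain ks k where p: "hoffman_dual_pair ms (ks @ [Suc k])"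
    using hoffman_dual_pair_exists[OF assms] by blast
  show thesis
    using that[OF hoffman_dualI[OF p] hoffman_dualI[OF hoffman_dual_pair_append[OF p assms]]] .
qed

section \<open>Star sums as functions of the parameter\<close>

text \<open>The parameter belongs to the innermost index. With the value \<open>x\<^sup>n\<close> for the empty word it is
  carried there by the recursion on the outermost index, and \<open>x = 1\<close> gives the sums without
  parameter.\<close>

fun star_sum :: "nat \<Rightarrow> nat list \<Rightarrow> real \<Rightarrow> real" where
  "star_sum n [] x = x ^ n"
| "star_sum n (k # ks) x = (\<Sum>l=1..n. star_sum l ks x / real l ^ k)"

lemma star_indices_0: "star_indices 0 n = {[]}"
  by (auto simp: star_indices_def)

lemma star_indices_Suc:
  "star_indices (Suc r) n = (\<Union>l\<in>{1..n}. (\<lambda>ns. l # ns) ` star_indices r l)"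
proof (rule set_eqI)
  fix ns
  show "ns \<in> star_indices (Suc r) n \<longleftrightarrow> ns \<in> (\<Union>l\<in>{1..n}. (\<lambda>ns. l # ns) ` star_indices r l)"
    by (cases ns) (auto simp: star_indices_def image_iff subset_iff intro: order_trans)
qed

lemma finite_star_indices: "finite (star_indices r n)"
  by (induction r arbitrary: n) (auto simp: star_indices_0 star_indices_Suc)

lemma monomial_denom_Cons: "monomial_denom (k # ks) (n # ns) = real n ^ k * monomial_denom ks ns"
  unfolding monomial_denom_def list.size(4) add_Suc_right add_0_right
  by (subst prod.lessThan_Suc_shift) simp

lemma sum_star_indices_Suc:
  fixes f :: "nat list \<Rightarrow> real"
  shows "sum f (star_indices (Suc r) n) = (\<Sum>l=1..n. \<Sum>ns\<in>star_indices r l. f (l # ns))"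
proof -
  have "sum f (star_indices (Suc r) n) = (\<Sum>l=1..n. sum f ((\<lambda>ns. l # ns) ` star_indices r l))"
    unfolding star_indices_Suc by (intro sum.UNION_disjoint) (auto simp: finite_star_indices)
  also have "\<dots> = (\<Sum>l=1..n. \<Sum>ns\<in>star_indices r l. f (l # ns))"
    by (intro sum.cong refl sum.reindex_cong[OF _ refl refl]) (auto simp: inj_on_def)
  finally show ?thesis .
qed

lemma zeta_star_eq_star_sum: "zeta_star n ks = star_sum n ks 1"
proof (induction ks arbitrary: n)
  case Nil
  show ?case by (simp add: zeta_star_def star_indices_0 monomial_denom_def)
next
  case (Cons k ks)
  have "zeta_star n (k # ks) = (\<Sum>l=1..n. \<Sum>ns\<in>star_indices (length ks) l.
          (1 / monomial_denom ks ns) / real l ^ k)"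
    unfolding zeta_star_def list.size(4) add_Suc_right add_0_right sum_star_indices_Suc monomial_denom_Cons
    by (intro sum.cong refl) (simp add: mult.commute)
  also have "\<dots> = star_sum n (k # ks) 1"
    unfolding sum_divide_distrib[symmetric] zeta_star_def[symmetric] Cons.IH by simp
  finally show ?case .
qed

lemma star_indices_length: "ns \<in> star_indices r n \<Longrightarrow> length ns = r"
  by (simp add: star_indices_def)

lemma zeta_star_param_eq_star_sum:
  assumes "ks \<noteq> []" shows "zeta_star_param n ks x = star_sum n ks x"
  using assms
proof (induction ks arbitrary: n rule: list_nonempty_induct)
  case (single k)
  show ?case
    by (simp add: zeta_star_param_def sum_star_indices_Suc star_indices_0 monomial_denom_Cons
        monomial_denom_def[of "[]"])
next
  case (cons k ks)
  have "zeta_star_param n (k # ks) x = (\<Sum>l=1..n. \<Sum>ns\<in>star_indices (length ks) l.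
          (x ^ last ns / monomial_denom ks ns) / real l ^ k)"
    unfolding zeta_star_param_def list.size(4) add_Suc_right add_0_right sum_star_indices_Suc monomial_denom_Cons
    using cons.hyps star_indices_length
    by (intro sum.cong refl) (fastforce simp: mult.commute)
  also have "\<dots> = star_sum n (k # ks) x"
    unfolding sum_divide_distrib[symmetric] zeta_star_param_def[symmetric] cons.IH by simp
  finally show ?case .
qed

lemma star_sum_nonneg: "0 \<le> x \<Longrightarrow> 0 \<le> star_sum n ks x"
  by (induction ks arbitrary: n) (auto intro!: sum_nonneg)

lemma star_sum_mono: "0 \<le> x \<Longrightarrow> x \<le> y \<Longrightarrow> star_sum n ks x \<le> star_sum n ks y"
  by (induction ks arbitrary: n) (auto intro!: sum_mono divide_right_mono power_mono)

lemma sum_inverse_sqrt_le: "(\<Sum>l=1..n. 1 / sqrt (real l)) \<le> 2 * sqrt (real n)"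
proof (induction n)
  case (Suc n)
  have "sqrt n * sqrt (Suc n) \<le> (real n + real (Suc n)) / 2"
    using arith_geo_mean_sqrt[of n "Suc n"] by (simp add: real_sqrt_mult)
  moreover have "sqrt (Suc n) * sqrt (Suc n) = real (Suc n)" by simp
  ultimately have "2 * sqrt n * sqrt (Suc n) + 1 \<le> 2 * sqrt (Suc n) * sqrt (Suc n)"
    by (simp add: algebra_simps)
  then have "2 * sqrt n + 1 / sqrt (Suc n) \<le> 2 * sqrt (Suc n)"
    by (simp add: field_simps del: of_nat_Suc)
  with Suc show ?case by simp
qed simp

text \<open>The rate \<open>sqrt n\<close> is reproduced, up to the constant, by one more summation against \<open>1/l\<close>, and it is
  small enough for convergence against \<open>1/n\<^sup>2\<close>.\<close>

lemma star_sum_bound: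
  assumes "composition ks"
  shows "\<exists>C\<ge>0. \<forall>n\<ge>1. star_sum n ks 1 \<le> C * sqrt (real n)"
  using assms
proof (induction ks)
  case Nil
  show ?case by (rule exI[of _ 1]) auto
next
  case (Cons k ks)
  then obtain C where C: "C \<ge> 0" "\<And>n. n \<ge> 1 \<Longrightarrow> star_sum n ks 1 \<le> C * sqrt (real n)"
    by (auto simp: composition_def)
  have k: "k \<ge> 1" using Cons.prems by (simp add: composition_def)
  have "star_sum n (k # ks) 1 \<le> 2 * C * sqrt n" for n
  proof -
    have "star_sum n (k # ks) 1 \<le> (\<Sum>l=1..n. C * (1 / sqrt (real l)))"
      unfolding star_sum.simps
    proof (rule sum_mono)
      fix l assume "l \<in> {1..n}"
      then have l: "l \<ge> 1" by simp
      have "star_sum l ks 1 / real l ^ k \<le> star_sum l ks 1 / real l"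
        using l k self_le_power[of "real l" k] by (intro divide_left_mono) (auto simp: star_sum_nonneg)
      also have "\<dots> \<le> C * sqrt l / real l" using C(2)[OF l] by (intro divide_right_mono) auto
      also have "\<dots> = C * (1 / sqrt (real l))"
        using l by (simp add: field_simps)
      finally show "star_sum l ks 1 / real l ^ k \<le> C * (1 / sqrt (real l))" .
    qed
    also have "\<dots> = C * (\<Sum>l=1..n. 1 / sqrt (real l))" by (simp add: sum_distrib_left)
    also have "\<dots> \<le> C * (2 * sqrt n)" using C sum_inverse_sqrt_le by (intro mult_left_mono)
    finally show ?thesis by simp
  qed
  then show ?case using C(1) by (intro exI[of _ "2 * C"]) auto
qed

lemma star_sum_continuous: "continuous_on X (star_sum n ks)"
proof (induction ks arbitrary: n)
  case Nil
  show ?case by (simp add: continuous_on_power continuous_on_id)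
next
  case (Cons k ks)
  show ?case
    unfolding star_sum.simps divide_inverse
    by (intro continuous_on_sum continuous_on_mult continuous_on_const Cons)
qed

text \<open>Only the innermost index carries \<open>x\<close>, and \<open>x d/dx\<close> multiplies its term by that index.\<close>

lemma star_sum_deriv_last:
  assumes "x \<noteq> 0"
  shows "(star_sum n (ks @ [Suc k]) has_real_derivative star_sum n (ks @ [k]) x / x) (at x)"
proof (induction ks arbitrary: n)
  case Nil
  have "((\<lambda>x. \<Sum>l=1..n. x ^ l / real l ^ Suc k) has_real_derivative
        (\<Sum>l=1..n. real l * x ^ (l - 1) / real l ^ Suc k)) (at x)"
    by (auto intro!: derivative_eq_intros sum.cong)
  also have "(\<Sum>l=1..n. real l * x ^ (l - 1) / real l ^ Suc k) = (\<Sum>l=1..n. x ^ l / real l ^ k) / x"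
    unfolding sum_divide_distrib using assms
    by (intro sum.cong refl) (simp add: power_diff)
  finally show ?case by simp
next
  case (Cons k' ks)
  have "((\<lambda>x. \<Sum>l=1..n. star_sum l (ks @ [Suc k]) x / real l ^ k') has_real_derivative
        (\<Sum>l=1..n. (star_sum l (ks @ [k]) x / x) / real l ^ k')) (at x)"
    by (intro DERIV_sum DERIV_cdivide Cons)
  then show ?case by (simp add: sum_divide_distrib mult.commute)
qed

text \<open>For an innermost exponent \<open>1\<close> the derivative is a geometric sum over the innermost index; its two
  boundary terms are the star sums of the shorter word at \<open>1\<close> and at \<open>x\<close>.\<close>

lemma star_sum_deriv_snoc_one:
  assumes "x \<noteq> 1"
  shows "(star_sum n (ks @ [1]) has_real_derivative (star_sum n ks 1 - star_sum n ks x) / (1 - x)) (at x)"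
proof (induction ks arbitrary: n)
  case Nil
  have "((\<lambda>x. \<Sum>l=1..n. x ^ l / real l) has_real_derivative (\<Sum>l=1..n. x ^ (l - 1))) (at x)"
    by (auto intro!: derivative_eq_intros sum.cong)
  also have "(\<Sum>l=1..n. x ^ (l - 1)) = (\<Sum>l<n. x ^ l)"
    by (rule sum.reindex_bij_witness[of _ Suc "\<lambda>l. l - 1"]) auto
  also have "\<dots> = (1 - x ^ n) / (1 - x)" using assms by (simp add: sum_gp_strict)
  finally show ?case by simp
next
  case (Cons k' ks)
  have "((\<lambda>x. \<Sum>l=1..n. star_sum l (ks @ [1]) x / real l ^ k') has_real_derivative
        (\<Sum>l=1..n. ((star_sum l ks 1 - star_sum l ks x) / (1 - x)) / real l ^ k')) (at x)"
    by (intro DERIV_sum DERIV_cdivide Cons)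
  then show ?case
    by (simp add: sum_divide_distrib sum_subtractf diff_divide_distrib mult.commute)
qed

section \<open>Multiple polylogarithms as power series\<close>

text \<open>The coefficients of the polylogarithm: the outermost index is the exponent of \<open>z\<close>. The empty word
  has to give the constant series \<open>1\<close>, whence the coefficient at \<open>n = 0\<close>.\<close>

fun li_coeff :: "nat list \<Rightarrow> nat \<Rightarrow> real" where
  "li_coeff [] n = (if n = 0 then 1 else 0)"
| "li_coeff (k # ks) n = (if n = 0 then 0 else (\<Sum>h<n. li_coeff ks h) / real n ^ k)"

definition polylog :: "nat list \<Rightarrow> real \<Rightarrow> real" where
  "polylog ks z = (\<Sum>n. li_coeff ks n * z ^ n)"

lemma li_coeff_nonneg: "0 \<le> li_coeff ks n"
  by (induction ks arbitrary: n) (auto intro!: sum_nonneg divide_nonneg_nonneg)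

lemma li_coeff_le_one:
  assumes "composition ks" shows "li_coeff ks n \<le> 1"
  using assms
proof (induction ks arbitrary: n)
  case (Cons k ks)
  have k: "k \<ge> 1" and ks: "composition ks" using Cons.prems by (auto simp: composition_def)
  show ?case
  proof (cases "n = 0")
    case False
    have "(\<Sum>h<n. li_coeff ks h) \<le> (\<Sum>h<n. 1)" by (intro sum_mono Cons.IH ks)
    also have "\<dots> \<le> real n ^ k" using self_le_power[of "real n" k] k False by simp
    finally show ?thesis using False by (simp add: divide_le_eq)
  qed simp
qed simp

lemma summable_polylog:
  assumes "composition ks" "\<bar>z\<bar> < 1" shows "summable (\<lambda>n. li_coeff ks n * z ^ n)"
proof (rule summable_comparison_test')
  show "summable (\<lambda>n. \<bar>z\<bar> ^ n)" using assms by (simp add: summable_geometric)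
  show "norm (li_coeff ks n * z ^ n) \<le> \<bar>z\<bar> ^ n" for n
    using li_coeff_le_one[OF assms(1), of n] li_coeff_nonneg[of ks n]
    by (simp add: abs_mult power_abs mult_left_le_one_le)
qed

text \<open>One more factor \<open>1/n\<close> then makes the series converge absolutely at \<open>z = 1\<close>, which is the case of a
  first exponent of at least \<open>2\<close>.\<close>

lemma li_coeff_bound:
  assumes "composition ks"
  shows "\<exists>C\<ge>0. \<forall>n\<ge>1. li_coeff ks n \<le> C / sqrt (real n)"
  using assms
proof (induction ks)
  case Nil
  show ?case by (rule exI[of _ 0]) auto
next
  case (Cons k ks)
  then obtain C where C: "C \<ge> 0" "\<And>n. n \<ge> 1 \<Longrightarrow> li_coeff ks n \<le> C / sqrt (real n)"
    by (auto simp: composition_def)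
  have k: "k \<ge> 1" and ks: "composition ks" using Cons.prems by (auto simp: composition_def)
  have "li_coeff (k # ks) n \<le> (1 + 2 * C) / sqrt n" if n: "n \<ge> 1" for n
  proof -
    have "(\<Sum>h<n. li_coeff ks h) \<le> (\<Sum>h\<in>insert 0 {1..n}. li_coeff ks h)"
      by (intro sum_mono2) (auto simp: li_coeff_nonneg)
    also have "\<dots> = li_coeff ks 0 + (\<Sum>h=1..n. li_coeff ks h)" by simp
    also have "(\<Sum>h=1..n. li_coeff ks h) \<le> (\<Sum>h=1..n. C * (1 / sqrt (real h)))"
      using C by (intro sum_mono) auto
    also have "\<dots> = C * (\<Sum>h=1..n. 1 / sqrt (real h))" by (simp add: sum_distrib_left)
    also have "\<dots> \<le> C * (2 * sqrt n)" using C sum_inverse_sqrt_le by (intro mult_left_mono)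
    also have "li_coeff ks 0 \<le> 1" using li_coeff_le_one[OF ks] .
    also have "1 + C * (2 * sqrt n) \<le> (1 + 2 * C) * sqrt n" using n by (simp add: algebra_simps)
    finally have "(\<Sum>h<n. li_coeff ks h) \<le> (1 + 2 * C) * sqrt n" by simp
    moreover have "real n ^ k \<ge> real n" using self_le_power[of "real n" k] k n by simp
    ultimately have "(\<Sum>h<n. li_coeff ks h) / real n ^ k \<le> (1 + 2 * C) * sqrt n / real n"
      using n C by (intro frac_le) auto
    also have "\<dots> = (1 + 2 * C) / sqrt n" using n by (simp add: field_simps)
    finally show ?thesis using n by simp
  qed
  then show ?case using C(1) by (intro exI[of _ "1 + 2 * C"]) auto
qed

lemma li_coeff_Suc: "real n * li_coeff (Suc k # ks) n = li_coeff (k # ks) n"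
  by simp

lemma summable_inverse_n_sqrt: "summable (\<lambda>n. 1 / (real n * sqrt (real n)))"
proof -
  have "summable (\<lambda>n. real n powr (- (3 / 2)))" by (subst summable_real_powr_iff) simp
  moreover have "real n powr (- (3 / 2)) = 1 / (real n * sqrt (real n))" for n
  proof (cases "n = 0")
    case False
    have "real n powr (1 + 1 / 2) = real n powr 1 * real n powr (1 / 2)" by (rule powr_add)
    moreover have "real n powr 1 * real n powr (1 / 2) = real n * sqrt (real n)"
      by (simp only: powr_half_sqrt of_nat_0_le_iff powr_one)
    moreover have "(1 + 1 / 2 :: real) = 3 / 2" by simp
    ultimately have "real n powr (3 / 2) = real n * sqrt (real n)" by metis
    then show ?thesis by (simp only: powr_minus divide_inverse mult_1)
  qed simp
  ultimately show ?thesis by simp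
qed

lemma summable_polylog_one:
  assumes "composition (Suc (Suc k) # ks)" shows "summable (li_coeff (Suc (Suc k) # ks))"
proof -
  have c: "composition (Suc k # ks)" using assms by (simp add: composition_def)
  obtain C where C: "C \<ge> 0" "\<And>n. n \<ge> 1 \<Longrightarrow> li_coeff (Suc k # ks) n \<le> C / sqrt (real n)"
    using li_coeff_bound[OF c] by auto
  show ?thesis
  proof (rule summable_comparison_test')
    show "summable (\<lambda>n. C * (1 / (real n * sqrt (real n))))"
      by (intro summable_mult summable_inverse_n_sqrt)
    fix n :: nat assume n: "n \<ge> 1"
    have "real n * li_coeff (Suc (Suc k) # ks) n \<le> C / sqrt n"
      unfolding li_coeff_Suc by (rule C(2)[OF n])
    then have "li_coeff (Suc (Suc k) # ks) n \<le> C * (1 / (real n * sqrt (real n)))"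
      using n by (simp add: field_simps)
    then show "norm (li_coeff (Suc (Suc k) # ks) n) \<le> C * (1 / (real n * sqrt (real n)))"
      using li_coeff_nonneg[of "Suc (Suc k) # ks" n] by (simp only: real_norm_def abs_of_nonneg)
  qed
qed

definition polylog_converges :: "nat list \<Rightarrow> real \<Rightarrow> bool" where
  "polylog_converges ks y \<longleftrightarrow> composition ks \<and> 0 \<le> y \<and> y \<le> 1 \<and> (y = 1 \<longrightarrow> ks = [] \<or> hd ks \<ge> 2)"

lemma summable_polylog_converges:
  assumes "polylog_converges ks y" shows "summable (\<lambda>n. li_coeff ks n * y ^ n)"
proof (cases "y = 1 \<and> ks \<noteq> []")
  case True
  then obtain k ks' where "ks = Suc (Suc k) # ks'"
    using assms unfolding polylog_converges_def
    by (metis add_2_eq_Suc le_Suc_ex list.exhaust_sel)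
  then show ?thesis
    using summable_polylog_one[of k ks'] assms True
    by (simp add: polylog_converges_def del: li_coeff.simps)
next
  case False
  then consider "y < 1" | "ks = []" using assms unfolding polylog_converges_def by fastforce
  then show ?thesis
  proof cases
    case 1
    then show ?thesis using assms by (intro summable_polylog) (auto simp: polylog_converges_def)
  next
    case 2
    then show ?thesis by (intro summable_finite[of "{0}"]) auto
  qed
qed

text \<open>The closed interval includes the end point \<open>1\<close> for a first exponent of at least \<open>2\<close>; the uniform
  bound by the series at \<open>y\<close> treats it like any other \<open>y\<close>.\<close>

lemma continuous_on_polylog:
  assumes "polylog_converges ks y" shows "continuous_on {0..y} (polylog ks)"
proof -
  have "uniform_limit {0..y} (\<lambda>n z. \<Sum>i<n. li_coeff ks i * z ^ i)
          (\<lambda>z. \<Sum>i. li_coeff ks i * z ^ i) sequentially"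
    by (rule Weierstrass_m_test[OF _ summable_polylog_converges[OF assms]])
       (auto simp: abs_mult li_coeff_nonneg power_abs intro!: mult_left_mono power_mono)
  then show ?thesis
    unfolding polylog_def
    by (rule uniform_limit_theorem[rotated]) (auto intro!: continuous_intros always_eventually)
qed

lemma polylog_nonneg:
  assumes "polylog_converges ks y" shows "0 \<le> polylog ks y"
  unfolding polylog_def using assms
  by (intro suminf_nonneg summable_polylog_converges)
     (auto simp: li_coeff_nonneg polylog_converges_def)

lemma polylog_Nil [simp]: "polylog [] z = 1"
proof -
  have "(\<lambda>n. li_coeff [] n * z ^ n) sums (\<Sum>n\<in>{0}. li_coeff [] n * z ^ n)"
    by (rule sums_finite) auto
  then show ?thesis by (simp add: polylog_def sums_iff)
qed

lemma polylog_0: "ks \<noteq> [] \<Longrightarrow> polylog ks 0 = 0"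
  unfolding polylog_def by (cases ks) simp_all

text \<open>Multiplication of the coefficients by \<open>n\<close> is the operator \<open>z d/dz\<close>. Polylogarithms and the central
  binomial series are both linked by it.\<close>

lemma powser_theta_deriv:
  fixes f g :: "nat \<Rightarrow> real"
  assumes "\<And>n. real n * f n = g n" "\<And>z. \<bar>z\<bar> < 1 \<Longrightarrow> summable (\<lambda>n. f n * z ^ n)"
    and "\<And>z. \<bar>z\<bar> < 1 \<Longrightarrow> summable (\<lambda>n. g n * z ^ n)" and "0 < z" "z < 1"
  shows "((\<lambda>z. \<Sum>n. f n * z ^ n) has_real_derivative (\<Sum>n. g n * z ^ n) / z) (at z)"
proof -
  have g0: "g 0 = 0" using assms(1)[of 0] by simp
  have "(\<lambda>n. g n * z ^ n) sums (\<Sum>n. g n * z ^ n)"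
    using assms by (intro summable_sums) auto
  then have "(\<lambda>n. g (Suc n) * z ^ Suc n) sums (\<Sum>n. g n * z ^ n)"
    by (subst sums_Suc_iff) (simp add: g0)
  then have "(\<lambda>n. g (Suc n) * z ^ Suc n / z) sums ((\<Sum>n. g n * z ^ n) / z)"
    by (rule sums_divide)
  also have "(\<lambda>n. g (Suc n) * z ^ Suc n / z) = (\<lambda>n. diffs f n * z ^ n)"
    unfolding diffs_def of_nat_Suc[symmetric] assms(1) using assms(4) by (simp add: fun_eq_iff)
  finally have "(\<Sum>n. diffs f n * z ^ n) = (\<Sum>n. g n * z ^ n) / z" by (simp add: sums_iff)
  moreover have "((\<lambda>z. \<Sum>n. f n * z ^ n) has_real_derivative (\<Sum>n. diffs f n * z ^ n)) (at z)"
    by (rule termdiffs_strong'[where K = 1]) (use assms in auto)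
  ultimately show ?thesis by simp
qed

lemma polylog_has_diffs_derivative:
  assumes "composition ks" "\<bar>z\<bar> < 1"
  shows "(polylog ks has_real_derivative (\<Sum>n. diffs (li_coeff ks) n * z ^ n)) (at z)"
  unfolding polylog_def
  by (rule termdiffs_strong'[where K = 1]) (use assms summable_polylog in auto)

lemma polylog_deriv_Suc:
  assumes "composition (Suc k # ks)" "0 < z" "z < 1"
  shows "(polylog (Suc (Suc k) # ks) has_real_derivative polylog (Suc k # ks) z / z) (at z)"
  unfolding polylog_def
  by (rule powser_theta_deriv[OF li_coeff_Suc])
    (use assms in \<open>auto intro!: summable_polylog simp: composition_def simp del: li_coeff.simps\<close>)

text \<open>The coefficients of the derivative are partial sums, that is, a Cauchy product with the geometric
  series.\<close>

lemma polylog_deriv_one: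
  assumes "composition ks" "0 \<le> z" "z < 1"
  shows "(polylog (1 # ks) has_real_derivative polylog ks z / (1 - z)) (at z)"
proof -
  have c: "composition (1 # ks)" using assms(1) by (simp add: composition_def)
  have s: "summable (\<lambda>n. norm (li_coeff ks n * z ^ n))"
    using summable_polylog[OF assms(1), of z] assms li_coeff_nonneg[of ks] by (simp add: abs_mult)
  have g: "summable (\<lambda>n. norm (z ^ n))" using assms by (simp add: summable_geometric)
  have "(\<lambda>n. \<Sum>i\<le>n. li_coeff ks i * z ^ i * z ^ (n - i)) sums
      ((\<Sum>n. li_coeff ks n * z ^ n) * (\<Sum>n. z ^ n))"
    by (rule Cauchy_product_sums[OF s g])
  also have "(\<lambda>n. \<Sum>i\<le>n. li_coeff ks i * z ^ i * z ^ (n - i)) = (\<lambda>n. diffs (li_coeff (1 # ks)) n * z ^ n)"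
    by (auto simp: fun_eq_iff diffs_def lessThan_Suc_atMost sum_distrib_right mult.assoc
        simp flip: power_add)
  also have "(\<Sum>n. li_coeff ks n * z ^ n) * (\<Sum>n. z ^ n) = polylog ks z / (1 - z)"
    using assms by (simp add: polylog_def suminf_geometric)
  finally show ?thesis
    using polylog_has_diffs_derivative[OF c, of z] assms by (simp add: sums_iff del: li_coeff.simps)
qed

definition strict_indices :: "nat \<Rightarrow> nat \<Rightarrow> nat list set" where
  "strict_indices r n = {ns. length ns = r \<and> sorted_wrt (>) ns \<and> set ns \<subseteq> {1..<n}}"

lemma strict_indices_0: "strict_indices 0 n = {[]}"
  by (auto simp: strict_indices_def)

lemma strict_indices_Suc:
  "strict_indices (Suc r) n = (\<Union>l\<in>{1..<n}. (\<lambda>ns. l # ns) ` strict_indices r l)"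
proof (rule set_eqI)
  fix ns
  show "ns \<in> strict_indices (Suc r) n \<longleftrightarrow> ns \<in> (\<Union>l\<in>{1..<n}. (\<lambda>ns. l # ns) ` strict_indices r l)"
    by (cases ns) (auto simp: strict_indices_def image_iff subset_iff intro: order_less_trans)
qed

lemma finite_strict_indices: "finite (strict_indices r n)"
  by (induction r arbitrary: n) (auto simp: strict_indices_0 strict_indices_Suc)

lemma sum_strict_indices:
  assumes "n \<ge> 1"
  shows "(\<Sum>ns\<in>strict_indices (length ks) n. 1 / monomial_denom ks ns) = (\<Sum>h<n. li_coeff ks h)"
  using assms
proof (induction ks arbitrary: n)
  case Nil
  have "(\<Sum>h<n. li_coeff [] h) = (\<Sum>h\<in>{0}. li_coeff [] h)"
    using Nil by (intro sum.mono_neutral_right) auto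
  then show ?case by (simp add: strict_indices_0 monomial_denom_def)
next
  case (Cons k ks)
  have "(\<Sum>ns\<in>strict_indices (length (k # ks)) n. 1 / monomial_denom (k # ks) ns) =
      (\<Sum>l=1..<n. \<Sum>ns\<in>(\<lambda>ns. l # ns) ` strict_indices (length ks) l. 1 / monomial_denom (k # ks) ns)"
    unfolding list.size(4) add_Suc_right add_0_right strict_indices_Suc
    by (intro sum.UNION_disjoint) (auto simp: finite_strict_indices)
  also have "\<dots> = (\<Sum>l=1..<n. \<Sum>ns\<in>strict_indices (length ks) l. (1 / monomial_denom ks ns) / real l ^ k)"
    by (intro sum.cong refl sum.reindex_cong[OF _ refl])
       (auto simp: inj_on_def monomial_denom_Cons mult.commute)
  also have "\<dots> = (\<Sum>l=1..<n. li_coeff (k # ks) l)"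
    unfolding sum_divide_distrib[symmetric] by (intro sum.cong refl) (auto simp: Cons.IH)
  also have "\<dots> = (\<Sum>l<n. li_coeff (k # ks) l)"
    using Cons.prems by (intro sum.mono_neutral_left) (auto simp: not_le Suc_le_eq)
  finally show ?case .
qed

text \<open>All terms are nonnegative, so the unconditional sum may be grouped by its largest index.\<close>

lemma multi_polylog_eq_polylog:
  assumes "polylog_converges ks z" shows "multi_polylog ks z = polylog ks z"
proof (cases ks)
  case Nil
  then show ?thesis by (simp add: multi_polylog_def)
next
  case (Cons k ks')
  have z: "0 \<le> z" using assms by (simp add: polylog_converges_def)
  define f where "f = (\<lambda>(n, ns). z ^ n / monomial_denom ks (n # ns))"
  have set_eq: "{ns. length ns = length ks \<and> sorted_wrt (>) ns \<and> (\<forall>n\<in>set ns. 0 < n)} =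
      (\<lambda>(n, ns). n # ns) ` Sigma {1..} (strict_indices (length ks'))" (is "?L = ?R")
  proof (rule set_eqI)
    fix ns show "ns \<in> ?L \<longleftrightarrow> ns \<in> ?R"
      by (cases ns) (auto simp: Cons strict_indices_def image_iff subset_iff Suc_le_eq)
  qed
  have outer: "((\<lambda>n. li_coeff ks n * z ^ n) has_sum polylog ks z) {1..}"
  proof -
    have "((\<lambda>n. li_coeff ks n * z ^ n) has_sum polylog ks z) UNIV"
      unfolding polylog_def using summable_polylog_converges[OF assms] z
      by (intro sums_nonneg_imp_has_sum summable_sums) (auto simp: li_coeff_nonneg)
    then show ?thesis
      by (rule has_sum_cong_neutral[THEN iffD1, rotated -1]) (auto simp: Cons)
  qed
  have inner: "((\<lambda>ns. f (n, ns)) has_sum li_coeff ks n * z ^ n) (strict_indices (length ks') n)"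
    if "n \<in> {1..}" for n
  proof -
    have "(\<Sum>ns\<in>strict_indices (length ks') n. f (n, ns)) =
        z ^ n / real n ^ k * (\<Sum>ns\<in>strict_indices (length ks') n. 1 / monomial_denom ks' ns)"
      by (simp add: f_def Cons monomial_denom_Cons sum_distrib_left)
    also have "\<dots> = li_coeff ks n * z ^ n"
      using that by (simp add: sum_strict_indices Cons)
    finally show ?thesis using has_sum_finite[OF finite_strict_indices] by metis
  qed
  have "f summable_on Sigma {1..} (strict_indices (length ks'))"
    using has_sum_imp_summable[OF outer] z
    by (intro summable_on_SigmaI[OF inner]) (auto simp: f_def monomial_denom_def intro!: prod_nonneg divide_nonneg_nonneg)
  from has_sum_SigmaI[OF inner outer this]
  have "(f has_sum polylog ks z) (Sigma {1..} (strict_indices (length ks')))" .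
  then have "infsum f (Sigma {1..} (strict_indices (length ks'))) = polylog ks z" by (rule infsumI)
  moreover have "inj_on (\<lambda>(n, ns). n # ns) (Sigma {1..} (strict_indices (length ks')))"
    by (auto simp: inj_on_def)
  ultimately show ?thesis
    unfolding multi_polylog_def set_eq
    by (simp add: infsum_reindex Cons o_def f_def case_prod_beta')
qed

section \<open>Iterated integrals over words of one-forms\<close>

text \<open>The head of the word is the outermost form, and the function \<open>h\<close> is integrated innermost. Values
  in \<open>[0,\<infinity>]\<close> make integrability conditions unnecessary. The absolute value matters for the label
  \<open>-1\<close>, whose form is negative.\<close>

fun iter_int :: "int list \<Rightarrow> (real \<Rightarrow> ennreal) \<Rightarrow> real \<Rightarrow> ennreal" where
  "iter_int [] h y = h y"
| "iter_int (d # w) h y =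
     (\<integral>\<^sup>+t. indicator {0<..<y} t * (ennreal \<bar>form_coeff d t\<bar> * iter_int w h t) \<partial>lborel)"

lemma measurable_form_coeff [measurable]: "form_coeff d \<in> borel_measurable borel"
  unfolding form_coeff_def by measurable

lemma indicator_Ioo_eq: "(indicator {0<..<y} t :: ennreal) = (if 0 < t \<and> t < y then 1 else 0)" for t y :: real
  by (simp split: split_indicator)

lemma measurable_iter_int [measurable]:
  assumes [measurable]: "h \<in> borel_measurable borel"
  shows "iter_int w h \<in> borel_measurable borel"
proof (induction w)
  case (Cons d w)
  note [measurable] = Cons
  have "(\<lambda>y. \<integral>\<^sup>+t. (if 0 < t \<and> t < y then 1 else 0) * (ennreal \<bar>form_coeff d t\<bar> * iter_int w h t) \<partial>lborel)
      \<in> borel_measurable borel"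
    by measurable
  then show ?case by (simp add: indicator_Ioo_eq)
qed (use assms in simp)

lemma iter_int_cong:
  assumes "w \<noteq> []" "\<And>t. 0 < t \<Longrightarrow> t < y \<Longrightarrow> h t = h' t"
  shows "iter_int w h y = iter_int w h' y"
  using assms
proof (induction w arbitrary: y)
  case (Cons d w)
  have "iter_int w h t = iter_int w h' t" if "0 < t" "t < y" for t
    using Cons that by (cases "w = []") auto
  then show ?case by (auto intro!: nn_integral_cong split: split_indicator)
qed simp

text \<open>Tonelli's theorem moves the innermost variable to the outside. Joint measurability of the kernel in
  both variables is what the induction has to carry along.\<close>

lemma iter_int_kernel:
  assumes "w \<noteq> []"
  shows "\<exists>K. (\<lambda>(y, s). K y s) \<in> borel_measurable (borel \<Otimes>\<^sub>M borel) \<and>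
    (\<forall>h\<in>borel_measurable borel. \<forall>y. iter_int w h y = (\<integral>\<^sup>+s. K y s * h s \<partial>lborel))"
  using assms
proof (induction w rule: list_nonempty_induct)
  case (single d)
  have "(\<lambda>(y, s). (if 0 < s \<and> s < y then 1 else 0) * ennreal \<bar>form_coeff d s\<bar>)
      \<in> borel_measurable (borel \<Otimes>\<^sub>M borel)" by measurable
  then show ?case
    by (intro exI[of _ "\<lambda>y s. indicator {0<..<y} s * ennreal \<bar>form_coeff d s\<bar>"])
       (simp add: indicator_Ioo_eq mult.assoc)
next
  case (cons d w)
  then obtain K where K [measurable]: "(\<lambda>(y, s). K y s) \<in> borel_measurable (borel \<Otimes>\<^sub>M borel)"
    and eq: "\<And>h y. h \<in> borel_measurable borel \<Longrightarrow> iter_int w h y = (\<integral>\<^sup>+s. K y s * h s \<partial>lborel)"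
    by blast
  define K' where "K' = (\<lambda>y s. \<integral>\<^sup>+t. (if 0 < t \<and> t < y then 1 else 0) *
      (ennreal \<bar>form_coeff d t\<bar> * K t s) \<partial>lborel)"
  have "(\<lambda>(y, s). K' y s) \<in> borel_measurable (borel \<Otimes>\<^sub>M borel)"
    unfolding K'_def by measurable
  moreover have "iter_int (d # w) h y = (\<integral>\<^sup>+s. K' y s * h s \<partial>lborel)"
    if [measurable]: "h \<in> borel_measurable borel" for h y
  proof -
    have "iter_int (d # w) h y = (\<integral>\<^sup>+t. \<integral>\<^sup>+s. (if 0 < t \<and> t < y then 1 else 0) *
        (ennreal \<bar>form_coeff d t\<bar> * (K t s * h s)) \<partial>lborel \<partial>lborel)"
      by (simp add: eq indicator_Ioo_eq nn_integral_cmult)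
    also have "\<dots> = (\<integral>\<^sup>+s. \<integral>\<^sup>+t. (if 0 < t \<and> t < y then 1 else 0) *
        (ennreal \<bar>form_coeff d t\<bar> * (K t s * h s)) \<partial>lborel \<partial>lborel)"
      by (rule lborel_pair.Fubini') measurable
    also have "\<dots> = (\<integral>\<^sup>+s. K' y s * h s \<partial>lborel)"
      unfolding K'_def by (intro nn_integral_cong) (simp add: nn_integral_multc[symmetric] mult.assoc)
    finally show ?thesis .
  qed
  ultimately show ?case by blast
qed

text \<open>An iterated integral is a linear functional of its innermost function; as integration against a
  measure it also applies to functions of either sign and commutes with nonnegative series.\<close>

lemma iter_int_measure:
  assumes "w \<noteq> []"
  obtains M where "sets M = sets borel"
    "\<And>h. h \<in> borel_measurable borel \<Longrightarrow> iter_int w h y = (\<integral>\<^sup>+s. h s \<partial>M)"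
    "AE s in M. 0 < s \<and> s < y"
proof -
  obtain K where K [measurable]: "(\<lambda>(y, s). K y s) \<in> borel_measurable (borel \<Otimes>\<^sub>M borel)"
    and eq: "\<And>h y. h \<in> borel_measurable borel \<Longrightarrow> iter_int w h y = (\<integral>\<^sup>+s. K y s * h s \<partial>lborel)"
    using iter_int_kernel[OF assms] by blast
  define M where "M = density lborel (K y)"
  have [measurable]: "K y \<in> borel_measurable borel" by measurable
  have M: "iter_int w h y = (\<integral>\<^sup>+s. h s \<partial>M)" if [measurable]: "h \<in> borel_measurable borel" for h
    unfolding M_def by (subst nn_integral_density) (simp_all add: eq)
  have sets: "sets M = sets borel" by (simp add: M_def)
  \<comment> \<open>The measure lives on the range of the innermost variable.\<close>
  have "iter_int w (indicator (- {0<..<y})) y = iter_int w (\<lambda>_. 0) y"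
    by (rule iter_int_cong[OF assms]) auto
  also have "\<dots> = 0" by (simp add: M)
  finally have "(\<integral>\<^sup>+s. indicator (- {0<..<y}) s \<partial>M) = 0" by (simp add: M)
  then have "AE s in M. indicator (- {0<..<y}) s = (0 :: ennreal)"
    using sets by (subst (asm) nn_integral_0_iff_AE) (auto simp: M_def)
  then have "AE s in M. 0 < s \<and> s < y"
    by eventually_elim (auto split: split_indicator_asm)
  with sets M show thesis by (rule that)
qed

text \<open>The derivative is required only inside the interval, since at the end points it may be unbounded:
  at \<open>0\<close> because of \<open>1/t\<close>, and at \<open>1\<close> because of powers of the logarithm.\<close>

lemma nn_integral_FTC_open:
  assumes "0 \<le> y" "continuous_on {0..y} F" "F 0 = 0"
    and deriv: "\<And>t. 0 < t \<Longrightarrow> t < y \<Longrightarrow> (F has_real_derivative f t) (at t)"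
    and nonneg: "\<And>t. 0 < t \<Longrightarrow> t < y \<Longrightarrow> 0 \<le> f t"
  shows "(\<integral>\<^sup>+t. indicator {0<..<y} t * ennreal (f t) \<partial>lborel) = ennreal (F y)" and "0 \<le> F y"
proof -
  have "(f has_integral (F y - F 0)) {0..y}"
    using assms by (intro fundamental_theorem_of_calculus_interior)
      (auto simp: has_real_derivative_iff_has_vector_derivative)
  then have "(f has_integral F y) {0<..<y}"
    using assms(3) by (simp add: has_integral_Icc_iff_Ioo)
  then show "0 \<le> F y" by (rule has_integral_nonneg) (use nonneg in auto)
  from \<open>(f has_integral F y) {0<..<y}\<close> have "(\<integral>\<^sup>+t. indicator {0<..<y} t * f t \<partial>lborel) = ennreal (F y)"
    using nonneg by (intro nn_integral_has_integral_lebesgue) auto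
  moreover have "ennreal (indicator {0<..<y} t * f t) = indicator {0<..<y} t * ennreal (f t)" for t
    by (simp split: split_indicator)
  ultimately show "(\<integral>\<^sup>+t. indicator {0<..<y} t * ennreal (f t) \<partial>lborel) = ennreal (F y)" by simp
qed

lemma iter_int_FTC:
  assumes "0 \<le> y" "continuous_on {0..y} F" "F 0 = 0"
    and "\<And>t. 0 < t \<Longrightarrow> t < y \<Longrightarrow> iter_int w h t = ennreal (G t)"
    and "\<And>t. 0 < t \<Longrightarrow> t < y \<Longrightarrow> 0 \<le> G t"
    and "\<And>t. 0 < t \<Longrightarrow> t < y \<Longrightarrow> (F has_real_derivative \<bar>form_coeff d t\<bar> * G t) (at t)"
  shows "iter_int (d # w) h y = ennreal (F y)" and "0 \<le> F y"
proof -
  have "iter_int (d # w) h y = (\<integral>\<^sup>+t. indicator {0<..<y} t * ennreal (\<bar>form_coeff d t\<bar> * G t) \<partial>lborel)"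
    using assms(4,5) by (auto intro!: nn_integral_cong simp: ennreal_mult split: split_indicator)
  also have "\<dots> = ennreal (F y)"
    by (rule nn_integral_FTC_open(1)) (use assms in auto)
  finally show "iter_int (d # w) h y = ennreal (F y)" .
  show "0 \<le> F y"
    by (rule nn_integral_FTC_open(2)[OF assms(1-3)]) (use assms in auto)
qed

lemma nn_integral_square_substitution:
  assumes [measurable]: "f \<in> borel_measurable borel" and "0 \<le> y"
  shows "(\<integral>\<^sup>+t. indicator {0<..<sqrt y} t * (ennreal (2 * t) * f (t\<^sup>2)) \<partial>lborel) =
    (\<integral>\<^sup>+s. indicator {0<..<y} s * f s \<partial>lborel)"
proof (cases "y = 0")
  case False
  with assms have y: "0 < sqrt y" by simp
  have "(\<integral>\<^sup>+t. indicator {0<..<sqrt y} t * (ennreal (2 * t) * f (t\<^sup>2)) \<partial>lborel) =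
      (\<integral>\<^sup>+t. f (t\<^sup>2) * ennreal (2 * t) * indicator {0..sqrt y} t \<partial>lborel)"
    using AE_lborel_singleton[of 0] AE_lborel_singleton[of "sqrt y"]
    by (intro nn_integral_cong_AE, eventually_elim) (auto simp: mult.commute split: split_indicator)
  also have "\<dots> = (\<integral>\<^sup>+s. f s * indicator {0\<^sup>2..(sqrt y)\<^sup>2} s \<partial>lborel)"
    by (rule nn_integral_substitution_aux[symmetric, OF _ _ _ _ _ y])
       (auto intro!: derivative_eq_intros continuous_intros)
  also have "\<dots> = (\<integral>\<^sup>+s. indicator {0<..<y} s * f s \<partial>lborel)"
    using AE_lborel_singleton[of 0] AE_lborel_singleton[of y]
    by (intro nn_integral_cong_AE, eventually_elim)
       (use assms(2) in \<open>auto simp: mult.commute split: split_indicator\<close>)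
  finally show ?thesis .
qed simp

text \<open>The label of the one-form in the variable \<open>s = t\<^sup>2\<close>.\<close>

definition squared_label :: "int \<Rightarrow> int" where
  "squared_label d = (if d = -2 then 1 else d)"

lemma iter_int_sqrt_step:
  assumes [measurable]: "f \<in> borel_measurable borel" and "0 \<le> y" "y \<le> 1" and d: "d \<in> {0, -2}"
  shows "(\<integral>\<^sup>+t. indicator {0<..<sqrt y} t * (ennreal \<bar>form_coeff d t\<bar> * f t) \<partial>lborel) =
    ennreal (if d = 0 then 1/2 else 1) *
      (\<integral>\<^sup>+s. indicator {0<..<y} s * (ennreal \<bar>form_coeff (squared_label d) s\<bar> * f (sqrt s)) \<partial>lborel)"
proof -
  define c :: real where "c = (if d = 0 then 1/2 else 1)"
  have c: "0 \<le> c" by (simp add: c_def)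
  have "\<bar>form_coeff d t\<bar> = c * (2 * t * \<bar>form_coeff (squared_label d) (t\<^sup>2)\<bar>)"
    if t: "0 < t" "t < sqrt y" for t
  proof -
    have "t < 1" using t assms by (meson order_less_le_trans real_sqrt_le_1_iff)
    then have "t\<^sup>2 < 1" using t by (simp add: power_less_one_iff)
    then show ?thesis
      using d t by (auto simp: form_coeff_def squared_label_def c_def power2_eq_square abs_mult)
  qed
  then have "(\<integral>\<^sup>+t. indicator {0<..<sqrt y} t * (ennreal \<bar>form_coeff d t\<bar> * f t) \<partial>lborel) =
      (\<integral>\<^sup>+t. ennreal c * (indicator {0<..<sqrt y} t *
        (ennreal (2 * t) * (ennreal \<bar>form_coeff (squared_label d) (t\<^sup>2)\<bar> * f (sqrt (t\<^sup>2))))) \<partial>lborel)"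
    using c by (intro nn_integral_cong) (auto split: split_indicator simp: ennreal_mult mult.assoc)
  also have "\<dots> = ennreal c * (\<integral>\<^sup>+t. (indicator {0<..<sqrt y} t *
        (ennreal (2 * t) * (ennreal \<bar>form_coeff (squared_label d) (t\<^sup>2)\<bar> * f (sqrt (t\<^sup>2))))) \<partial>lborel)"
    by (rule nn_integral_cmult) measurable
  also have "(\<integral>\<^sup>+t. (indicator {0<..<sqrt y} t *
        (ennreal (2 * t) * (ennreal \<bar>form_coeff (squared_label d) (t\<^sup>2)\<bar> * f (sqrt (t\<^sup>2))))) \<partial>lborel) =
      (\<integral>\<^sup>+s. indicator {0<..<y} s * (ennreal \<bar>form_coeff (squared_label d) s\<bar> * f (sqrt s)) \<partial>lborel)"
    using assms(2) by (subst nn_integral_square_substitution[symmetric]) simp_all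
  finally show ?thesis unfolding c_def .
qed

text \<open>With \<open>s = t\<^sup>2\<close> one has \<open>dt/t = ds/(2s)\<close> and \<open>2t dt/(1-t\<^sup>2) = ds/(1-s)\<close>, so each label \<open>0\<close> costs a
  factor \<open>1/2\<close>.\<close>

lemma iter_int_sqrt:
  assumes [measurable]: "h \<in> borel_measurable borel" and "0 \<le> y" "y \<le> 1" "set w \<subseteq> {0, -2}"
  shows "iter_int w h (sqrt y) =
    ennreal ((1/2) ^ count_list w 0) * iter_int (map squared_label w) (\<lambda>s. h (sqrt s)) y"
  using assms(2-)
proof (induction w arbitrary: y)
  case (Cons d w)
  let ?c = "ennreal ((1/2) ^ count_list w 0)"
  have d: "d \<in> {0, -2}" using Cons.prems by auto
  have "iter_int (d # w) h (sqrt y) = ennreal (if d = 0 then 1/2 else 1) *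
      (\<integral>\<^sup>+s. indicator {0<..<y} s * (ennreal \<bar>form_coeff (squared_label d) s\<bar> * iter_int w h (sqrt s)) \<partial>lborel)"
    using Cons.prems d unfolding iter_int.simps by (intro iter_int_sqrt_step) auto
  also have "(\<integral>\<^sup>+s. indicator {0<..<y} s * (ennreal \<bar>form_coeff (squared_label d) s\<bar> * iter_int w h (sqrt s)) \<partial>lborel) =
      (\<integral>\<^sup>+s. ?c * (indicator {0<..<y} s * (ennreal \<bar>form_coeff (squared_label d) s\<bar> *
         iter_int (map squared_label w) (\<lambda>s. h (sqrt s)) s)) \<partial>lborel)"
    using Cons by (intro nn_integral_cong) (auto split: split_indicator simp: mult_ac)
  also have "\<dots> = ?c * iter_int (map squared_label (d # w)) (\<lambda>s. h (sqrt s)) y"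
    by (simp add: nn_integral_cmult)
  finally have "iter_int (d # w) h (sqrt y) = (ennreal (if d = 0 then 1/2 else 1) * ?c) *
      iter_int (map squared_label (d # w)) (\<lambda>s. h (sqrt s)) y"
    by (simp only: mult.assoc)
  also have "ennreal (if d = 0 then 1/2 else 1) * ?c = ennreal ((1/2) ^ count_list (d # w) 0)"
    by (subst ennreal_mult[symmetric]) auto
  finally show ?case .
qed simp

section \<open>Integrals over finite posets\<close>

text \<open>The range \<open>D\<close> of the values is a parameter because removing a largest element leaves the half-open
  interval below its value in place of the closed one of \<^const>\<open>poset_domain\<close>.\<close>

definition monotone_domain :: "real set \<Rightarrow> 'a set \<Rightarrow> ('a \<times> 'a) set \<Rightarrow> ('a \<Rightarrow> real) set" where
  "monotone_domain D X R = {t \<in> X \<rightarrow>\<^sub>E D. \<forall>a\<in>X. \<forall>b\<in>X. (a, b) \<in> R \<longrightarrow> t a < t b}"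

definition poset_nn_integral :: "real set \<Rightarrow> 'a set \<Rightarrow> ('a \<times> 'a) set \<Rightarrow> ('a \<Rightarrow> int) \<Rightarrow> ennreal" where
  "poset_nn_integral D X R \<delta> =
     (\<integral>\<^sup>+t. indicator (monotone_domain D X R) t * (\<Prod>a\<in>X. ennreal \<bar>form_coeff (\<delta> a) (t a)\<bar>)
        \<partial>(\<Pi>\<^sub>M a\<in>X. lborel))"

lemma measurable_monotone_domain:
  assumes "finite X" and [measurable]: "D \<in> sets borel"
  shows "monotone_domain D X R \<in> sets (\<Pi>\<^sub>M a\<in>X. lborel)"
proof -
  have [measurable]: "countable X" by (rule countable_finite[OF assms(1)])
  have "monotone_domain D X R = {t \<in> space (\<Pi>\<^sub>M a\<in>X. lborel). (\<forall>a\<in>X. t a \<in> D) \<and>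
      (\<forall>a\<in>X. \<forall>b\<in>X. (a, b) \<in> R \<longrightarrow> t a < t b)}"
    by (auto simp: monotone_domain_def space_PiM PiE_iff)
  also have "\<dots> \<in> sets (\<Pi>\<^sub>M a\<in>X. lborel)"
    using assms(1) by measurable
  finally show ?thesis .
qed

lemma measurable_poset_integrand:
  assumes "finite X" "D \<in> sets borel"
  shows "(\<lambda>t. indicator (monotone_domain D X R) t * (\<Prod>a\<in>X. ennreal \<bar>form_coeff (\<delta> a) (t a)\<bar>))
    \<in> borel_measurable (\<Pi>\<^sub>M a\<in>X. lborel)"
proof -
  note [measurable] = measurable_monotone_domain[OF assms, of R]
  show ?thesis by measurable
qed

lemma product_sigma_finite_lborel: "product_sigma_finite (\<lambda>_. lborel :: real measure)"
  by (simp add: product_sigma_finite_def sigma_finite_lborel)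

lemma poset_nn_integral_empty: "poset_nn_integral D {} R \<delta> = 1"
  by (simp add: poset_nn_integral_def monotone_domain_def PiM_empty
      nn_integral_count_space_finite)

text \<open>The value at a largest element is the upper bound for all other values. Whether \<open>D\<close> contains \<open>z\<close>
  only matters on a null set.\<close>

lemma poset_nn_integral_insert_top:
  assumes "finite X" "a \<notin> X" "(a, a) \<notin> R"
    and below: "\<And>b. b \<in> X \<Longrightarrow> (b, a) \<in> R \<and> (a, b) \<notin> R"
    and D: "D \<in> sets borel" "{0..<z} \<subseteq> D" "D \<subseteq> {0..z}"
  shows "poset_nn_integral D (insert a X) R \<delta> =
    (\<integral>\<^sup>+y. indicator {0<..<z} y * (ennreal \<bar>form_coeff (\<delta> a) y\<bar> * poset_nn_integral {0..<y} X R \<delta>) \<partial>lborel)"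
proof -
  interpret product_sigma_finite "\<lambda>_. lborel :: real measure" by (rule product_sigma_finite_lborel)
  let ?w = "\<lambda>t. \<Prod>b\<in>X. ennreal \<bar>form_coeff (\<delta> b) (t b)\<bar>"
  have "poset_nn_integral D (insert a X) R \<delta> = (\<integral>\<^sup>+y. \<integral>\<^sup>+x.
      indicator (monotone_domain D (insert a X) R) (x(a := y)) *
      (\<Prod>b\<in>insert a X. ennreal \<bar>form_coeff (\<delta> b) ((x(a := y)) b)\<bar>) \<partial>(\<Pi>\<^sub>M a\<in>X. lborel) \<partial>lborel)"
    unfolding poset_nn_integral_def
    using assms measurable_poset_integrand[of "insert a X" D R \<delta>]
    by (subst product_nn_integral_insert_rev) auto
  also have "\<dots> = (\<integral>\<^sup>+y. indicator D y * (ennreal \<bar>form_coeff (\<delta> a) y\<bar> *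
      poset_nn_integral {0..<y} X R \<delta>) \<partial>lborel)"
  proof (rule nn_integral_cong)
    fix y :: real
    have dom: "indicator (monotone_domain D (insert a X) R) (x(a := y)) =
        indicator D y * (indicator (monotone_domain {0..<y} X R) x :: ennreal)"
      if x: "x \<in> space (\<Pi>\<^sub>M a\<in>X. lborel)" for x
    proof -
      have "x(a := y) \<in> monotone_domain D (insert a X) R \<longleftrightarrow> y \<in> D \<and> x \<in> monotone_domain {0..<y} X R"
        (is "?L \<longleftrightarrow> ?R")
      proof
        assume L: ?L
        then have y: "y \<in> D" by (auto simp: monotone_domain_def PiE_iff)
        have xb: "x b \<in> {0..<y}" if "b \<in> X" for b
        proof -
          have "b \<noteq> a" using that assms by auto
          then have "x b \<in> D" "x b < y"
            using L that below[OF that] by (fastforce simp: monotone_domain_def PiE_iff)+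
          then show ?thesis using D by auto
        qed
        have "x b < x c" if "b \<in> X" "c \<in> X" "(b, c) \<in> R" for b c
        proof -
          have "b \<noteq> a" "c \<noteq> a" using that assms by auto
          then show ?thesis using L that by (fastforce simp: monotone_domain_def)
        qed
        with y xb x show ?R by (auto simp: monotone_domain_def PiE_iff space_PiM)
      next
        assume R: ?R
        have "x b \<in> D" if "b \<in> X" for b
        proof -
          have "x b \<in> {0..<y}" using R that by (auto simp: monotone_domain_def)
          moreover have "y \<le> z" using R D by auto
          ultimately show ?thesis using D by auto
        qed
        moreover have "x b < y" if "b \<in> X" for b
          using R that by (auto simp: monotone_domain_def)
        ultimately show ?L
          using R x below assms(2,3) by (auto simp: monotone_domain_def PiE_iff space_PiM extensional_def)
      qed
      then show ?thesis by (simp add: indicator_def)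
    qed
    have prod: "(\<Prod>b\<in>insert a X. ennreal \<bar>form_coeff (\<delta> b) ((x(a := y)) b)\<bar>) =
        ennreal \<bar>form_coeff (\<delta> a) y\<bar> * ?w x" for x
    proof -
      have "(\<Prod>b\<in>X. ennreal \<bar>form_coeff (\<delta> b) ((x(a := y)) b)\<bar>) = ?w x"
        using assms by (intro prod.cong) auto
      then show ?thesis using assms by simp
    qed
    have "(\<integral>\<^sup>+x. indicator (monotone_domain D (insert a X) R) (x(a := y)) *
        (\<Prod>b\<in>insert a X. ennreal \<bar>form_coeff (\<delta> b) ((x(a := y)) b)\<bar>) \<partial>(\<Pi>\<^sub>M a\<in>X. lborel)) =
      (\<integral>\<^sup>+x. (indicator D y * ennreal \<bar>form_coeff (\<delta> a) y\<bar>) *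
        (indicator (monotone_domain {0..<y} X R) x * ?w x) \<partial>(\<Pi>\<^sub>M a\<in>X. lborel))"
      unfolding prod by (intro nn_integral_cong) (simp add: dom mult_ac)
    also have "\<dots> = (indicator D y * ennreal \<bar>form_coeff (\<delta> a) y\<bar>) * poset_nn_integral {0..<y} X R \<delta>"
      unfolding poset_nn_integral_def using assms
      by (intro nn_integral_cmult measurable_poset_integrand) auto
    finally show "(\<integral>\<^sup>+x. indicator (monotone_domain D (insert a X) R) (x(a := y)) *
        (\<Prod>b\<in>insert a X. ennreal \<bar>form_coeff (\<delta> b) ((x(a := y)) b)\<bar>) \<partial>(\<Pi>\<^sub>M a\<in>X. lborel)) =
        indicator D y * (ennreal \<bar>form_coeff (\<delta> a) y\<bar> * poset_nn_integral {0..<y} X R \<delta>)"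
      by (simp add: mult.assoc)
  qed
  also have "\<dots> = (\<integral>\<^sup>+y. indicator {0<..<z} y * (ennreal \<bar>form_coeff (\<delta> a) y\<bar> *
      poset_nn_integral {0..<y} X R \<delta>) \<partial>lborel)"
    using AE_lborel_singleton[of 0] AE_lborel_singleton[of z]
    by (intro nn_integral_cong_AE, eventually_elim)
       (use D in \<open>auto simp: subset_iff split: split_indicator\<close>)
  finally show ?thesis .
qed

lemma poset_nn_integral_Un:
  assumes "finite X" "finite Y" "X \<inter> Y = {}" "D \<in> sets borel"
    and unrelated: "\<And>a b. a \<in> X \<Longrightarrow> b \<in> Y \<Longrightarrow> (a, b) \<notin> R \<and> (b, a) \<notin> R"
  shows "poset_nn_integral D (X \<union> Y) R \<delta> = poset_nn_integral D X R \<delta> * poset_nn_integral D Y R \<delta>"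
proof -
  interpret product_sigma_finite "\<lambda>_. lborel :: real measure" by (rule product_sigma_finite_lborel)
  let ?f = "\<lambda>X t. indicator (monotone_domain D X R) t * (\<Prod>a\<in>X. ennreal \<bar>form_coeff (\<delta> a) (t a)\<bar>)"
  have split: "?f (X \<union> Y) (merge X Y (x, y)) = ?f X x * ?f Y y"
    if "x \<in> space (\<Pi>\<^sub>M a\<in>X. lborel)" "y \<in> space (\<Pi>\<^sub>M a\<in>Y. lborel)" for x y
  proof -
    have m: "merge X Y (x, y) a = x a" if "a \<in> X" for a using that by (simp add: merge_def)
    have m': "merge X Y (x, y) a = y a" if "a \<in> Y" for a using that assms(3) by (auto simp: merge_def)
    have "merge X Y (x, y) \<in> monotone_domain D (X \<union> Y) R \<longleftrightarrow>
        x \<in> monotone_domain D X R \<and> y \<in> monotone_domain D Y R"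
      using that unrelated m m'
      by (auto simp: monotone_domain_def PiE_iff space_PiM merge_def ball_Un extensional_def)
    then have "indicator (monotone_domain D (X \<union> Y) R) (merge X Y (x, y)) =
        indicator (monotone_domain D X R) x * (indicator (monotone_domain D Y R) y :: ennreal)"
      by (simp add: indicator_def)
    moreover have "(\<Prod>a\<in>X \<union> Y. ennreal \<bar>form_coeff (\<delta> a) (merge X Y (x, y) a)\<bar>) =
        (\<Prod>a\<in>X. ennreal \<bar>form_coeff (\<delta> a) (x a)\<bar>) * (\<Prod>a\<in>Y. ennreal \<bar>form_coeff (\<delta> a) (y a)\<bar>)"
      using assms by (subst prod.union_disjoint) (simp_all add: m m')
    ultimately show ?thesis by (simp add: mult_ac)
  qed
  have "poset_nn_integral D (X \<union> Y) R \<delta> =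
      (\<integral>\<^sup>+x. \<integral>\<^sup>+y. ?f (X \<union> Y) (merge X Y (x, y)) \<partial>(\<Pi>\<^sub>M a\<in>Y. lborel) \<partial>(\<Pi>\<^sub>M a\<in>X. lborel))"
    unfolding poset_nn_integral_def using assms
    by (subst product_nn_integral_fold) (auto intro!: measurable_poset_integrand)
  also have "\<dots> = (\<integral>\<^sup>+x. \<integral>\<^sup>+y. ?f X x * ?f Y y \<partial>(\<Pi>\<^sub>M a\<in>Y. lborel) \<partial>(\<Pi>\<^sub>M a\<in>X. lborel))"
    by (intro nn_integral_cong split)
  also have "\<dots> = (\<integral>\<^sup>+x. ?f X x * poset_nn_integral D Y R \<delta> \<partial>(\<Pi>\<^sub>M a\<in>X. lborel))"
    unfolding poset_nn_integral_def using assms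
    by (intro nn_integral_cong nn_integral_cmult measurable_poset_integrand) auto
  also have "\<dots> = poset_nn_integral D X R \<delta> * poset_nn_integral D Y R \<delta>"
    unfolding poset_nn_integral_def[of D X] using assms
    by (intro nn_integral_multc measurable_poset_integrand) auto
  finally show ?thesis .
qed

lemma poset_nn_integral_chain_step:
  assumes "finite Y" "inj c" "\<And>l. c l \<notin> Y"
    and chain: "\<And>k l. (c k, c l) \<in> R \<longleftrightarrow> k < (l :: nat)"
    and above: "\<And>l b. b \<in> Y \<Longrightarrow> (b, c l) \<in> R \<and> (c l, b) \<notin> R"
    and D: "D \<in> sets borel" "{0..<z} \<subseteq> D" "D \<subseteq> {0..z}"
  shows "poset_nn_integral D (c ` {1..Suc n} \<union> Y) R \<delta> = (\<integral>\<^sup>+y. indicator {0<..<z} y *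
    (ennreal \<bar>form_coeff (\<delta> (c (Suc n))) y\<bar> * poset_nn_integral {0..<y} (c ` {1..n} \<union> Y) R \<delta>) \<partial>lborel)"
proof -
  have *: "c ` {1..Suc n} \<union> Y = insert (c (Suc n)) (c ` {1..n} \<union> Y)"
    by (simp add: atLeastAtMostSuc_conv)
  show ?thesis
    unfolding * by (rule poset_nn_integral_insert_top[OF _ _ _ _ D])
      (use assms in \<open>auto simp: inj_eq\<close>)
qed

text \<open>A chain on top of a poset is peeled off from above, one form of the word at a time.\<close>

lemma poset_nn_integral_chain:
  assumes "finite Y" "inj c" "\<And>l. c l \<notin> Y"
    and chain: "\<And>k l. (c k, c l) \<in> R \<longleftrightarrow> k < (l :: nat)"
    and above: "\<And>l b. b \<in> Y \<Longrightarrow> (b, c l) \<in> R \<and> (c l, b) \<notin> R"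
  shows "poset_nn_integral {0..<z} (c ` {1..n} \<union> Y) R \<delta> =
    iter_int (rev (map (\<lambda>l. \<delta> (c l)) [1..<Suc n])) (\<lambda>t. poset_nn_integral {0..<t} Y R \<delta>) z"
proof (induction n arbitrary: z)
  case (Suc n)
  have *: "rev (map (\<lambda>l. \<delta> (c l)) [1..<Suc (Suc n)]) =
      \<delta> (c (Suc n)) # rev (map (\<lambda>l. \<delta> (c l)) [1..<Suc n])" by simp
  show ?case
    unfolding * iter_int.simps Suc.IH[symmetric]
    by (rule poset_nn_integral_chain_step) (use assms in auto)
qed simp

lemma poset_nn_integral_chain_top:
  assumes "finite Y" "inj c" "\<And>l. c l \<notin> Y"
    and chain: "\<And>k l. (c k, c l) \<in> R \<longleftrightarrow> k < (l :: nat)"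
    and above: "\<And>l b. b \<in> Y \<Longrightarrow> (b, c l) \<in> R \<and> (c l, b) \<notin> R"
    and "1 \<le> n"
  shows "poset_nn_integral {0..z} (c ` {1..n} \<union> Y) R \<delta> =
    iter_int (rev (map (\<lambda>l. \<delta> (c l)) [1..<Suc n])) (\<lambda>t. poset_nn_integral {0..<t} Y R \<delta>) z"
proof -
  obtain m where n: "n = Suc m" using assms(6) by (cases n) auto
  have *: "rev (map (\<lambda>l. \<delta> (c l)) [1..<Suc (Suc m)]) =
      \<delta> (c (Suc m)) # rev (map (\<lambda>l. \<delta> (c l)) [1..<Suc m])" by simp
  have "poset_nn_integral {0..z} (c ` {1..Suc m} \<union> Y) R \<delta> = (\<integral>\<^sup>+y. indicator {0<..<z} y *
    (ennreal \<bar>form_coeff (\<delta> (c (Suc m))) y\<bar> * poset_nn_integral {0..<y} (c ` {1..m} \<union> Y) R \<delta>) \<partial>lborel)"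
    by (rule poset_nn_integral_chain_step) (use assms in auto)
  moreover have "poset_nn_integral {0..<y} (c ` {1..m} \<union> Y) R \<delta> =
      iter_int (rev (map (\<lambda>l. \<delta> (c l)) [1..<Suc m])) (\<lambda>t. poset_nn_integral {0..<t} Y R \<delta>) y" for y
    by (rule poset_nn_integral_chain) (use assms in auto)
  ultimately show ?thesis
    unfolding n * iter_int.simps by simp
qed

lemma poset_integral_eq_nn_integral:
  assumes "finite X" "\<bar>\<sigma>\<bar> = 1"
    and sgn: "\<And>t. t \<in> poset_domain z X R \<Longrightarrow>
      (\<Prod>a\<in>X. form_coeff (\<delta> a) (t a)) = \<sigma> * (\<Prod>a\<in>X. \<bar>form_coeff (\<delta> a) (t a)\<bar>)"
  shows "poset_integral z X R \<delta> = \<sigma> * enn2real (poset_nn_integral {0..z} X R \<delta>)"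
proof -
  let ?f = "\<lambda>t. indicator (poset_domain z X R) t * (\<Prod>a\<in>X. \<bar>form_coeff (\<delta> a) (t a)\<bar>)"
  have eq: "poset_domain z X R = monotone_domain {0..z} X R"
    by (simp add: poset_domain_def monotone_domain_def)
  note [measurable] = measurable_monotone_domain[OF assms(1), of "{0..z}" R, simplified, folded eq]
  have "poset_integral z X R \<delta> = (LINT t|(\<Pi>\<^sub>M a\<in>X. lborel). \<sigma> * ?f t)"
    unfolding poset_integral_def set_lebesgue_integral_def
    by (intro Bochner_Integration.integral_cong refl) (auto split: split_indicator simp: sgn)
  also have "\<dots> = \<sigma> * (LINT t|(\<Pi>\<^sub>M a\<in>X. lborel). ?f t)" by simp
  also have "(LINT t|(\<Pi>\<^sub>M a\<in>X. lborel). ?f t) = enn2real (\<integral>\<^sup>+t. ennreal (?f t) \<partial>(\<Pi>\<^sub>M a\<in>X. lborel))"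
    by (intro integral_eq_nn_integral AE_I2 mult_nonneg_nonneg prod_nonneg) auto
  also have "(\<integral>\<^sup>+t. ennreal (?f t) \<partial>(\<Pi>\<^sub>M a\<in>X. lborel)) = poset_nn_integral {0..z} X R \<delta>"
    unfolding poset_nn_integral_def eq
    by (intro nn_integral_cong) (simp split: split_indicator add: prod_ennreal)
  finally show ?thesis .
qed

section \<open>Powers of the logarithm\<close>

text \<open>This is the iterated integral of \<open>n\<close> copies of \<open>dt/(1-t)\<close>, hence also the polylogarithm with \<open>n\<close>
  indices \<open>1\<close>.\<close>

definition log_power :: "nat \<Rightarrow> real \<Rightarrow> real" where
  "log_power n s = (- ln (1 - s)) ^ n / fact n"

lemma log_power_zero [simp]: "log_power 0 s = 1"
  by (simp add: log_power_def)

lemma log_power_Suc_at_zero [simp]: "log_power (Suc n) 0 = 0"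
  by (simp add: log_power_def)

lemma log_power_nonneg: "0 \<le> s \<Longrightarrow> s < 1 \<Longrightarrow> 0 \<le> log_power n s"
  by (simp add: log_power_def)

lemma measurable_log_power [measurable]: "log_power n \<in> borel_measurable borel"
  unfolding log_power_def by measurable

lemma log_power_deriv:
  assumes "s < 1"
  shows "(log_power (Suc n) has_real_derivative log_power n s / (1 - s)) (at s)"
proof -
  have "((\<lambda>s. (- ln (1 - s)) ^ Suc n / fact (Suc n)) has_real_derivative
      (real (Suc n) * (- ln (1 - s)) ^ n * (1 / (1 - s))) / fact (Suc n)) (at s)"
    using assms by (auto intro!: derivative_eq_intros simp del: power_Suc of_nat_Suc fact_Suc)
  also have "(real (Suc n) * (- ln (1 - s)) ^ n * (1 / (1 - s))) / fact (Suc n) = log_power n s / (1 - s)"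
    by (simp add: log_power_def fact_Suc del: of_nat_Suc)
  finally show ?thesis unfolding log_power_def .
qed

lemma continuous_on_log_power: "y < 1 \<Longrightarrow> continuous_on {0..y} (log_power n)"
  unfolding log_power_def by (intro continuous_intros) auto

text \<open>The shuffle product of two chains with equal labels. It makes every product of powers that occurs
  below integrable as soon as the single powers are.\<close>

lemma log_power_mult: "log_power a s * log_power b s = real ((a + b) choose a) * log_power (a + b) s"
  by (simp add: log_power_def power_add binomial_fact[of a "a + b"])

lemma form_coeff_simps:
  "form_coeff 0 t = 1 / t" "form_coeff 1 t = 1 / (1 - t)"
  "form_coeff (-1) t = - 1 / (1 + t)" "form_coeff (-2) t = 2 * t / (1 - t\<^sup>2)"
  by (simp_all add: form_coeff_def)

lemma iter_int_one_FTC: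
  assumes "0 \<le> z" "z < 1" "continuous_on {0..z} F" "F 0 = 0"
    and "\<And>t. 0 < t \<Longrightarrow> t < z \<Longrightarrow> iter_int w h t = ennreal (G t)"
    and "\<And>t. 0 < t \<Longrightarrow> t < z \<Longrightarrow> 0 \<le> G t"
    and "\<And>t. 0 < t \<Longrightarrow> t < z \<Longrightarrow> (F has_real_derivative G t / (1 - t)) (at t)"
  shows "iter_int (1 # w) h z = ennreal (F z)"
proof (rule iter_int_FTC(1)[OF assms(1,3,4,5,6)])
  fix t assume "0 < t" "t < z"
  then show "(F has_real_derivative \<bar>form_coeff 1 t\<bar> * G t) (at t)"
    using assms(7)[of t] assms(2) by (simp add: form_coeff_simps)
qed

lemma iter_int_replicate_one:
  "0 \<le> z \<Longrightarrow> z < 1 \<Longrightarrow> iter_int (replicate n 1) (\<lambda>_. 1) z = ennreal (log_power n z)"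
proof (induction n arbitrary: z)
  case (Suc n)
  then show ?case
    unfolding replicate_Suc
    by (intro iter_int_one_FTC[where G = "log_power n"] log_power_deriv continuous_on_log_power
        log_power_nonneg) auto
qed simp

text \<open>In the variable \<open>s = t\<^sup>2\<close> and up to sign, this is the integral over the part \<open>u\<^sub>1 < \<dots> < u\<^sub>j < v\<close>,
  \<open>w < v\<close> of the first poset. The detour through \<^const>\<open>iter_int\<close> makes measurability on the whole
  line immediate; the formula as an ordinary integral holds on \<open>[0,1)\<close>.\<close>

definition log_root_int :: "nat \<Rightarrow> real \<Rightarrow> real" where
  "log_root_int j s = enn2real (iter_int [1] (\<lambda>r. ennreal (log_power j r * ln (1 + sqrt r))) s)"

lemma measurable_log_root_int [measurable]: "log_root_int j \<in> borel_measurable borel"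
  unfolding log_root_int_def by measurable

lemma continuous_on_log_root_integrand:
  "y < 1 \<Longrightarrow> continuous_on {0..y} (\<lambda>r. log_power j r * ln (1 + sqrt r) / (1 - r))"
proof -
  assume "y < 1"
  moreover have "1 + sqrt r \<noteq> 0" if "0 \<le> r" for r
    using real_sqrt_ge_zero[OF that] by linarith
  ultimately show ?thesis
    by (intro continuous_intros continuous_on_log_power) auto
qed

lemma integral_deriv:
  fixes f :: "real \<Rightarrow> real"
  assumes "0 < s" "s < b" "continuous_on {0..b} f"
  shows "((\<lambda>s. integral {0..s} f) has_real_derivative f s) (at s)"
  using integral_has_real_derivative[OF assms(3), of s] assms
  by (simp add: at_within_Icc_at)

lemma iter_int_log_root:
  assumes "0 \<le> s" "s < 1"
  shows "iter_int [1] (\<lambda>r. ennreal (log_power j r * ln (1 + sqrt r))) s =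
    ennreal (integral {0..s} (\<lambda>r. log_power j r * ln (1 + sqrt r) / (1 - r)))"
proof (rule iter_int_one_FTC[where G = "\<lambda>r. log_power j r * ln (1 + sqrt r)"])
  show "continuous_on {0..s} (\<lambda>s. integral {0..s} (\<lambda>r. log_power j r * ln (1 + sqrt r) / (1 - r)))"
    by (intro indefinite_integral_continuous_1 integrable_continuous_real
        continuous_on_log_root_integrand assms)
  show "((\<lambda>s. integral {0..s} (\<lambda>r. log_power j r * ln (1 + sqrt r) / (1 - r)))
      has_real_derivative log_power j t * ln (1 + sqrt t) / (1 - t)) (at t)" if "0 < t" "t < s" for t
    by (rule integral_deriv[OF that continuous_on_log_root_integrand]) fact
qed (use assms in \<open>auto simp: log_power_nonneg\<close>)

lemma log_root_int_eq:
  assumes "0 \<le> s" "s < 1"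
  shows "log_root_int j s = integral {0..s} (\<lambda>r. log_power j r * ln (1 + sqrt r) / (1 - r))"
    and "iter_int [1] (\<lambda>r. ennreal (log_power j r * ln (1 + sqrt r))) s = ennreal (log_root_int j s)"
proof -
  have "0 \<le> integral {0..s} (\<lambda>r. log_power j r * ln (1 + sqrt r) / (1 - r))"
    using assms
    by (intro integral_nonneg integrable_continuous_real continuous_on_log_root_integrand)
       (auto intro!: divide_nonneg_nonneg mult_nonneg_nonneg log_power_nonneg)
  then show "log_root_int j s = integral {0..s} (\<lambda>r. log_power j r * ln (1 + sqrt r) / (1 - r))"
    unfolding log_root_int_def iter_int_log_root[OF assms] by simp
  then show "iter_int [1] (\<lambda>r. ennreal (log_power j r * ln (1 + sqrt r))) s = ennreal (log_root_int j s)"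
    unfolding iter_int_log_root[OF assms] by simp
qed

lemma log_root_int_nonneg: "0 \<le> log_root_int j s"
  by (simp add: log_root_int_def)

lemma log_root_int_at_zero: "log_root_int j 0 = 0"
  by (simp add: log_root_int_eq)

lemma log_root_int_deriv:
  assumes "0 < s" "s < 1"
  shows "(log_root_int j has_real_derivative log_power j s * ln (1 + sqrt s) / (1 - s)) (at s)"
proof -
  obtain b where b: "s < b" "b < 1" using assms(2) dense by blast
  have "((\<lambda>s. integral {0..s} (\<lambda>r. log_power j r * ln (1 + sqrt r) / (1 - r)))
      has_real_derivative log_power j s * ln (1 + sqrt s) / (1 - s)) (at s)"
    by (rule integral_deriv[OF assms(1) b(1) continuous_on_log_root_integrand[OF b(2)]])
  then show ?thesis
    by (rule has_field_derivative_transform_within_open[where S = "{0<..<1}"])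
      (use assms in \<open>auto simp: log_root_int_eq(1)\<close>)
qed

lemma continuous_on_log_root_int:
  assumes "y < 1" shows "continuous_on {0..y} (log_root_int j)"
proof -
  have "continuous_on {0..y} (\<lambda>s. integral {0..s} (\<lambda>r. log_power j r * ln (1 + sqrt r) / (1 - r)))"
    by (intro indefinite_integral_continuous_1 integrable_continuous_real
        continuous_on_log_root_integrand assms)
  then show ?thesis
    by (rule continuous_on_eq) (use assms in \<open>auto simp: log_root_int_eq(1)\<close>)
qed

text \<open>The bound reduces the integrability of the products with this function to that of powers of the
  logarithm.\<close>

lemma log_root_int_le:
  assumes "0 \<le> s" "s < 1" shows "log_root_int j s \<le> ln 2 * log_power (Suc j) s"
proof -
  have "iter_int [1] (\<lambda>r. ennreal (log_power j r * ln (1 + sqrt r))) s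
      \<le> iter_int [1] (\<lambda>r. ennreal (ln 2 * log_power j r)) s"
    unfolding iter_int.simps
  proof (intro nn_integral_mono)
    fix t
    show "indicator {0<..<s} t * (ennreal \<bar>form_coeff 1 t\<bar> * ennreal (log_power j t * ln (1 + sqrt t)))
        \<le> indicator {0<..<s} t * (ennreal \<bar>form_coeff 1 t\<bar> * ennreal (ln 2 * log_power j t))"
    proof (cases "0 < t \<and> t < s")
      case True
      then have "0 \<le> sqrt t" "sqrt t \<le> 1" using assms by auto
      then have "ln (1 + sqrt t) \<le> ln 2" by (subst ln_le_cancel_iff) linarith+
      then have "log_power j t * ln (1 + sqrt t) \<le> ln 2 * log_power j t"
        using True assms log_power_nonneg[of t j] by (subst mult.commute) (intro mult_right_mono, auto)
      then show ?thesis by (intro mult_left_mono ennreal_leI) auto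
    qed simp
  qed
  also have "iter_int [1] (\<lambda>r. ennreal (ln 2 * log_power j r)) s = ennreal (ln 2 * log_power (Suc j) s)"
  proof (rule iter_int_one_FTC[where G = "\<lambda>r. ln 2 * log_power j r"])
    show "((\<lambda>s. ln 2 * log_power (Suc j) s) has_real_derivative ln 2 * log_power j t / (1 - t)) (at t)"
      if "0 < t" "t < s" for t
      using DERIV_cmult[OF log_power_deriv[of t j], of "ln 2"] that assms by simp
  qed (use assms in \<open>auto intro!: continuous_intros continuous_on_log_power simp: log_power_nonneg\<close>)
  finally show ?thesis
    unfolding log_root_int_eq(2)[OF assms]
    using assms log_power_nonneg[of s "Suc j"] by (simp add: ennreal_le_iff)
qed

section \<open>The order on the nodes\<close>

lemma T_labels_one: "T_labels [1] = [0]"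
  by (simp add: T_labels_def)

lemma T_labels_raise: "T_labels (ms @ [Suc (Suc m)]) = T_labels (ms @ [Suc m]) @ [0]"
  by (cases ms) (simp_all add: T_labels_def replicate_append_same)

lemma T_labels_append: "ms \<noteq> [] \<Longrightarrow> T_labels (ms @ [1]) = T_labels ms @ [-2]"
  by (cases ms) (simp_all add: T_labels_def)

lemma T_labels_properties:
  assumes "composition ms" "ms \<noteq> []"
  shows "length (T_labels ms) = sum_list ms"
    and "count_list (T_labels ms) 0 + length ms = Suc (sum_list ms)"
    and "set (T_labels ms) \<subseteq> {0, -2}"
  using assms
proof (induction rule: composition_induct)
  case one
  { case 1 show ?case by (simp add: T_labels_one[simplified]) }
  { case 2 show ?case by (simp add: T_labels_one[simplified]) }
  { case 3 show ?case by (simp add: T_labels_one[simplified]) }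
next
  case (raise ms m)
  { case 1 show ?case using raise by (simp add: T_labels_raise) }
  { case 2 show ?case using raise by (simp add: T_labels_raise) }
  { case 3 show ?case using raise by (simp add: T_labels_raise) }
next
  case (append ms)
  { case 1 show ?case using append by (simp add: T_labels_append[simplified]) }
  { case 2 show ?case using append by (simp add: T_labels_append[simplified]) }
  { case 3 show ?case using append by (simp add: T_labels_append[simplified]) }
qed

text \<open>The order of the poset in closed form, in place of the transitive closure. On the carrier the two
  agree, and the closed form restricts to any subset, such as the carrier without \<^const>\<open>W\<close>.\<close>

fun node_less :: "node \<Rightarrow> node \<Rightarrow> bool" where
  "node_less (U k) (U l) \<longleftrightarrow> k < l"
| "node_less (U k) V \<longleftrightarrow> True"
| "node_less W V \<longleftrightarrow> True"
| "node_less (S k) (S l) \<longleftrightarrow> k < l"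
| "node_less (T k) (T l) \<longleftrightarrow> k < l"
| "node_less a (T l) \<longleftrightarrow> True"
| "node_less a b \<longleftrightarrow> False"

definition node_rel :: "(node \<times> node) set" where "node_rel = {(a, b). node_less a b}"

lemma node_less_trans: "node_less a b \<Longrightarrow> node_less b c \<Longrightarrow> node_less a c"
  by (cases a; cases b; cases c) auto

definition X_cover :: "nat \<Rightarrow> nat \<Rightarrow> nat list \<Rightarrow> (node \<times> node) set" where
  "X_cover i j ms = {(U l, U (Suc l)) | l. 1 \<le> l \<and> l < j} \<union> {(U l, V) | l. 1 \<le> l \<and> l = j}
      \<union> {(W, V), (V, T 1)}
      \<union> {(S l, S (Suc l)) | l. 1 \<le> l \<and> l < i} \<union> {(S l, T 1) | l. 1 \<le> l \<and> l = i}
      \<union> {(T l, T (Suc l)) | l. 1 \<le> l \<and> l < sum_list ms}"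

lemma X_order_eq: "X_order i j ms = (X_cover i j ms)\<^sup>+"
  by (simp add: X_order_def X_cover_def)

lemma X_order_imp_node_less: "(a, b) \<in> X_order i j ms \<Longrightarrow> node_less a b"
  unfolding X_order_eq
proof (induction rule: trancl_induct)
  case (base b)
  then show ?case by (auto simp: X_cover_def)
next
  case (step b c)
  moreover have "node_less b c" using step.hyps by (auto simp: X_cover_def)
  ultimately show ?case using node_less_trans by blast
qed

lemma trancl_chain:
  assumes "\<And>l. m \<le> l \<Longrightarrow> l < n \<Longrightarrow> (c l, c (Suc l)) \<in> r\<^sup>+"
    and "m \<le> a" "a < b" "b \<le> (n :: nat)"
  shows "(c a, c b) \<in> r\<^sup>+"
  using assms(3,4)
proof (induction b)
  case (Suc b)
  then have last: "(c b, c (Suc b)) \<in> r\<^sup>+" using assms(1)[of b] assms(2) by simp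
  show ?case
  proof (cases "a = b")
    case False
    with Suc have "(c a, c b) \<in> r\<^sup>+" by simp
    with last show ?thesis by (rule trancl_trans[rotated])
  qed (use last in simp)
qed simp

lemma X_carrier_simps:
  "U l \<in> X_carrier i j ms \<longleftrightarrow> 1 \<le> l \<and> l \<le> j"
  "S l \<in> X_carrier i j ms \<longleftrightarrow> 1 \<le> l \<and> l \<le> i"
  "T l \<in> X_carrier i j ms \<longleftrightarrow> 1 \<le> l \<and> l \<le> sum_list ms"
  by (auto simp: X_carrier_def)

lemma node_less_imp_X_order:
  assumes "1 \<le> sum_list ms" "a \<in> X_carrier i j ms" "b \<in> X_carrier i j ms" "node_less a b"
  shows "(a, b) \<in> X_order i j ms"
proof -
  let ?r = "X_cover i j ms"
  have UU: "(U k, U l) \<in> ?r\<^sup>+" if "1 \<le> k" "k < l" "l \<le> j" for k l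
    by (rule trancl_chain[where m = 1 and n = j]) (use that in \<open>auto simp: X_cover_def\<close>)
  have SS: "(S k, S l) \<in> ?r\<^sup>+" if "1 \<le> k" "k < l" "l \<le> i" for k l
    by (rule trancl_chain[where m = 1 and n = i]) (use that in \<open>auto simp: X_cover_def\<close>)
  have TT: "(T k, T l) \<in> ?r\<^sup>+" if "1 \<le> k" "k < l" "l \<le> sum_list ms" for k l
    by (rule trancl_chain[where m = 1 and n = "sum_list ms"]) (use that in \<open>auto simp: X_cover_def\<close>)
  have UV: "(U k, V) \<in> ?r\<^sup>+" if "1 \<le> k" "k \<le> j" for k
  proof -
    have "(U j, V) \<in> ?r\<^sup>+" using that by (auto simp: X_cover_def)
    then show ?thesis using UU[of k j] that by (cases "k = j") (auto intro: trancl_trans)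
  qed
  have T1: "(T 1, T l) \<in> ?r\<^sup>+" if "1 < l" "l \<le> sum_list ms" for l using TT that by simp
  have above: "(b, T l) \<in> ?r\<^sup>+" if "(b, T 1) \<in> ?r\<^sup>+" "1 \<le> l" "l \<le> sum_list ms" for b l
    using that T1[of l] by (cases "l = 1") (auto intro: trancl_trans)
  have VT1: "(V, T 1) \<in> ?r\<^sup>+" by (auto simp: X_cover_def)
  have WV: "(W, V) \<in> ?r\<^sup>+" by (auto simp: X_cover_def)
  have ST1: "(S k, T 1) \<in> ?r\<^sup>+" if "1 \<le> k" "k \<le> i" for k
  proof -
    have "(S i, T 1) \<in> ?r\<^sup>+" using that by (auto simp: X_cover_def)
    then show ?thesis using SS[of k i] that by (cases "k = i") (auto intro: trancl_trans)
  qed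
  have UT1: "(U k, T 1) \<in> ?r\<^sup>+" if "1 \<le> k" "k \<le> j" for k
    using trancl_trans[OF UV[OF that] VT1] .
  have WT1: "(W, T 1) \<in> ?r\<^sup>+" using trancl_trans[OF WV VT1] .
  show ?thesis
    using assms(2-4) unfolding X_order_eq
    by (cases a; cases b)
       (simp_all add: X_carrier_simps UU SS TT UV WV VT1 ST1 UT1 WT1 above del: One_nat_def)
qed

lemma poset_domain_node_rel:
  assumes "1 \<le> sum_list ms" "X \<subseteq> X_carrier i j ms"
  shows "poset_domain z X (X_order i j ms) = poset_domain z X node_rel"
proof -
  have "(a, b) \<in> X_order i j ms \<longleftrightarrow> (a, b) \<in> node_rel" if "a \<in> X" "b \<in> X" for a b
    using that assms X_order_imp_node_less[of a b i j ms] node_less_imp_X_order[of ms a i j b]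
    by (auto simp: node_rel_def)
  then show ?thesis unfolding poset_domain_def by (intro Collect_cong) auto
qed

section \<open>The poset integrals as iterated integrals\<close>

lemma form_coeff_nonneg: "d \<in> {0, 1, -2} \<Longrightarrow> 0 \<le> t \<Longrightarrow> t \<le> 1 \<Longrightarrow> 0 \<le> form_coeff d t"
  by (auto simp: form_coeff_simps power_le_one intro!: divide_nonneg_nonneg)

lemma iter_int_replicate_minus_two:
  assumes "0 \<le> t" "t < 1"
  shows "iter_int (replicate n (-2)) (\<lambda>_. 1) t = ennreal (log_power n (t\<^sup>2))"
proof -
  have t: "t\<^sup>2 < 1" using assms by (simp add: power_less_one_iff)
  have c: "count_list (replicate n (-2 :: int)) 0 = 0" by (induction n) auto
  have "iter_int (replicate n (-2)) (\<lambda>_. 1) (sqrt (t\<^sup>2)) = ennreal (log_power n (t\<^sup>2))"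
    using t by (subst iter_int_sqrt) (auto simp: c squared_label_def iter_int_replicate_one)
  then show ?thesis using assms by simp
qed

lemma poset_nn_integral_const_chain:
  assumes "inj c" "\<And>k l. (c k, c l) \<in> R \<longleftrightarrow> k < (l :: nat)" "\<And>l. \<delta> (c l) = d"
  shows "poset_nn_integral {0..<z} (c ` {1..n}) R \<delta> = iter_int (replicate n d) (\<lambda>_. 1) z"
  using poset_nn_integral_chain[of "{}" c R z n \<delta>] assms
  by (simp add: poset_nn_integral_empty map_replicate_const del: upt_Suc)

lemma poset_nn_integral_W:
  assumes "\<delta> W = -1" "0 \<le> v"
  shows "poset_nn_integral {0..<v} {W} node_rel \<delta> = ennreal (ln (1 + v))"
proof -
  have "poset_nn_integral {0..<v} {W} node_rel \<delta> =
      (\<integral>\<^sup>+y. indicator {0<..<v} y * (ennreal \<bar>form_coeff (\<delta> W) y\<bar> * poset_nn_integral {0..<y} {} node_rel \<delta>) \<partial>lborel)"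
    by (rule poset_nn_integral_insert_top) (auto simp: node_rel_def)
  also have "\<dots> = (\<integral>\<^sup>+y. indicator {0<..<v} y * ennreal (1 / (1 + y)) \<partial>lborel)"
    using assms
    by (intro nn_integral_cong) (auto split: split_indicator simp: poset_nn_integral_empty form_coeff_simps)
  also have "\<dots> = ennreal (ln (1 + v))"
    using assms(2)
    by (intro nn_integral_FTC_open(1)) (auto intro!: continuous_intros derivative_eq_intros)
  finally show ?thesis .
qed

lemma X_carrier_eq:
  "X_carrier i j ms = T ` {1..sum_list ms} \<union> (insert V (U ` {1..j} \<union> {W}) \<union> S ` {1..i})"
  "X_carrier i j ms - {W} = T ` {1..sum_list ms} \<union> (insert V (U ` {1..j}) \<union> S ` {1..i})"
  by (auto simp: X_carrier_def)

lemma finite_X_carrier: "finite (X_carrier i j ms)"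
  by (simp add: X_carrier_def)

lemma map_X_label_T:
  assumes "length (T_labels ms) = sum_list ms"
  shows "map (\<lambda>l. f (X_label ms (T l))) [1..<Suc (sum_list ms)] = map f (T_labels ms)"
  by (rule nth_equalityI) (use assms in \<open>auto simp del: upt_Suc\<close>)

lemma map_X_label_T_plain:
  assumes "length (T_labels ms) = sum_list ms"
  shows "map (\<lambda>l. X_label ms (T l)) [1..<Suc (sum_list ms)] = T_labels ms"
  using map_X_label_T[OF assms, where f = "\<lambda>d. d"] by (simp only: list.map_ident)

lemma X_label_values:
  assumes "composition ms" "ms \<noteq> []" "a \<in> X_carrier i j ms" "a \<noteq> W"
  shows "X_label ms a \<in> {0, -2}"
proof (cases a)
  case (T l)
  then have "l - 1 < length (T_labels ms)"
    using assms T_labels_properties(1) by (auto simp: X_carrier_simps)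
  then show ?thesis using T T_labels_properties(3)[OF assms(1,2)] nth_mem by fastforce
qed (use assms in auto)

text \<open>Below the chain the poset splits into \<open>s\<^sub>1 < \<dots> < s\<^sub>i\<close> and the part with largest element \<open>v\<close>, in
  which \<open>w\<close> and the chain of the \<open>u\<^sub>l\<close> are again unrelated.\<close>

lemma poset_nn_integral_A_lower:
  assumes \<delta>: "\<And>l. \<delta> (U l) = -2" "\<delta> V = -2" "\<And>l. \<delta> (S l) = -2" "\<delta> W = -1"
    and t: "0 < t" "t < 1"
  shows "poset_nn_integral {0..<t} (insert V (U ` {1..j} \<union> {W}) \<union> S ` {1..i}) node_rel \<delta> =
    ennreal (log_power i (t\<^sup>2) * log_root_int j (t\<^sup>2))"
proof -
  have t2: "t\<^sup>2 < 1" using t by (simp add: power_less_one_iff)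
  have UW: "poset_nn_integral {0..<v} (U ` {1..j} \<union> {W}) node_rel \<delta> =
      ennreal (log_power j (v\<^sup>2) * ln (1 + v))" if v: "0 < v" "v < 1" for v
  proof -
    have "poset_nn_integral {0..<v} (U ` {1..j} \<union> {W}) node_rel \<delta> =
        poset_nn_integral {0..<v} (U ` {1..j}) node_rel \<delta> * poset_nn_integral {0..<v} {W} node_rel \<delta>"
      by (intro poset_nn_integral_Un) (auto simp: node_rel_def)
    also have "poset_nn_integral {0..<v} (U ` {1..j}) node_rel \<delta> = ennreal (log_power j (v\<^sup>2))"
      using v \<delta> by (subst poset_nn_integral_const_chain[where d = "-2"])
        (auto simp: inj_def node_rel_def iter_int_replicate_minus_two)
    also have "poset_nn_integral {0..<v} {W} node_rel \<delta> = ennreal (ln (1 + v))"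
      using v \<delta> by (intro poset_nn_integral_W) auto
    finally show ?thesis using v by (simp add: ennreal_mult'')
  qed
  have "poset_nn_integral {0..<t} (insert V (U ` {1..j} \<union> {W}) \<union> S ` {1..i}) node_rel \<delta> =
      poset_nn_integral {0..<t} (insert V (U ` {1..j} \<union> {W})) node_rel \<delta> *
      poset_nn_integral {0..<t} (S ` {1..i}) node_rel \<delta>"
    by (intro poset_nn_integral_Un) (auto simp: node_rel_def)
  also have "poset_nn_integral {0..<t} (S ` {1..i}) node_rel \<delta> = ennreal (log_power i (t\<^sup>2))"
    using t \<delta> by (subst poset_nn_integral_const_chain[where d = "-2"])
      (auto simp: inj_def node_rel_def iter_int_replicate_minus_two)
  also have "poset_nn_integral {0..<t} (insert V (U ` {1..j} \<union> {W})) node_rel \<delta> =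
      (\<integral>\<^sup>+v. indicator {0<..<t} v * (ennreal \<bar>form_coeff (\<delta> V) v\<bar> *
        poset_nn_integral {0..<v} (U ` {1..j} \<union> {W}) node_rel \<delta>) \<partial>lborel)"
    by (rule poset_nn_integral_insert_top) (auto simp: node_rel_def)
  also have "\<dots> = iter_int [-2] (\<lambda>v. ennreal (log_power j (v\<^sup>2) * ln (1 + v))) (sqrt (t\<^sup>2))"
    using t UW \<delta> by (auto intro!: nn_integral_cong split: split_indicator)
  also have "\<dots> = iter_int [1] (\<lambda>s. ennreal (log_power j ((sqrt s)\<^sup>2) * ln (1 + sqrt s))) (t\<^sup>2)"
    using t2 by (subst iter_int_sqrt) (auto simp: squared_label_def)
  also have "\<dots> = iter_int [1] (\<lambda>s. ennreal (log_power j s * ln (1 + sqrt s))) (t\<^sup>2)"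
    by (rule iter_int_cong) auto
  also have "\<dots> = ennreal (log_root_int j (t\<^sup>2))"
    using t2 by (intro log_root_int_eq(2)) auto
  finally show ?thesis by (simp add: ennreal_mult'' log_root_int_nonneg mult.commute)
qed

text \<open>The one-form at \<open>w\<close> is the only negative one on \<open>[0,1]\<close>, hence the sign; the labels \<open>0\<close> of the
  chain, \<open>|m| + 1 - p\<close> in number, give the power of \<open>1/2\<close>.\<close>

lemma A_integral_eq:
  assumes ms: "composition ms" "ms \<noteq> []" and y: "0 \<le> y" "y \<le> 1"
  shows "A_integral ms i j (sqrt y) = - ((1/2) ^ (sum_list ms + 1 - length ms) *
    enn2real (iter_int (map squared_label (rev (T_labels ms)))
      (\<lambda>s. ennreal (log_power i s * log_root_int j s)) y))"
proof -
  let ?X = "X_carrier i j ms" and ?\<delta> = "X_label ms"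
  let ?Y = "insert V (U ` {1..j} \<union> {W}) \<union> S ` {1..i}"
  note Tl = T_labels_properties[OF ms]
  have N: "1 \<le> sum_list ms" using composition_sum_pos[OF ms] by simp
  have ne: "rev (T_labels ms) \<noteq> []"
    using Tl(1) N by (metis length_0_conv not_one_le_zero rev_is_Nil_conv)
  have sgn: "(\<Prod>a\<in>?X. form_coeff (?\<delta> a) (t a)) = -1 * (\<Prod>a\<in>?X. \<bar>form_coeff (?\<delta> a) (t a)\<bar>)"
    if "t \<in> poset_domain (sqrt y) ?X node_rel" for t
  proof -
    have t: "0 \<le> t a" "t a \<le> 1" if "a \<in> ?X" for a
    proof -
      have "t a \<in> {0..sqrt y}" using that \<open>t \<in> _\<close> by (auto simp: poset_domain_def)
      moreover have "sqrt y \<le> 1" using y by simp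
      ultimately show "0 \<le> t a" "t a \<le> 1" by (meson atLeastAtMost_iff order_trans)+
    qed
    have W: "W \<in> ?X" by (simp add: X_carrier_def)
    have "(\<Prod>a\<in>?X - {W}. form_coeff (?\<delta> a) (t a)) = (\<Prod>a\<in>?X - {W}. \<bar>form_coeff (?\<delta> a) (t a)\<bar>)"
    proof (rule prod.cong)
      fix a assume a: "a \<in> ?X - {W}"
      then have "?\<delta> a \<in> {0, 1, -2}" using X_label_values[OF ms, of a i j] by auto
      then show "form_coeff (?\<delta> a) (t a) = \<bar>form_coeff (?\<delta> a) (t a)\<bar>"
        using form_coeff_nonneg[of "?\<delta> a" "t a"] t[of a] a by (metis DiffD1 abs_of_nonneg)
    qed simp
    moreover have "\<bar>form_coeff (?\<delta> W) (t W)\<bar> = - form_coeff (?\<delta> W) (t W)"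
      using t[OF W] by (simp add: form_coeff_simps)
    ultimately have "form_coeff (?\<delta> W) (t W) * (\<Prod>a\<in>?X - {W}. form_coeff (?\<delta> a) (t a)) =
        - (\<bar>form_coeff (?\<delta> W) (t W)\<bar> * (\<Prod>a\<in>?X - {W}. \<bar>form_coeff (?\<delta> a) (t a)\<bar>))"
      by (simp only: mult_minus_left minus_minus)
    then show ?thesis
      by (simp only: prod.remove[OF finite_X_carrier W] mult_minus_left mult_1)
  qed
  have "A_integral ms i j (sqrt y) = poset_integral (sqrt y) ?X node_rel ?\<delta>"
    unfolding A_integral_def poset_integral_def poset_domain_node_rel[OF N order.refl] ..
  also have "\<dots> = -1 * enn2real (poset_nn_integral {0..sqrt y} ?X node_rel ?\<delta>)"
    by (rule poset_integral_eq_nn_integral[OF finite_X_carrier _ sgn]) auto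
  also have "poset_nn_integral {0..sqrt y} ?X node_rel ?\<delta> =
      iter_int (rev (T_labels ms)) (\<lambda>t. poset_nn_integral {0..<t} ?Y node_rel ?\<delta>) (sqrt y)"
    unfolding X_carrier_eq map_X_label_T_plain[OF Tl(1), symmetric]
    by (rule poset_nn_integral_chain_top[OF _ _ _ _ _ N])
       (auto simp: inj_def node_rel_def)
  also have "\<dots> = iter_int (rev (T_labels ms)) (\<lambda>t. ennreal (log_power i (t\<^sup>2) * log_root_int j (t\<^sup>2))) (sqrt y)"
  proof (rule iter_int_cong[OF ne])
    fix t assume t: "0 < t" "t < sqrt y"
    have "sqrt y \<le> 1" using y by simp
    with t(2) have "t < 1" by (rule less_le_trans)
    with t show "poset_nn_integral {0..<t} ?Y node_rel ?\<delta> =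
        ennreal (log_power i (t\<^sup>2) * log_root_int j (t\<^sup>2))"
      by (intro poset_nn_integral_A_lower) auto
  qed
  also have "\<dots> = ennreal ((1/2) ^ count_list (rev (T_labels ms)) 0) *
      iter_int (map squared_label (rev (T_labels ms)))
        (\<lambda>s. ennreal (log_power i ((sqrt s)\<^sup>2) * log_root_int j ((sqrt s)\<^sup>2))) y"
    using y Tl(3) by (intro iter_int_sqrt) auto
  also have "iter_int (map squared_label (rev (T_labels ms)))
        (\<lambda>s. ennreal (log_power i ((sqrt s)\<^sup>2) * log_root_int j ((sqrt s)\<^sup>2))) y =
      iter_int (map squared_label (rev (T_labels ms)))
        (\<lambda>s. ennreal (log_power i s * log_root_int j s)) y"
    by (rule iter_int_cong) (use ne in auto)
  also have "count_list (rev (T_labels ms)) 0 = sum_list ms + 1 - length ms" using Tl(2) by simp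
  finally show ?thesis by (simp add: enn2real_mult)
qed

text \<open>All forms are nonnegative, the labels are already those of the variable \<open>s\<close>, and \<open>v\<close> merely
  lengthens the chain of the \<open>u\<^sub>l\<close> by one.\<close>

lemma B_integral_eq:
  assumes ms: "composition ms" "ms \<noteq> []" and y: "0 \<le> y" "y \<le> 1"
  shows "B_integral ms i j y = enn2real (iter_int (map squared_label (rev (T_labels ms)))
      (\<lambda>s. ennreal (log_power i s * log_power (Suc j) s)) y)"
proof -
  let ?X = "X_carrier i j ms - {W}" and ?\<delta> = "\<lambda>a. squared_label (X_label ms a)"
  let ?Y = "insert V (U ` {1..j}) \<union> S ` {1..i}"
  note Tl = T_labels_properties[OF ms]
  have N: "1 \<le> sum_list ms" using composition_sum_pos[OF ms] by simp
  have fin: "finite ?X" using finite_X_carrier by simp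
  have ne: "map squared_label (rev (T_labels ms)) \<noteq> []"
    using Tl(1) N by (metis length_0_conv not_one_le_zero rev_is_Nil_conv map_is_Nil_conv)
  have sgn: "(\<Prod>a\<in>?X. form_coeff (?\<delta> a) (t a)) = 1 * (\<Prod>a\<in>?X. \<bar>form_coeff (?\<delta> a) (t a)\<bar>)"
    if "t \<in> poset_domain y ?X node_rel" for t
  proof -
    have "form_coeff (?\<delta> a) (t a) = \<bar>form_coeff (?\<delta> a) (t a)\<bar>" if a: "a \<in> ?X" for a
    proof -
      have "t \<in> ?X \<rightarrow>\<^sub>E {0..y}" using \<open>t \<in> _\<close> by (simp add: poset_domain_def)
      then have "t a \<in> {0..y}" using a by (rule PiE_mem)
      moreover have "?\<delta> a \<in> {0, 1, -2}"
        using X_label_values[OF ms, of a i j] a by (auto simp: squared_label_def)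
      ultimately show ?thesis
        using form_coeff_nonneg[of "?\<delta> a" "t a"] y by simp
    qed
    then show ?thesis unfolding mult_1 by (intro prod.cong refl)
  qed
  have "B_integral ms i j y = poset_integral y ?X node_rel ?\<delta>"
    unfolding B_integral_def poset_integral_def poset_domain_node_rel[OF N Diff_subset]
      squared_label_def ..
  also have "\<dots> = 1 * enn2real (poset_nn_integral {0..y} ?X node_rel ?\<delta>)"
    by (rule poset_integral_eq_nn_integral[OF fin _ sgn]) auto
  also have "poset_nn_integral {0..y} ?X node_rel ?\<delta> =
      iter_int (map squared_label (rev (T_labels ms))) (\<lambda>t. poset_nn_integral {0..<t} ?Y node_rel ?\<delta>) y"
    unfolding X_carrier_eq(2) rev_map[symmetric] map_X_label_T[OF Tl(1), symmetric]
    by (rule poset_nn_integral_chain_top[OF _ _ _ _ _ N])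
       (auto simp: inj_def node_rel_def)
  also have "\<dots> = iter_int (map squared_label (rev (T_labels ms)))
      (\<lambda>s. ennreal (log_power i s * log_power (Suc j) s)) y"
  proof (rule iter_int_cong[OF ne])
    fix t assume t: "0 < t" "t < y"
    have "poset_nn_integral {0..<t} ?Y node_rel ?\<delta> =
        poset_nn_integral {0..<t} (insert V (U ` {1..j})) node_rel ?\<delta> *
        poset_nn_integral {0..<t} (S ` {1..i}) node_rel ?\<delta>"
      by (intro poset_nn_integral_Un) (auto simp: node_rel_def)
    also have "poset_nn_integral {0..<t} (S ` {1..i}) node_rel ?\<delta> = iter_int (replicate i 1) (\<lambda>_. 1) t"
      by (rule poset_nn_integral_const_chain) (auto simp: inj_def node_rel_def squared_label_def)
    also have "\<dots> = ennreal (log_power i t)"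
      using t y by (intro iter_int_replicate_one) auto
    also have "poset_nn_integral {0..<t} (insert V (U ` {1..j})) node_rel ?\<delta> =
        (\<integral>\<^sup>+v. indicator {0<..<t} v * (ennreal \<bar>form_coeff (?\<delta> V) v\<bar> *
          poset_nn_integral {0..<v} (U ` {1..j}) node_rel ?\<delta>) \<partial>lborel)"
      by (rule poset_nn_integral_insert_top) (auto simp: node_rel_def)
    also have "\<dots> = iter_int (replicate (Suc j) 1) (\<lambda>_. 1) t"
    proof -
      have "poset_nn_integral {0..<v} (U ` {1..j}) node_rel ?\<delta> = iter_int (replicate j 1) (\<lambda>_. 1) v" for v
        by (rule poset_nn_integral_const_chain) (auto simp: inj_def node_rel_def squared_label_def)
      then show ?thesis by (simp add: squared_label_def)
    qed
    also have "\<dots> = ennreal (log_power (Suc j) t)"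
      using t y by (intro iter_int_replicate_one) auto
    finally show "poset_nn_integral {0..<t} ?Y node_rel ?\<delta> =
        ennreal (log_power i t * log_power (Suc j) t)"
      using t y by (simp add: ennreal_mult'' log_power_nonneg mult.commute)
  qed
  finally show ?thesis by simp
qed

section \<open>Polylogarithms and star sums as iterated integrals\<close>

text \<open>The word of the polylogarithm with reversed indices \<open>m\<^sub>p,\<dots>,m\<^sub>1\<close>: the label \<open>0\<close> stands for
  \<open>dt/t\<close> and \<open>1\<close> for \<open>dt/(1-t)\<close>.\<close>

definition polylog_word :: "nat list \<Rightarrow> int list" where
  "polylog_word ms = map squared_label (rev (T_labels ms))"

lemma polylog_word_one: "polylog_word [1] = [0]"
  by (simp add: polylog_word_def T_labels_one[simplified] squared_label_def)

lemma polylog_word_raise: "polylog_word (ms @ [Suc (Suc m)]) = 0 # polylog_word (ms @ [Suc m])"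
  by (simp add: polylog_word_def T_labels_raise squared_label_def)

lemma polylog_word_append: "ms \<noteq> [] \<Longrightarrow> polylog_word (ms @ [1]) = 1 # polylog_word ms"
  by (simp add: polylog_word_def T_labels_append[simplified] squared_label_def)

lemma composition_rev [simp]: "composition (rev ms) \<longleftrightarrow> composition ms"
  and composition_append [simp]: "composition (ms @ ns) \<longleftrightarrow> composition ms \<and> composition ns"
  and composition_Cons [simp]: "composition (m # ms) \<longleftrightarrow> 0 < m \<and> composition ms"
  and composition_Nil [simp]: "composition []"
  and composition_replicate_one [simp]: "composition (replicate n (Suc 0))"
  by (auto simp: composition_def)

lemma composition_drop [simp]: "composition ms \<Longrightarrow> composition (drop j ms)"
  and composition_take [simp]: "composition ms \<Longrightarrow> composition (take j ms)"
  by (auto simp: composition_def dest: in_set_dropD in_set_takeD)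

lemma polylog_convergesI:
  "composition ks \<Longrightarrow> 0 \<le> y \<Longrightarrow> y < 1 \<Longrightarrow> polylog_converges ks y"
  by (simp add: polylog_converges_def)

lemma polylog_replicate_one:
  "0 \<le> z \<Longrightarrow> z < 1 \<Longrightarrow> polylog (replicate n 1) z = log_power n z"
proof (induction n arbitrary: z)
  case (Suc n)
  have "iter_int (1 # replicate n 1) (\<lambda>_. 1) z = ennreal (polylog (1 # replicate n 1) z)"
  proof (rule iter_int_one_FTC[where G = "log_power n"])
    fix t assume t: "0 < t" "t < z"
    then show "iter_int (replicate n 1) (\<lambda>_. 1) t = ennreal (log_power n t)"
      using Suc.prems by (intro iter_int_replicate_one) auto
    show "(polylog (1 # replicate n 1) has_real_derivative log_power n t / (1 - t)) (at t)"
      using polylog_deriv_one[of "replicate n 1" t] Suc t by simp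
  qed (use Suc.prems in \<open>auto simp: polylog_0 log_power_nonneg
         intro!: continuous_on_polylog polylog_convergesI composition_replicate_one\<close>)
  then have "ennreal (polylog (replicate (Suc n) 1) z) = ennreal (log_power (Suc n) z)"
    using iter_int_replicate_one[OF Suc.prems, of "Suc n"] by simp
  then show ?case
    using Suc.prems polylog_nonneg[OF polylog_convergesI[OF composition_replicate_one Suc.prems, of "Suc n"]]
      log_power_nonneg[OF Suc.prems, of "Suc n"]
    by (simp add: ennreal_inj del: replicate_Suc)
qed simp

text \<open>At \<open>y = 1\<close> the outermost form must not be \<open>dt/(1-t)\<close>.\<close>

definition word_converges :: "nat list \<Rightarrow> real \<Rightarrow> bool" where
  "word_converges ms y \<longleftrightarrow> 0 \<le> y \<and> y \<le> 1 \<and> (y = 1 \<longrightarrow> length ms = 1 \<or> last ms \<ge> 2)"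

lemma word_convergesI: "0 < t \<Longrightarrow> t < y \<Longrightarrow> y \<le> 1 \<Longrightarrow> word_converges ms t"
  by (simp add: word_converges_def)

lemma abs_form_coeff_zero: "0 < t \<Longrightarrow> \<bar>form_coeff 0 t\<bar> * g = g / t"
  and abs_form_coeff_one: "t < 1 \<Longrightarrow> \<bar>form_coeff 1 t\<bar> * g = g / (1 - t)"
  by (simp_all add: form_coeff_simps)

text \<open>The \<open>m\<^sub>1\<close> innermost forms \<open>dt/t\<close> act on a power of the logarithm, which has the indices
  \<open>1,\<dots>,1\<close>, and raise the first of them to \<open>m\<^sub>1 + 1\<close>.\<close>

definition raised_word :: "nat list \<Rightarrow> nat \<Rightarrow> nat list" where
  "raised_word ms i = rev (tl ms) @ [hd ms + 1] @ replicate i 1"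

lemma polylog_converges_raised_word:
  assumes "composition ms" "ms \<noteq> []" "word_converges ms y"
  shows "polylog_converges (raised_word ms i) y"
proof -
  have c: "composition (raised_word ms i)"
    using assms by (cases ms) (simp_all add: raised_word_def composition_replicate_one)
  have "hd (raised_word ms i) \<ge> 2" if "length ms = 1 \<or> last ms \<ge> 2"
  proof (cases "tl ms = []")
    case True
    have "hd ms \<ge> 1" using assms by (cases ms) auto
    with True show ?thesis by (simp add: raised_word_def)
  next
    case False
    then have "length ms \<noteq> 1" by (cases ms) auto
    with that False show ?thesis
      by (simp add: raised_word_def hd_append hd_rev last_tl)
  qed
  then show ?thesis using c assms(3) by (auto simp: polylog_converges_def word_converges_def)
qed

text \<open>The outermost form of the word and the first index of the polylogarithm are both removed by one
  differentiation, and at \<open>y = 0\<close> both sides vanish.\<close>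

lemma iter_int_log_power:
  assumes "composition ms" "ms \<noteq> []" "word_converges ms y"
  shows "iter_int (polylog_word ms) (\<lambda>s. ennreal (log_power (Suc i) s)) y = ennreal (polylog (raised_word ms i) y)"
  using assms
proof (induction arbitrary: y rule: composition_induct)
  case one
  have y: "0 \<le> y" "y \<le> 1" using one by (auto simp: word_converges_def)
  have w: "raised_word [1] i = 2 # replicate i 1" by (simp add: raised_word_def)
  show ?case unfolding polylog_word_one w
  proof (rule iter_int_FTC(1)[where G = "log_power (Suc i)"])
    show "continuous_on {0..y} (polylog (2 # replicate i 1))"
      using polylog_converges_raised_word[OF _ _ one, of i] unfolding w
      by (intro continuous_on_polylog) simp
    fix t assume t: "0 < t" "t < y"
    then show "(polylog (2 # replicate i 1) has_real_derivative \<bar>form_coeff 0 t\<bar> * log_power (Suc i) t) (at t)"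
      using polylog_deriv_Suc[of 0 "replicate i 1" t] y polylog_replicate_one[of t "Suc i"]
      by (simp add: abs_form_coeff_zero composition_replicate_one numeral_2_eq_2)
  qed (use y in \<open>auto simp: polylog_0 log_power_nonneg\<close>)
next
  case (raise ms m)
  have y: "0 \<le> y" "y \<le> 1" using raise by (auto simp: word_converges_def)
  obtain k ks where w: "raised_word (ms @ [Suc m]) i = Suc k # ks"
    "raised_word (ms @ [Suc (Suc m)]) i = Suc (Suc k) # ks"
    by (cases ms) (simp_all add: raised_word_def)
  have c': "composition (ms @ [Suc (Suc m)])" using raise.hyps by simp
  have c: "composition (Suc k # ks)"
    using polylog_converges_raised_word[OF raise.hyps, of 0 i] w
    by (simp add: polylog_converges_def word_converges_def)
  show ?case unfolding polylog_word_raise w(2)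
  proof (rule iter_int_FTC(1)[where G = "polylog (Suc k # ks)"])
    show "continuous_on {0..y} (polylog (Suc (Suc k) # ks))"
      using polylog_converges_raised_word[OF c' _ raise.prems, of i] w
      by (intro continuous_on_polylog) simp
    fix t assume t: "0 < t" "t < y"
    show "iter_int (polylog_word (ms @ [Suc m])) (\<lambda>s. ennreal (log_power (Suc i) s)) t =
        ennreal (polylog (Suc k # ks) t)"
      using raise.IH[of t] word_convergesI[OF t y(2)] w by simp
    show "(polylog (Suc (Suc k) # ks) has_real_derivative \<bar>form_coeff 0 t\<bar> * polylog (Suc k # ks) t) (at t)"
      using polylog_deriv_Suc[OF c t(1)] t y by (simp add: abs_form_coeff_zero)
    show "0 \<le> polylog (Suc k # ks) t"
      using c t y by (intro polylog_nonneg polylog_convergesI) auto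
  qed (use y in \<open>auto simp: polylog_0\<close>)
next
  case (append ms)
  have y: "0 \<le> y" "y \<le> 1" "y < 1" using append by (auto simp: word_converges_def)
  have w: "raised_word (ms @ [1]) i = 1 # raised_word ms i"
    using append.hyps by (cases ms) (simp_all add: raised_word_def)
  have c: "composition (raised_word ms i)"
    using polylog_converges_raised_word[OF append.hyps, of 0 i]
    by (simp add: polylog_converges_def word_converges_def)
  show ?case unfolding polylog_word_append[OF append.hyps(2)] w
  proof (rule iter_int_one_FTC[where G = "polylog (raised_word ms i)"])
    show "continuous_on {0..y} (polylog (1 # raised_word ms i))"
      using c y by (intro continuous_on_polylog polylog_convergesI) auto
    fix t assume t: "0 < t" "t < y"
    show "iter_int (polylog_word ms) (\<lambda>s. ennreal (log_power (Suc i) s)) t =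
        ennreal (polylog (raised_word ms i) t)"
      using append.IH[of t] word_convergesI[OF t y(2)] by simp
    show "(polylog (1 # raised_word ms i) has_real_derivative polylog (raised_word ms i) t / (1 - t)) (at t)"
      using polylog_deriv_one[OF c, of t] t y by simp
    show "0 \<le> polylog (raised_word ms i) t"
      using c t y by (intro polylog_nonneg polylog_convergesI) auto
  qed (use y in \<open>auto simp: polylog_0\<close>)
qed

text \<open>The part of the identity that belongs to one \<open>n\<close>. The terms of the sum are, up to sign, the iterated
  integrals of the constants \<open>\<zeta>\<^sub>n\<^sup>\<star>((m\<^sub>1,\<dots>,m\<^sub>j)\<^sup>\<or>)\<close> that arise when the star sum is differentiated
  repeatedly, and they make the function vanish at \<open>y = 0\<close>.\<close>

definition star_remainder :: "nat \<Rightarrow> nat list \<Rightarrow> real \<Rightarrow> real" where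
  "star_remainder n ms y = star_sum n (hoffman_dual ms) (1 - y) -
     (\<Sum>j=1..length ms. (-1) ^ (length ms - j) * polylog (rev (drop j ms)) y *
        star_sum n (hoffman_dual (take j ms)) 1)"

text \<open>The term \<open>j = p\<close> has the empty polylogarithm \<open>1\<close> and is a constant; in the other terms the last
  part of the composition is the first index of the polylogarithm.\<close>

lemma star_remainder_snoc:
  "star_remainder n (ms @ [m]) y =
     star_sum n (hoffman_dual (ms @ [m])) (1 - y) - star_sum n (hoffman_dual (ms @ [m])) 1 -
     (\<Sum>j=1..length ms. (-1) ^ (Suc (length ms) - j) * polylog (m # rev (drop j ms)) y *
        star_sum n (hoffman_dual (take j ms)) 1)"
proof -
  have "(\<Sum>j=1..length ms. (-1) ^ (Suc (length ms) - j) * polylog (rev (drop j (ms @ [m]))) y *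
          star_sum n (hoffman_dual (take j (ms @ [m]))) 1) =
      (\<Sum>j=1..length ms. (-1) ^ (Suc (length ms) - j) * polylog (m # rev (drop j ms)) y *
        star_sum n (hoffman_dual (take j ms)) 1)"
    by (intro sum.cong refl) auto
  then show ?thesis by (simp add: star_remainder_def)
qed

lemma star_remainder_zero:
  assumes "ms \<noteq> []" shows "star_remainder n ms 0 = 0"
proof -
  have "star_remainder n (butlast ms @ [last ms]) 0 = 0"
    unfolding star_remainder_snoc by (simp add: polylog_0)
  then show ?thesis using assms by simp
qed

lemma continuous_on_star_remainder:
  assumes "composition ms" "ms \<noteq> []" "word_converges ms y"
  shows "continuous_on {0..y} (star_remainder n ms)"
proof -
  obtain ms' m where ms: "ms = ms' @ [m]" using assms(2) by (metis rev_exhaust)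
  have "continuous_on {0..y} (\<lambda>t. star_sum n (hoffman_dual ms) (1 - t))"
    by (rule continuous_on_compose2[OF star_sum_continuous[of UNIV]]) (auto intro!: continuous_intros)
  moreover have "continuous_on {0..y} (polylog (m # rev (drop j ms')))" if "j \<in> {1..length ms'}" for j
    using assms that ms
    by (intro continuous_on_polylog) (auto simp: polylog_converges_def word_converges_def)
  ultimately show ?thesis
    unfolding ms star_remainder_snoc by (intro continuous_intros) auto
qed

text \<open>The dual of the raised composition ends in an additional \<open>1\<close>. The constant produced by its
  derivative is the term \<open>j = p\<close> for the shorter composition.\<close>

lemma star_remainder_deriv_raise:
  assumes "composition (ms @ [Suc m])" "0 < t" "t < 1"
  shows "(star_remainder n (ms @ [Suc (Suc m)]) has_real_derivative star_remainder n (ms @ [Suc m]) t / t) (at t)"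
proof -
  let ?d = "hoffman_dual (ms @ [Suc m])"
  have dual: "hoffman_dual (ms @ [Suc (Suc m)]) = ?d @ [1]" by (rule hoffman_dual_raise[OF assms(1)])
  have "((\<lambda>t. star_sum n (?d @ [1]) (1 - t)) has_real_derivative
      ((star_sum n ?d 1 - star_sum n ?d (1 - t)) / (1 - (1 - t))) * (- 1)) (at t)"
    by (rule DERIV_chain2[OF star_sum_deriv_snoc_one]) (use assms in \<open>auto intro!: derivative_eq_intros\<close>)
  moreover have "((\<lambda>t. \<Sum>j=1..length ms. (-1) ^ (Suc (length ms) - j) * polylog (Suc (Suc m) # rev (drop j ms)) t *
        star_sum n (hoffman_dual (take j ms)) 1) has_real_derivative
      (\<Sum>j=1..length ms. (-1) ^ (Suc (length ms) - j) * (polylog (Suc m # rev (drop j ms)) t / t) *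
        star_sum n (hoffman_dual (take j ms)) 1)) (at t)"
    using assms by (intro DERIV_sum DERIV_cmult_right DERIV_cmult polylog_deriv_Suc) auto
  ultimately have "(star_remainder n (ms @ [Suc (Suc m)]) has_real_derivative
     ((star_sum n ?d 1 - star_sum n ?d (1 - t)) / (1 - (1 - t))) * (- 1) - 0 -
      (\<Sum>j=1..length ms. (-1) ^ (Suc (length ms) - j) * (polylog (Suc m # rev (drop j ms)) t / t) *
        star_sum n (hoffman_dual (take j ms)) 1)) (at t)"
    unfolding star_remainder_snoc dual by (intro DERIV_diff DERIV_const)
  also have "((star_sum n ?d 1 - star_sum n ?d (1 - t)) / (1 - (1 - t))) * (- 1) - 0 -
      (\<Sum>j=1..length ms. (-1) ^ (Suc (length ms) - j) * (polylog (Suc m # rev (drop j ms)) t / t) *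
        star_sum n (hoffman_dual (take j ms)) 1) = star_remainder n (ms @ [Suc m]) t / t"
    unfolding star_remainder_snoc by (simp add: diff_divide_distrib sum_divide_distrib)
  finally show ?thesis .
qed

text \<open>The last part of the dual is raised, so the derivative of the star sum has no constant term: the
  former constant \<open>j = p\<close> is now supplied by the derivative of the polylogarithm with index \<open>1\<close>. The
  length of the composition grows, hence the sign.\<close>

lemma star_remainder_deriv_append:
  assumes "composition ms" "ms \<noteq> []" "0 < t" "t < 1"
  shows "(star_remainder n (ms @ [1]) has_real_derivative - star_remainder n ms t / (1 - t)) (at t)"
proof -
  obtain ks k where dual: "hoffman_dual ms = ks @ [Suc k]" "hoffman_dual (ms @ [1]) = ks @ [Suc (Suc k)]"
    using hoffman_dual_append[OF assms(1,2)] by blast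
  have "((\<lambda>t. star_sum n (ks @ [Suc (Suc k)]) (1 - t)) has_real_derivative
      (star_sum n (ks @ [Suc k]) (1 - t) / (1 - t)) * (- 1)) (at t)"
    by (rule DERIV_chain2[OF star_sum_deriv_last]) (use assms in \<open>auto intro!: derivative_eq_intros\<close>)
  moreover have "((\<lambda>t. \<Sum>j=1..length ms. (-1) ^ (Suc (length ms) - j) * polylog (1 # rev (drop j ms)) t *
        star_sum n (hoffman_dual (take j ms)) 1) has_real_derivative
      (\<Sum>j=1..length ms. (-1) ^ (Suc (length ms) - j) * (polylog (rev (drop j ms)) t / (1 - t)) *
        star_sum n (hoffman_dual (take j ms)) 1)) (at t)"
    using assms by (intro DERIV_sum DERIV_cmult_right DERIV_cmult polylog_deriv_one) auto
  ultimately have "(star_remainder n (ms @ [1]) has_real_derivative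
     (star_sum n (ks @ [Suc k]) (1 - t) / (1 - t)) * (- 1) - 0 -
      (\<Sum>j=1..length ms. (-1) ^ (Suc (length ms) - j) * (polylog (rev (drop j ms)) t / (1 - t)) *
        star_sum n (hoffman_dual (take j ms)) 1)) (at t)"
    unfolding star_remainder_snoc dual by (intro DERIV_diff DERIV_const)
  also have "(\<Sum>j=1..length ms. (-1) ^ (Suc (length ms) - j) * (polylog (rev (drop j ms)) t / (1 - t)) *
        star_sum n (hoffman_dual (take j ms)) 1) =
     - (\<Sum>j=1..length ms. (-1) ^ (length ms - j) * polylog (rev (drop j ms)) t *
        star_sum n (hoffman_dual (take j ms)) 1) / (1 - t)"
    unfolding sum_divide_distrib sum_negf[symmetric]
    by (intro sum.cong refl) (simp add: Suc_diff_le)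
  finally show ?thesis
    unfolding star_remainder_def[of n ms] dual(1) by (simp add: diff_divide_distrib)
qed

text \<open>Nonnegativity is part of the induction because the passage from \<open>[0,\<infinity>]\<close> to real derivatives needs
  it.\<close>

lemma iter_int_star_remainder:
  assumes "composition ms" "ms \<noteq> []" "word_converges ms y"
  shows "iter_int (polylog_word ms) (\<lambda>s. ennreal (1 - (1 - s) ^ n)) y =
      ennreal ((-1) ^ length ms * star_remainder n ms y) \<and>
    0 \<le> (-1) ^ length ms * star_remainder n ms y"
  using assms
proof (induction arbitrary: y rule: composition_induct)
  case one
  have y: "0 \<le> y" "y \<le> 1" using one by (auto simp: word_converges_def)
  have deriv: "((\<lambda>t. (-1) ^ length [1 :: nat] * star_remainder n [1] t) has_real_derivative
      \<bar>form_coeff 0 t\<bar> * (1 - (1 - t) ^ n)) (at t)" if t: "0 < t" "t < y" for t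
  proof -
    have "((\<lambda>t. star_sum n ([] @ [1]) (1 - t)) has_real_derivative
        ((star_sum n [] 1 - star_sum n [] (1 - t)) / (1 - (1 - t))) * (- 1)) (at t)"
      by (rule DERIV_chain2[OF star_sum_deriv_snoc_one]) (use t in \<open>auto intro!: derivative_eq_intros\<close>)
    from DERIV_minus[OF DERIV_diff[OF this DERIV_const[of "star_sum n [1] 1"]]]
    show ?thesis
      using t star_remainder_snoc[of n "[]" 1] hoffman_dual_one
      by (simp add: abs_form_coeff_zero del: star_sum.simps(2) One_nat_def) 
  qed
  have nonneg: "0 \<le> 1 - (1 - t) ^ n" if "0 < t" "t < y" for t :: real
    using that y by (simp add: power_le_one)
  have cont: "continuous_on {0..y} (\<lambda>t. (-1) ^ length [1 :: nat] * star_remainder n [1] t)"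
    using one by (intro continuous_intros continuous_on_star_remainder) auto
  show ?case unfolding polylog_word_one
    using iter_int_FTC[OF y(1) cont _ _ nonneg deriv, of "[]" "\<lambda>s. ennreal (1 - (1 - s) ^ n)"]
    by (simp add: star_remainder_zero del: One_nat_def iter_int.simps(2))
next
  case (raise ms m)
  have y: "0 \<le> y" "y \<le> 1" using raise by (auto simp: word_converges_def)
  let ?F = "\<lambda>ms t. (-1) ^ length ms * star_remainder n ms t"
  have IH: "iter_int (polylog_word (ms @ [Suc m])) (\<lambda>s. ennreal (1 - (1 - s) ^ n)) t = ennreal (?F (ms @ [Suc m]) t)"
    "0 \<le> ?F (ms @ [Suc m]) t" if t: "0 < t" "t < y" for t
    using raise.IH[OF word_convergesI[OF t y(2)]] by blast+
  have cont: "continuous_on {0..y} (?F (ms @ [Suc (Suc m)]))"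
    using raise by (intro continuous_intros continuous_on_star_remainder) auto
  have deriv: "(?F (ms @ [Suc (Suc m)]) has_real_derivative \<bar>form_coeff 0 t\<bar> * ?F (ms @ [Suc m]) t) (at t)"
    if t: "0 < t" "t < y" for t
    using DERIV_cmult[OF star_remainder_deriv_raise[OF raise.hyps, of t n], of "(-1) ^ length (ms @ [Suc m])"] t y
    by (simp add: abs_form_coeff_zero)
  show ?case unfolding polylog_word_raise
    using iter_int_FTC[OF y(1) cont _ IH(1) IH(2) deriv] by (simp add: star_remainder_zero)
next
  case (append ms)
  have y: "0 \<le> y" "y \<le> 1" using append by (auto simp: word_converges_def)
  let ?F = "\<lambda>ms t. (-1) ^ length ms * star_remainder n ms t"
  have IH: "iter_int (polylog_word ms) (\<lambda>s. ennreal (1 - (1 - s) ^ n)) t = ennreal (?F ms t)"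
    "0 \<le> ?F ms t" if t: "0 < t" "t < y" for t
    using append.IH[OF word_convergesI[OF t y(2)]] by blast+
  have cont: "continuous_on {0..y} (?F (ms @ [1]))"
    using append by (intro continuous_intros continuous_on_star_remainder) auto
  have deriv: "(?F (ms @ [1]) has_real_derivative \<bar>form_coeff 1 t\<bar> * ?F ms t) (at t)"
    if t: "0 < t" "t < y" for t
    using DERIV_cmult[OF star_remainder_deriv_append[OF append.hyps, of t n], of "(-1) ^ length (ms @ [1])"] t y
    by (simp add: abs_form_coeff_one)
  show ?case unfolding polylog_word_append[OF append.hyps(2)]
    using iter_int_FTC[OF y(1) cont _ IH(1) IH(2) deriv] by (simp add: star_remainder_zero)
qed

section \<open>The central binomial series\<close>

definition central_coeff :: "nat \<Rightarrow> real" where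
  "central_coeff n = real ((2 * n) choose n) / 4 ^ n"

lemma central_coeff_0 [simp]: "central_coeff 0 = 1"
  by (simp add: central_coeff_def)

lemma central_coeff_nonneg: "0 \<le> central_coeff n"
  by (simp add: central_coeff_def)

lemma central_coeff_rec: "real (2 * n + 2) * central_coeff (Suc n) = real (2 * n + 1) * central_coeff n"
proof -
  have f: "central_coeff m = fact (2 * m) / (fact m * fact m * 4 ^ m)" for m
    unfolding central_coeff_def by (subst binomial_fact) auto
  have "fact (2 * Suc n) = real (2 * n + 2) * (real (2 * n + 1) * fact (2 * n))" by simp
  moreover have "fact (Suc n) = real (n + 1) * fact n" by simp
  moreover have "real (2 * n + 2) = 2 * real (n + 1)" by simp
  ultimately show ?thesis unfolding f by (simp add: divide_simps del: fact_Suc of_nat_Suc of_nat_add)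
qed

lemma central_coeff_le_one: "central_coeff n \<le> 1"
proof (induction n)
  case (Suc n)
  have "real (2 * n + 2) * central_coeff (Suc n) \<le> real (2 * n + 2) * 1"
    unfolding central_coeff_rec using Suc central_coeff_nonneg[of n]
    by (intro mult_mono) auto
  then show ?case by (subst (asm) mult_le_cancel_left_pos) auto
qed simp

lemma gbinomial_minus_half: "((- 1 / 2 :: real) gchoose n) = (-1) ^ n * central_coeff n"
proof (induction n)
  case (Suc n)
  have "real (Suc n) * ((- 1 / 2 :: real) gchoose Suc n) = (- 1 / 2 - real n) * ((- 1 / 2) gchoose n)"
    using gbinomial_mult_1[of "- 1 / 2 :: real" n] by (simp add: algebra_simps)
  also have "\<dots> = (-1) ^ Suc n * (real (2 * n + 1) * central_coeff n) / 2"
    unfolding Suc by (simp add: algebra_simps)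
  also have "\<dots> = real (Suc n) * ((-1) ^ Suc n * central_coeff (Suc n))"
    unfolding central_coeff_rec[symmetric] by (simp add: field_simps)
  finally show ?case by (subst (asm) mult_left_cancel) auto
qed simp

lemma central_coeff_sums:
  assumes "0 \<le> q" "q < 1"
  shows "(\<lambda>n. central_coeff n * q ^ n) sums (1 / sqrt (1 - q))"
proof -
  have "(\<lambda>n. ((- 1 / 2) gchoose n) * (- q) ^ n) sums (1 + (- q)) powr (- 1 / 2)"
    by (rule gen_binomial_real) (use assms in auto)
  moreover have "((- 1 / 2) gchoose n) * (- q) ^ n = central_coeff n * q ^ n" for n
  proof -
    have "(-1) ^ n * central_coeff n * ((-1) ^ n * q ^ n) =
        ((-1) ^ n * (-1) ^ n) * (central_coeff n * q ^ n)"
      by (simp only: mult_ac)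
    then show ?thesis
      unfolding gbinomial_minus_half power_minus[of q] by (simp only: minus_one_mult_self mult_1)
  qed
  moreover have "(1 + (- q)) powr (- 1 / 2) = 1 / sqrt (1 - q)"
  proof -
    have "(1 - q) powr (- (1 / 2)) = inverse ((1 - q) powr (1 / 2))" by (rule powr_minus)
    also have "(1 - q) powr (1 / 2) = sqrt (1 - q)"
      using assms by (intro powr_half_sqrt) simp
    finally show ?thesis
      by (simp only: divide_inverse mult_1 minus_mult_left[symmetric] add_uminus_conv_diff)
  qed
  ultimately show ?thesis by (simp only:)
qed

definition central_weight :: "nat \<Rightarrow> nat \<Rightarrow> real" where
  "central_weight k n = (if n = 0 then 0 else central_coeff n / real n ^ k)"

definition central_polylog :: "nat \<Rightarrow> real \<Rightarrow> real" where
  "central_polylog k q = (\<Sum>n. central_weight k n * q ^ n)"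

lemma central_weight_nonneg: "0 \<le> central_weight k n"
  by (simp add: central_weight_def central_coeff_nonneg)

lemma central_weight_le_one: "central_weight k n \<le> 1"
proof (cases "n = 0")
  case False
  have "central_coeff n / real n ^ k \<le> 1 / 1"
    using False central_coeff_le_one by (intro frac_le) auto
  then show ?thesis using False by (simp add: central_weight_def)
qed (simp add: central_weight_def)

lemma summable_central: "\<bar>z\<bar> < 1 \<Longrightarrow> summable (\<lambda>n. central_weight k n * z ^ n)"
proof (rule summable_comparison_test'[where g = "\<lambda>n. \<bar>z\<bar> ^ n"])
  show "norm (central_weight k n * z ^ n) \<le> \<bar>z\<bar> ^ n" for n
    using central_weight_le_one[of k n] central_weight_nonneg[of k n]
    by (simp add: abs_mult power_abs mult_left_le_one_le)
qed (simp add: summable_geometric)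

lemma summable_central_weight: "summable (central_weight (k + 2))"
proof (rule summable_comparison_test')
  show "summable (\<lambda>n. 1 / real n ^ 2)"
    using inverse_power_summable[of 2, where 'a = real] by (simp add: divide_inverse)
  fix n :: nat assume n: "n \<ge> 1"
  have "central_coeff n / real n ^ (k + 2) \<le> 1 / real n ^ 2"
    using n central_coeff_le_one by (intro frac_le power_increasing) auto
  then show "norm (central_weight (k + 2) n) \<le> 1 / real n ^ 2"
    using n central_weight_nonneg[of "k + 2" n] by (simp add: central_weight_def central_coeff_nonneg)
qed

lemma continuous_on_central_polylog:
  assumes "0 \<le> y" "y < 1 \<or> k \<ge> 2 \<and> y = 1" shows "continuous_on {0..y} (central_polylog k)"
proof -
  have "summable (\<lambda>n. central_weight k n * y ^ n)"
  proof (cases "y < 1")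
    case False
    then have "y = 1" "k = (k - 2) + 2" using assms by auto
    then show ?thesis using summable_central_weight[of "k - 2"] by simp
  qed (use assms in \<open>auto intro: summable_central\<close>)
  then have "uniform_limit {0..y} (\<lambda>n z. \<Sum>i<n. central_weight k i * z ^ i)
          (\<lambda>z. \<Sum>i. central_weight k i * z ^ i) sequentially"
    by (rule Weierstrass_m_test[rotated])
       (auto simp: abs_mult central_weight_nonneg power_abs intro!: mult_left_mono power_mono)
  then show ?thesis
    unfolding central_polylog_def
    by (rule uniform_limit_theorem[rotated]) (auto intro!: continuous_intros always_eventually)
qed

lemma central_polylog_deriv:
  assumes "0 < q" "q < 1"
  shows "(central_polylog (Suc k) has_real_derivative central_polylog k q / q) (at q)"
  unfolding central_polylog_def
proof (rule powser_theta_deriv)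
  show "real n * central_weight (Suc k) n = central_weight k n" for n
    by (simp add: central_weight_def)
qed (use assms in \<open>auto intro: summable_central\<close>)

lemma central_polylog_0:
  assumes "0 \<le> q" "q < 1" shows "central_polylog 0 q = 1 / sqrt (1 - q) - 1"
proof -
  have "(\<lambda>n. central_coeff (Suc n) * q ^ Suc n) sums (1 / sqrt (1 - q) - 1)"
    using central_coeff_sums[OF assms] by (subst sums_Suc_iff) simp
  then have "(\<lambda>n. central_weight 0 (Suc n) * q ^ Suc n) sums (1 / sqrt (1 - q) - 1)"
    by (simp add: central_weight_def)
  then have "(\<lambda>n. central_weight 0 n * q ^ n) sums (1 / sqrt (1 - q) - 1)"
    by (subst (asm) sums_Suc_iff) (simp add: central_weight_def)
  then show ?thesis by (simp add: central_polylog_def sums_iff)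
qed

lemma equal_derivatives_imp_eq:
  fixes f g :: "real \<Rightarrow> real"
  assumes "0 \<le> y" "continuous_on {0..y} f" "continuous_on {0..y} g" "f 0 = g 0"
    and "\<And>t. 0 < t \<Longrightarrow> t < y \<Longrightarrow> (f has_real_derivative d t) (at t)"
    and "\<And>t. 0 < t \<Longrightarrow> t < y \<Longrightarrow> (g has_real_derivative d t) (at t)"
  shows "f y = g y"
proof (cases "y = 0")
  case False
  have "(\<lambda>t. f t - g t) y = (\<lambda>t. f t - g t) 0"
  proof (rule DERIV_isconst2[of 0 y _ y])
    show "((\<lambda>t. f t - g t) has_real_derivative 0) (at t)" if "0 < t" "t < y" for t
      using DERIV_diff[OF assms(5)[OF that] assms(6)[OF that]] by simp
  qed (use assms False in \<open>auto intro!: continuous_intros\<close>)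
  then show ?thesis using assms(4) by simp
qed (use assms in simp)

text \<open>The derivatives agree because \<open>q = (1-r)(1+r)\<close> for \<open>r = sqrt (1-q)\<close>.\<close>

lemma central_polylog_1:
  assumes "0 \<le> q" "q < 1" shows "central_polylog 1 q = 2 * ln 2 - 2 * ln (1 + sqrt (1 - q))"
proof (rule equal_derivatives_imp_eq[OF assms(1)])
  have pos: "1 + sqrt (1 - t) > 0" if "t \<le> 1" for t using that by (simp add: add_pos_nonneg)
  show "continuous_on {0..q} (central_polylog 1)"
    using assms by (intro continuous_on_central_polylog) auto
  show "continuous_on {0..q} (\<lambda>q. 2 * ln 2 - 2 * ln (1 + sqrt (1 - q)))"
    using pos assms by (intro continuous_intros) (fastforce simp: less_le)
  show "central_polylog 1 0 = 2 * ln 2 - 2 * ln (1 + sqrt (1 - 0))"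
    by (simp add: central_polylog_def central_weight_def)
  fix t assume t: "0 < t" "t < q"
  show "(central_polylog 1 has_real_derivative central_polylog 0 t / t) (at t)"
    using central_polylog_deriv[of t 0] t assms by simp
  \<comment> \<open>In terms of \<open>r\<close> both derivatives are rational functions.\<close>
  define r where "r = sqrt (1 - t)"
  have r: "0 < r" "r < 1" and t_eq: "t = (1 - r) * (1 + r)"
    using t assms by (auto simp: r_def algebra_simps)
  have "((\<lambda>q. 2 * ln 2 - 2 * ln (1 + sqrt (1 - q))) has_real_derivative
      - (2 * ((- 1 * (inverse (sqrt (1 - t)) / 2)) / (1 + sqrt (1 - t))))) (at t)"
    using t assms pos[of t] by (auto intro!: derivative_eq_intros simp: divide_simps)
  also have "- (2 * ((- 1 * (inverse (sqrt (1 - t)) / 2)) / (1 + sqrt (1 - t)))) = 1 / (r * (1 + r))"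
    unfolding r_def[symmetric] using r by (simp add: divide_simps)
  also have "1 / (r * (1 + r)) = (1 / r - 1) / t"
    unfolding t_eq using r by (simp add: divide_simps)
  also have "(1 / r - 1) / t = central_polylog 0 t / t"
    using t assms by (simp add: central_polylog_0 r_def)
  finally show "((\<lambda>q. 2 * ln 2 - 2 * ln (1 + sqrt (1 - q))) has_real_derivative central_polylog 0 t / t) (at t)" .
qed

text \<open>The binomial expansion of \<open>(L - L)\<^sup>k / k!\<close> with \<open>L = -log (1-s)\<close>.\<close>

lemma alternating_log_power_sum: "(\<Sum>i\<le>k. (-1) ^ i * log_power i s * log_power (k - i) s) = (if k = 0 then 1 else 0)"
proof -
  have "(\<Sum>i\<le>k. (-1) ^ i * log_power i s * log_power (k - i) s) =
      (\<Sum>i\<le>k. (-1) ^ i * real (k choose i)) * log_power k s"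
    unfolding sum_distrib_right
    by (intro sum.cong refl) (simp add: mult.assoc log_power_mult)
  also have "\<dots> = (if k = 0 then 1 else 0)"
    using choose_alternating_sum[of k, where 'a = real] by simp
  finally show ?thesis .
qed

text \<open>A primitive of \<open>-g\<^sub>j(s) C(1-s) / (1-s)\<close> with \<open>C\<close> the central binomial series of exponent \<open>1\<close>; the
  constant is the value at \<open>s = 0\<close> that the expansion below requires.\<close>

definition log_primitive :: "nat \<Rightarrow> real \<Rightarrow> real" where
  "log_primitive j s = central_polylog (j + 2) 1 + 2 * log_root_int j s - 2 * ln 2 * log_power (Suc j) s"

lemma log_primitive_deriv:
  assumes "0 < s" "s < 1"
  shows "(log_primitive j has_real_derivative - (log_power j s * central_polylog 1 (1 - s) / (1 - s))) (at s)"
proof -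
  have c: "central_polylog 1 (1 - s) = 2 * ln 2 - 2 * ln (1 + sqrt s)"
    using central_polylog_1[of "1 - s"] assms by simp
  have "(log_primitive j has_real_derivative 0 + 2 * (log_power j s * ln (1 + sqrt s) / (1 - s)) -
      2 * ln 2 * (log_power j s / (1 - s))) (at s)"
    unfolding log_primitive_def using assms
    by (intro DERIV_diff DERIV_add DERIV_const DERIV_cmult log_root_int_deriv log_power_deriv) auto
  also have "0 + 2 * (log_power j s * ln (1 + sqrt s) / (1 - s)) - 2 * ln 2 * (log_power j s / (1 - s)) =
      - (log_power j s * central_polylog 1 (1 - s) / (1 - s))"
    unfolding c by (simp add: algebra_simps diff_divide_distrib)
  finally show ?thesis .
qed

text \<open>Differentiating the powers of the logarithm shifts the index and gives back the sum for \<open>k - 1\<close>.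
  Differentiating the second factors gives the alternating sum of products of powers, which cancels
  except for \<open>k = 0\<close>.\<close>

lemma log_primitive_convolution_deriv:
  assumes "0 < s" "s < 1"
  shows "((\<lambda>s. \<Sum>i\<le>k. (-1) ^ i * log_power i s * log_primitive (k - i) s) has_real_derivative
    - ((if k = 0 then central_polylog 1 (1 - s)
        else (\<Sum>i\<le>k - 1. (-1) ^ i * log_power i s * log_primitive (k - 1 - i) s)) / (1 - s))) (at s)"
proof -
  define g' where "g' = (\<lambda>i. if i = 0 then 0 else log_power (i - 1) s / (1 - s))"
  define h' where "h' = (\<lambda>j. - (log_power j s * central_polylog 1 (1 - s) / (1 - s)))"
  have g: "(log_power i has_real_derivative g' i) (at s)" for i
  proof (cases i)
    case 0
    have "log_power 0 = (\<lambda>_. 1)" by (simp add: fun_eq_iff)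
    then show ?thesis by (simp add: 0 g'_def)
  next
    case (Suc j)
    then show ?thesis using log_power_deriv[OF assms(2), of j] by (simp add: g'_def)
  qed
  have h: "(log_primitive j has_real_derivative h' j) (at s)" for j
    unfolding h'_def by (rule log_primitive_deriv[OF assms])
  have "((\<lambda>s. \<Sum>i\<le>k. (-1) ^ i * (log_power i s * log_primitive (k - i) s)) has_real_derivative
      (\<Sum>i\<le>k. (-1) ^ i * (g' i * log_primitive (k - i) s + h' (k - i) * log_power i s))) (at s)"
    by (intro DERIV_sum DERIV_cmult DERIV_mult g h)
  also have "(\<Sum>i\<le>k. (-1) ^ i * (g' i * log_primitive (k - i) s + h' (k - i) * log_power i s)) =
      (\<Sum>i\<le>k. (-1) ^ i * g' i * log_primitive (k - i) s) +
      (\<Sum>i\<le>k. (-1) ^ i * log_power i s * h' (k - i))"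
    unfolding sum.distrib[symmetric] by (intro sum.cong refl) (simp add: algebra_simps)
  also have "(\<Sum>i\<le>k. (-1) ^ i * log_power i s * h' (k - i)) =
      - (if k = 0 then 1 else 0) * (central_polylog 1 (1 - s) / (1 - s))"
    unfolding alternating_log_power_sum[where k = k and s = s, symmetric] h'_def sum_negf[symmetric] sum_distrib_right
    by (intro sum.cong refl) simp
  also have "(\<Sum>i\<le>k. (-1) ^ i * g' i * log_primitive (k - i) s) = (if k = 0 then 0 else
      - (\<Sum>i\<le>k - 1. (-1) ^ i * log_power i s * log_primitive (k - 1 - i) s) / (1 - s))"
  proof (cases k)
    case (Suc m)
    have "(\<Sum>i\<le>Suc m. (-1) ^ i * g' i * log_primitive (Suc m - i) s) =
        (\<Sum>i\<le>m. (-1) ^ Suc i * g' (Suc i) * log_primitive (m - i) s)"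
      by (subst sum.atMost_Suc_shift) (simp add: g'_def)
    also have "\<dots> = - (\<Sum>i\<le>m. (-1) ^ i * log_power i s * log_primitive (m - i) s) / (1 - s)"
      unfolding sum_divide_distrib sum_negf[symmetric]
      by (intro sum.cong refl) (simp add: g'_def)
    finally show ?thesis by (simp add: Suc)
  qed (simp add: g'_def)
  finally show ?thesis by (auto simp: mult.assoc)
qed

text \<open>Both sides have the value \<open>c\<^bsub>k+2\<^esub>\<close> at \<open>s = 0\<close>, and their derivatives agree by the case \<open>k - 1\<close>; for
  \<open>k = 0\<close> both derivatives contain the series of exponent \<open>1\<close>.\<close>

lemma central_polylog_expansion:
  assumes "0 \<le> s" "s < 1"
  shows "central_polylog (k + 2) (1 - s) = (\<Sum>i\<le>k. (-1) ^ i * log_power i s * log_primitive (k - i) s)"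
  using assms
proof (induction k arbitrary: s rule: less_induct)
  case (less k)
  show ?case
  proof (rule equal_derivatives_imp_eq[OF less.prems(1)])
    show "continuous_on {0..s} (\<lambda>s. central_polylog (k + 2) (1 - s))"
      by (rule continuous_on_compose2[OF continuous_on_central_polylog[of 1]])
        (use less.prems in \<open>auto intro!: continuous_intros\<close>)
    show "continuous_on {0..s} (\<lambda>s. \<Sum>i\<le>k. (-1) ^ i * log_power i s * log_primitive (k - i) s)"
      unfolding log_primitive_def using less.prems
      by (intro continuous_intros continuous_on_log_power continuous_on_log_root_int)
    have "(\<Sum>i\<le>k. (-1) ^ i * log_power i 0 * log_primitive (k - i) 0) =
        (\<Sum>i\<in>{0}. (-1) ^ i * log_power i 0 * log_primitive (k - i) 0)"
      by (rule sum.mono_neutral_right) (auto simp: log_power_def)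
    then show "central_polylog (k + 2) (1 - 0) = (\<Sum>i\<le>k. (-1) ^ i * log_power i 0 * log_primitive (k - i) 0)"
      by (simp add: log_primitive_def log_root_int_at_zero)
    fix t assume t: "0 < t" "t < s"
    then have t1: "t < 1" using less.prems by simp
    have "((\<lambda>s. central_polylog (k + 2) (1 - s)) has_real_derivative
        (central_polylog (k + 1) (1 - t) / (1 - t)) * (- 1)) (at t)"
      using central_polylog_deriv[of "1 - t" "k + 1"] t t1
      by (intro DERIV_chain2[of "central_polylog (k + 2)"]) (auto intro!: derivative_eq_intros)
    then show "((\<lambda>s. central_polylog (k + 2) (1 - s)) has_real_derivative
        - (central_polylog (k + 1) (1 - t) / (1 - t))) (at t)" by simp
    have "(if k = 0 then central_polylog 1 (1 - t)
        else (\<Sum>i\<le>k - 1. (-1) ^ i * log_power i t * log_primitive (k - 1 - i) t)) = central_polylog (k + 1) (1 - t)"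
    proof (cases k)
      case (Suc m)
      then show ?thesis using less.IH[of m t] t t1 by simp
    qed simp
    then show "((\<lambda>s. \<Sum>i\<le>k. (-1) ^ i * log_power i s * log_primitive (k - i) s) has_real_derivative
        - (central_polylog (k + 1) (1 - t) / (1 - t))) (at t)"
      using log_primitive_convolution_deriv[OF t(1) t1, of k] by simp
  qed
qed

section \<open>The integrated identity\<close>

lemma infsum_central_eq:
  assumes "\<And>n. 0 \<le> f n" "summable (\<lambda>n. central_weight k n * f n)"
  shows "(\<Sum>\<^sub>\<infinity>n\<in>{1..}. f n / (real n ^ k * 4 ^ n) * real ((2 * n) choose n)) =
    (\<Sum>n. central_weight k n * f n)"
proof (rule infsumI)
  have "((\<lambda>n. central_weight k n * f n) has_sum (\<Sum>n. central_weight k n * f n)) UNIV"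
    using assms by (intro sums_nonneg_imp_has_sum summable_sums)
      (auto simp: central_weight_nonneg)
  then show "((\<lambda>n. f n / (real n ^ k * 4 ^ n) * real ((2 * n) choose n)) has_sum
      (\<Sum>n. central_weight k n * f n)) {1..}"
    by (rule has_sum_cong_neutral[THEN iffD1, rotated -1])
       (auto simp: central_weight_def central_coeff_def mult_ac)
qed

lemma summable_central_star_sum:
  assumes "composition ks" "0 \<le> x" "x \<le> 1"
  shows "summable (\<lambda>n. central_weight (k + 2) n * star_sum n ks x)"
proof -
  obtain C where C: "C \<ge> 0" "\<And>n. n \<ge> 1 \<Longrightarrow> star_sum n ks 1 \<le> C * sqrt (real n)"
    using star_sum_bound[OF assms(1)] by blast
  show ?thesis
  proof (rule summable_comparison_test')
    show "summable (\<lambda>n. C * (1 / (real n * sqrt (real n))))"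
      by (intro summable_mult summable_inverse_n_sqrt)
    fix n :: nat assume n: "n \<ge> 1"
    have "central_coeff n / real n ^ (k + 2) \<le> 1 / real n ^ 2"
      using n central_coeff_le_one by (intro frac_le power_increasing) auto
    then have "central_weight (k + 2) n \<le> 1 / real n ^ 2"
      using n by (simp add: central_weight_def)
    moreover have "star_sum n ks x \<le> C * sqrt (real n)"
      using star_sum_mono[OF assms(2,3), of n ks] C(2)[OF n] by simp
    ultimately have "central_weight (k + 2) n * star_sum n ks x \<le> (1 / real n ^ 2) * (C * sqrt (real n))"
      using star_sum_nonneg[OF assms(2)] by (intro mult_mono) auto
    also have "\<dots> = C * (1 / (real n * sqrt (real n)))"
      using n by (simp add: field_simps power2_eq_square)
    finally show "norm (central_weight (k + 2) n * star_sum n ks x) \<le> C * (1 / (real n * sqrt (real n)))"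
      using central_weight_nonneg[of "k + 2" n] star_sum_nonneg[OF assms(2), of n ks] by simp
  qed
qed

text \<open>The expansion, subtracted from its value at \<open>s = 0\<close>. The constant function in the term \<open>i = 0\<close> is
  not integrable against \<open>dt/t\<close>; it cancels here, and only functions vanishing at \<open>0\<close> remain.\<close>

lemma sums_one_minus_power:
  assumes "0 < s" "s < 1"
  shows "(\<lambda>n. central_weight (k + 2) n * (1 - (1 - s) ^ n)) sums
    (- (\<Sum>i=1..k. (-1) ^ i * central_polylog (k - i + 2) 1 * log_power i s)
     - 2 * (\<Sum>i\<le>k. (-1) ^ i * (log_power i s * log_root_int (k - i) s))
     + 2 * ln 2 * (\<Sum>i\<le>k. (-1) ^ i * (log_power i s * log_power (Suc (k - i)) s)))"
proof -
  have "(\<lambda>n. central_weight (k + 2) n * 1 ^ n) sums central_polylog (k + 2) 1"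
    unfolding central_polylog_def using summable_central_weight by (intro summable_sums) simp
  moreover have "(\<lambda>n. central_weight (k + 2) n * (1 - s) ^ n) sums central_polylog (k + 2) (1 - s)"
    unfolding central_polylog_def using assms by (intro summable_sums summable_central) auto
  ultimately have "(\<lambda>n. central_weight (k + 2) n * 1 ^ n - central_weight (k + 2) n * (1 - s) ^ n) sums
      (central_polylog (k + 2) 1 - central_polylog (k + 2) (1 - s))"
    by (rule sums_diff)
  also have "(\<lambda>n. central_weight (k + 2) n * 1 ^ n - central_weight (k + 2) n * (1 - s) ^ n) =
      (\<lambda>n. central_weight (k + 2) n * (1 - (1 - s) ^ n))"
    by (simp add: right_diff_distrib)
  also have "central_polylog (k + 2) (1 - s) =
      (\<Sum>i\<le>k. (-1) ^ i * central_polylog (k - i + 2) 1 * log_power i s)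
      + 2 * (\<Sum>i\<le>k. (-1) ^ i * (log_power i s * log_root_int (k - i) s))
      - 2 * ln 2 * (\<Sum>i\<le>k. (-1) ^ i * (log_power i s * log_power (Suc (k - i)) s))"
    unfolding central_polylog_expansion[OF less_imp_le[OF assms(1)] assms(2)] sum_distrib_left
      sum.distrib[symmetric] sum_subtractf[symmetric]
    by (intro sum.cong refl) (simp add: log_primitive_def algebra_simps)
  also have "(\<Sum>i\<le>k. (-1) ^ i * central_polylog (k - i + 2) 1 * log_power i s) =
      central_polylog (k + 2) 1 + (\<Sum>i=1..k. (-1) ^ i * central_polylog (k - i + 2) 1 * log_power i s)"
    by (simp add: atMost_atLeast0 sum.atLeast_Suc_atMost[of 0 k])
  finally show ?thesis by (simp add: algebra_simps)
qed

lemma integrable_log_power: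
  assumes ms: "composition ms" "ms \<noteq> []" "word_converges ms y"
    and M: "sets M = sets borel"
      "\<And>h. h \<in> borel_measurable borel \<Longrightarrow> iter_int (polylog_word ms) h y = (\<integral>\<^sup>+s. h s \<partial>M)"
      "AE s in M. 0 < s \<and> s < y"
  shows "integrable M (log_power (Suc i))"
    and "(\<integral>s. log_power (Suc i) s \<partial>M) = polylog (raised_word ms i) y"
proof -
  have y: "y \<le> 1" using ms(3) by (simp add: word_converges_def)
  have [measurable]: "log_power (Suc i) \<in> borel_measurable M"
    by (simp add: measurable_cong_sets[OF M(1) refl])
  have "(\<integral>\<^sup>+s. ennreal (log_power (Suc i) s) \<partial>M) = ennreal (polylog (raised_word ms i) y)"
    using iter_int_log_power[OF ms, of i] M(2)[of "\<lambda>s. ennreal (log_power (Suc i) s)"] by simp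
  moreover have nn: "AE s in M. 0 \<le> log_power (Suc i) s"
    using M(3) by eventually_elim (use y in \<open>auto intro: log_power_nonneg\<close>)
  moreover have "0 \<le> polylog (raised_word ms i) y"
    by (rule polylog_nonneg[OF polylog_converges_raised_word[OF ms]])
  ultimately have "has_bochner_integral M (log_power (Suc i)) (polylog (raised_word ms i) y)"
    by (intro has_bochner_integral_nn_integral) auto
  then show "integrable M (log_power (Suc i))"
    "(\<integral>s. log_power (Suc i) s \<partial>M) = polylog (raised_word ms i) y"
    by (auto simp: has_bochner_integral_iff)
qed

lemma nn_suminf_imp_sums:
  assumes "\<And>n. 0 \<le> a n" "0 \<le> r" "(\<Sum>n. ennreal (a n)) = ennreal r"
  shows "a sums r"
proof -
  have s: "summable a"
    by (rule summable_suminf_not_top[OF assms(1)]) (simp add: assms(3))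
  have "ennreal (suminf a) = ennreal r"
    using suminf_ennreal2[OF assms(1) s] assms(3) by (rule trans[OF sym])
  then have "suminf a = r"
    using suminf_nonneg[OF s assms(1)] assms(2) by (simp only: ennreal_inj)
  with s show ?thesis using summable_sums by blast
qed

text \<open>The pointwise identity is integrated against the measure that represents the iterated integral.
  The series has nonnegative terms, so monotone convergence gives its convergence together with its
  sum, and the finite sums on the other side are split because each function in them is integrable.\<close>

lemma central_star_remainder_sums:
  assumes ms: "composition ms" "ms \<noteq> []" "word_converges ms y"
  shows "(\<lambda>n. central_weight (k + 2) n * ((-1) ^ length ms * star_remainder n ms y)) sums
    (- (\<Sum>i=1..k. (-1) ^ i * central_polylog (k - i + 2) 1 * polylog (raised_word ms (i - 1)) y)
     - 2 * (\<Sum>i\<le>k. (-1) ^ i * enn2real (iter_int (polylog_word ms)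
         (\<lambda>s. ennreal (log_power i s * log_root_int (k - i) s)) y))
     + 2 * ln 2 * (\<Sum>i\<le>k. (-1) ^ i * enn2real (iter_int (polylog_word ms)
         (\<lambda>s. ennreal (log_power i s * log_power (Suc (k - i)) s)) y)))"
    (is "_ sums ?R")
proof -
  have y: "0 \<le> y" "y \<le> 1" using ms(3) by (auto simp: word_converges_def)
  have ne: "polylog_word ms \<noteq> []"
    using T_labels_properties(1)[OF ms(1,2)] composition_sum_pos[OF ms(1,2)]
    unfolding polylog_word_def
    by (metis length_0_conv less_irrefl rev_is_Nil_conv map_is_Nil_conv)
  obtain M where M: "sets M = sets borel"
      "\<And>h. h \<in> borel_measurable borel \<Longrightarrow> iter_int (polylog_word ms) h y = (\<integral>\<^sup>+s. h s \<partial>M)"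
      "AE s in M. 0 < s \<and> s < y"
    using iter_int_measure[OF ne, of y] by blast
  note [measurable_cong] = M(1)
  note g = integrable_log_power[OF ms M]
  have M01: "AE s in M. 0 < s \<and> s < 1"
    using M(3) by eventually_elim (use y in auto)
  have gg: "integrable M (\<lambda>s. log_power i s * log_power (Suc j) s)" for i j
    using g(1)[of "i + j"] by (simp add: log_power_mult)
  have measurable_gP: "(\<lambda>s. log_power i s * log_root_int j s) \<in> borel_measurable M" for i j
    unfolding measurable_cong_sets[OF M(1) refl] by measurable
  \<comment> \<open>Dominated by a multiple of the power with exponent \<open>i + j + 1\<close>.\<close>
  have gP: "integrable M (\<lambda>s. log_power i s * log_root_int j s)" for i j
  proof (rule Bochner_Integration.integrable_bound[OF integrable_mult_right[OF gg, of "ln 2"]])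
    show "AE s in M. norm (log_power i s * log_root_int j s) \<le> norm (ln 2 * (log_power i s * log_power (Suc j) s))"
      using M01
    proof eventually_elim
      case (elim s)
      then have "log_power i s * log_root_int j s \<le> log_power i s * (ln 2 * log_power (Suc j) s)"
        by (intro mult_left_mono log_root_int_le log_power_nonneg) auto
      with elim show ?case
        by (simp add: log_power_nonneg log_root_int_nonneg mult_ac)
    qed
  qed (rule measurable_gP)
  have int_gP: "enn2real (iter_int (polylog_word ms) (\<lambda>s. ennreal (log_power i s * log_root_int j s)) y) =
      (\<integral>s. log_power i s * log_root_int j s \<partial>M)" for i j
  proof -
    have nn: "AE s in M. 0 \<le> log_power i s * log_root_int j s"
      using M01 by eventually_elim (simp add: log_power_nonneg log_root_int_nonneg)
    have "(\<integral>s. log_power i s * log_root_int j s \<partial>M) = enn2real (\<integral>\<^sup>+s. ennreal (log_power i s * log_root_int j s) \<partial>M)"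
      by (rule integral_eq_nn_integral[OF _ nn]) measurable
    moreover have "iter_int (polylog_word ms) (\<lambda>s. ennreal (log_power i s * log_root_int j s)) y =
        (\<integral>\<^sup>+s. ennreal (log_power i s * log_root_int j s) \<partial>M)"
      by (rule M(2)) measurable
    ultimately show ?thesis by (simp only:)
  qed
  have int_gg: "enn2real (iter_int (polylog_word ms) (\<lambda>s. ennreal (log_power i s * log_power j s)) y) =
      (\<integral>s. log_power i s * log_power j s \<partial>M)" for i j
  proof -
    have nn: "AE s in M. 0 \<le> log_power i s * log_power j s"
      using M01 by eventually_elim (simp add: log_power_nonneg)
    have "(\<integral>s. log_power i s * log_power j s \<partial>M) = enn2real (\<integral>\<^sup>+s. ennreal (log_power i s * log_power j s) \<partial>M)"
      by (rule integral_eq_nn_integral[OF _ nn]) measurable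
    moreover have "iter_int (polylog_word ms) (\<lambda>s. ennreal (log_power i s * log_power j s)) y =
        (\<integral>\<^sup>+s. ennreal (log_power i s * log_power j s) \<partial>M)"
      by (rule M(2)) measurable
    ultimately show ?thesis by (simp only:)
  qed
  define r where "r = (\<lambda>s. - (\<Sum>i=1..k. (-1) ^ i * central_polylog (k - i + 2) 1 * log_power i s)
     - 2 * (\<Sum>i\<le>k. (-1) ^ i * (log_power i s * log_root_int (k - i) s))
     + 2 * ln 2 * (\<Sum>i\<le>k. (-1) ^ i * (log_power i s * log_power (Suc (k - i)) s)))"
  have g': "integrable M (log_power i)" "(\<integral>s. log_power i s \<partial>M) = polylog (raised_word ms (i - 1)) y"
    if "i \<in> {1..k}" for i
    using that g[of "i - 1"] by simp_all
  have r_int: "integrable M r" unfolding r_def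
    by (intro Bochner_Integration.integrable_add Bochner_Integration.integrable_diff
        Bochner_Integration.integrable_minus integrable_mult_right Bochner_Integration.integrable_sum g' gP gg)
  have r_eq: "(\<integral>s. r s \<partial>M) = ?R"
  proof -
    have linear: "(\<integral>s. - a s - 2 * b s + 2 * ln 2 * c s \<partial>M) =
        - (\<integral>s. a s \<partial>M) - 2 * (\<integral>s. b s \<partial>M) + 2 * ln 2 * (\<integral>s. c s \<partial>M)"
      if "integrable M a" "integrable M b" "integrable M c" for a b c :: "real \<Rightarrow> real"
      using that by simp
    have sum: "(\<integral>s. (\<Sum>i\<in>I. c i * f i s) \<partial>M) = (\<Sum>i\<in>I. c i * (\<integral>s. f i s \<partial>M))"
      if "\<And>i. i \<in> I \<Longrightarrow> integrable M (f i)" for I c and f :: "nat \<Rightarrow> real \<Rightarrow> real"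
      using that by (subst Bochner_Integration.integral_sum) auto
    have e0: "(\<integral>s. r s \<partial>M) =
      - (\<integral>s. (\<Sum>i=1..k. (-1) ^ i * central_polylog (k - i + 2) 1 * log_power i s) \<partial>M)
      - 2 * (\<integral>s. (\<Sum>i\<le>k. (-1) ^ i * (log_power i s * log_root_int (k - i) s)) \<partial>M)
      + 2 * ln 2 * (\<integral>s. (\<Sum>i\<le>k. (-1) ^ i * (log_power i s * log_power (Suc (k - i)) s)) \<partial>M)"
      unfolding r_def
      by (rule linear; intro Bochner_Integration.integrable_sum integrable_mult_right g' gP gg)
    have e1: "(\<integral>s. (\<Sum>i=1..k. (-1) ^ i * central_polylog (k - i + 2) 1 * log_power i s) \<partial>M) =
        (\<Sum>i=1..k. (-1) ^ i * central_polylog (k - i + 2) 1 * (\<integral>s. log_power i s \<partial>M))"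
      by (rule sum[OF g'(1)])
    have e2: "(\<Sum>i=1..k. (-1) ^ i * central_polylog (k - i + 2) 1 * (\<integral>s. log_power i s \<partial>M)) =
        (\<Sum>i=1..k. (-1) ^ i * central_polylog (k - i + 2) 1 * polylog (raised_word ms (i - 1)) y)"
      by (intro sum.cong refl) (simp only: g'(2))
    have e3: "(\<integral>s. (\<Sum>i\<le>k. (-1) ^ i * (log_power i s * log_root_int (k - i) s)) \<partial>M) =
        (\<Sum>i\<le>k. (-1) ^ i * (\<integral>s. log_power i s * log_root_int (k - i) s \<partial>M))"
      by (rule sum[OF gP])
    have e4: "(\<integral>s. (\<Sum>i\<le>k. (-1) ^ i * (log_power i s * log_power (Suc (k - i)) s)) \<partial>M) =
        (\<Sum>i\<le>k. (-1) ^ i * (\<integral>s. log_power i s * log_power (Suc (k - i)) s \<partial>M))"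
      by (rule sum[OF gg])
    show ?thesis unfolding int_gP int_gg e0 e1 e2 e3 e4 ..
  qed
  have term_nonneg: "0 \<le> central_weight (k + 2) n * (1 - (1 - s) ^ n)" if "0 < s" "s < 1" for s n
    using that by (intro mult_nonneg_nonneg central_weight_nonneg) (simp add: power_le_one)
  have sums_r: "(\<lambda>n. central_weight (k + 2) n * (1 - (1 - s) ^ n)) sums r s" if "0 < s" "s < 1" for s
    unfolding r_def by (rule sums_one_minus_power[OF that])
  have "0 \<le> r s" if "0 < s" "s < 1" for s
    using suminf_nonneg[OF sums_summable[OF sums_r[OF that]] term_nonneg[OF that]]
      sums_unique[OF sums_r[OF that]] by linarith
  then have r_nonneg: "AE s in M. 0 \<le> r s"
    using M01 by (auto elim: eventually_mono)
  have r_suminf: "(\<Sum>n. ennreal (central_weight (k + 2) n * (1 - (1 - s) ^ n))) = ennreal (r s)"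
    if "0 < s" "s < 1" for s
    by (rule suminf_ennreal_eq[OF term_nonneg[OF that] sums_r[OF that]])
  have F: "(\<integral>\<^sup>+s. ennreal (1 - (1 - s) ^ n) \<partial>M) = ennreal ((-1) ^ length ms * star_remainder n ms y)"
    "0 \<le> (-1) ^ length ms * star_remainder n ms y" for n
    using iter_int_star_remainder[OF ms, of n] M(2)[of "\<lambda>s. ennreal (1 - (1 - s) ^ n)"] by auto
  have "ennreal (\<integral>s. r s \<partial>M) = (\<integral>\<^sup>+s. ennreal (r s) \<partial>M)"
    by (rule nn_integral_eq_integral[symmetric, OF r_int r_nonneg])
  also have "\<dots> = (\<integral>\<^sup>+s. (\<Sum>n. ennreal (central_weight (k + 2) n * (1 - (1 - s) ^ n))) \<partial>M)"
    using M01 by (intro nn_integral_cong_AE, eventually_elim) (simp only: r_suminf)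
  also have "\<dots> = (\<Sum>n. \<integral>\<^sup>+s. ennreal (central_weight (k + 2) n * (1 - (1 - s) ^ n)) \<partial>M)"
    by (rule nn_integral_suminf) measurable
  also have "\<dots> = (\<Sum>n. ennreal (central_weight (k + 2) n * ((-1) ^ length ms * star_remainder n ms y)))"
    by (intro suminf_cong) (simp add: ennreal_mult' central_weight_nonneg nn_integral_cmult F)
  finally have "(\<lambda>n. central_weight (k + 2) n * ((-1) ^ length ms * star_remainder n ms y)) sums (\<integral>s. r s \<partial>M)"
    by (intro nn_suminf_imp_sums[OF mult_nonneg_nonneg[OF central_weight_nonneg F(2)]
          integral_nonneg_AE[OF r_nonneg]]) (simp only:)
  then show ?thesis unfolding r_eq .
qed

lemma sum_pairs_eq: "(\<Sum>(i, j)\<in>{(i, j). i + j = k}. f i j) = (\<Sum>i\<le>k. f i (k - i))" for k :: nat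
  by (rule sum.reindex_bij_witness[of _ "\<lambda>i. (i, k - i)" fst]) auto

lemma sum_pairs_pos_eq: "(\<Sum>(i, j)\<in>{(i, j). i + j = k \<and> 1 \<le> i}. f i j) = (\<Sum>i=1..k. f i (k - i))" for k :: nat
  by (rule sum.reindex_bij_witness[of _ "\<lambda>i. (i, k - i)" fst]) auto

text \<open>Splitting the series needs the convergence of each of the star sum series by itself, which is
  where the bound by \<open>sqrt n\<close> enters.\<close>

lemma star_remainder_series:
  assumes ms: "composition ms" "ms \<noteq> []" and x: "0 \<le> x" "x \<le> 1"
  shows "(\<Sum>n. central_weight (k + 2) n * star_remainder n ms (1 - x)) =
    (\<Sum>n. central_weight (k + 2) n * star_sum n (hoffman_dual ms) x) -
    (\<Sum>j=1..length ms. (-1) ^ (length ms - j) * polylog (rev (drop j ms)) (1 - x) *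
       (\<Sum>n. central_weight (k + 2) n * star_sum n (hoffman_dual (take j ms)) 1))"
proof (rule sums_unique[symmetric])
  let ?w = "central_weight (k + 2)"
  have "(\<lambda>n. ?w n * star_sum n (hoffman_dual ms) x) sums (\<Sum>n. ?w n * star_sum n (hoffman_dual ms) x)"
    using ms x by (intro summable_sums summable_central_star_sum composition_hoffman_dual)
  moreover have "(\<lambda>n. \<Sum>j=1..length ms. (-1) ^ (length ms - j) * polylog (rev (drop j ms)) (1 - x) *
       (?w n * star_sum n (hoffman_dual (take j ms)) 1)) sums
    (\<Sum>j=1..length ms. (-1) ^ (length ms - j) * polylog (rev (drop j ms)) (1 - x) *
       (\<Sum>n. ?w n * star_sum n (hoffman_dual (take j ms)) 1))"
  proof (intro sums_sum sums_mult summable_sums summable_central_star_sum composition_hoffman_dual)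
    fix j assume "j \<in> {1..length ms}"
    then show "composition (take j ms)" "take j ms \<noteq> []" using ms by auto
  qed auto
  ultimately have "(\<lambda>n. ?w n * star_sum n (hoffman_dual ms) x -
      (\<Sum>j=1..length ms. (-1) ^ (length ms - j) * polylog (rev (drop j ms)) (1 - x) *
         (?w n * star_sum n (hoffman_dual (take j ms)) 1))) sums
    ((\<Sum>n. ?w n * star_sum n (hoffman_dual ms) x) -
     (\<Sum>j=1..length ms. (-1) ^ (length ms - j) * polylog (rev (drop j ms)) (1 - x) *
       (\<Sum>n. ?w n * star_sum n (hoffman_dual (take j ms)) 1)))"
    by (rule sums_diff)
  also have "(\<lambda>n. ?w n * star_sum n (hoffman_dual ms) x -
      (\<Sum>j=1..length ms. (-1) ^ (length ms - j) * polylog (rev (drop j ms)) (1 - x) *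
         (?w n * star_sum n (hoffman_dual (take j ms)) 1))) =
      (\<lambda>n. ?w n * star_remainder n ms (1 - x))"
    by (simp add: star_remainder_def right_diff_distrib sum_distrib_left mult_ac)
  finally show "(\<lambda>n. ?w n * star_remainder n ms (1 - x)) sums
    ((\<Sum>n. ?w n * star_sum n (hoffman_dual ms) x) -
     (\<Sum>j=1..length ms. (-1) ^ (length ms - j) * polylog (rev (drop j ms)) (1 - x) *
       (\<Sum>n. ?w n * star_sum n (hoffman_dual (take j ms)) 1)))" .
qed

theorem theorem3p2:
  fixes k :: nat and ms :: "nat list" and x c\<^sub>1 c\<^sub>2 :: real and p :: nat
  assumes "ms \<noteq> []" and "composition ms" and p: "p = length ms"
    and "0 \<le> x" and "x \<le> 1"
    and convergence: "x = 0 \<Longrightarrow> p = 1 \<or> last ms \<ge> 2"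
    and c1: "c\<^sub>1 = (-1) ^ p * 2 ^ (sum_list ms + 2 - p)"
    and c2: "c\<^sub>2 = (-1) ^ p * 2 * ln 2"
  shows
    "(\<Sum>\<^sub>\<infinity>n\<in>{1..}. zeta_star_param n (hoffman_dual ms) x / (real n ^ (k + 2) * 4 ^ n)
                    * real ((2 * n) choose n))
     - (\<Sum>j=1..p. (-1) ^ (p - j) * multi_polylog (rev (drop j ms)) (1 - x)
          * (\<Sum>\<^sub>\<infinity>n\<in>{1..}. zeta_star n (hoffman_dual (take j ms)) / (real n ^ (k + 2) * 4 ^ n)
                         * real ((2 * n) choose n)))
     + (-1) ^ p * (\<Sum>(i, j)\<in>{(i, j). i + j = k \<and> 1 \<le> i}. (-1) ^ i
          * (\<Sum>\<^sub>\<infinity>n\<in>{1..}. real ((2 * n) choose n) / (real n ^ (j + 2) * 4 ^ n))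
          * multi_polylog (rev (tl ms) @ [hd ms + 1] @ replicate (i - 1) 1) (1 - x))
     = c\<^sub>1 * (\<Sum>(i, j)\<in>{(i, j). i + j = k}. (-1) ^ i * A_integral ms i j (sqrt (1 - x)))
     + c\<^sub>2 * (\<Sum>(i, j)\<in>{(i, j). i + j = k}. (-1) ^ i * B_integral ms i j (1 - x))"
proof -
  define y where "y = 1 - x"
  define sg where "sg = ((-1) ^ p :: real)"
  define ia where "ia = (\<lambda>i. enn2real (iter_int (polylog_word ms)
      (\<lambda>s. ennreal (log_power i s * log_root_int (k - i) s)) y))"
  define ib where "ib = (\<lambda>i. enn2real (iter_int (polylog_word ms)
      (\<lambda>s. ennreal (log_power i s * log_power (Suc (k - i)) s)) y))"
  define li where "li = (\<lambda>i. polylog (raised_word ms (i - 1)) y)"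
  have ms: "composition ms" "ms \<noteq> []" by fact+
  have y: "0 \<le> y" "y \<le> 1" using assms(4,5) by (auto simp: y_def)
  have conv: "word_converges ms y"
    using convergence y p by (auto simp: word_converges_def y_def)
  have sg: "sg * sg = 1" by (simp add: sg_def)
  have first: "(\<Sum>\<^sub>\<infinity>n\<in>{1..}. zeta_star_param n (hoffman_dual ms) x / (real n ^ (k + 2) * 4 ^ n)
      * real ((2 * n) choose n)) = (\<Sum>n. central_weight (k + 2) n * star_sum n (hoffman_dual ms) x)"
    unfolding zeta_star_param_eq_star_sum[OF hoffman_dual_nonempty[OF ms]]
    using assms(4,5) ms
    by (intro infsum_central_eq star_sum_nonneg summable_central_star_sum composition_hoffman_dual)
  have second: "(\<Sum>j=1..p. (-1) ^ (p - j) * multi_polylog (rev (drop j ms)) (1 - x)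
          * (\<Sum>\<^sub>\<infinity>n\<in>{1..}. zeta_star n (hoffman_dual (take j ms)) / (real n ^ (k + 2) * 4 ^ n)
                         * real ((2 * n) choose n))) =
      (\<Sum>j=1..length ms. (-1) ^ (length ms - j) * polylog (rev (drop j ms)) (1 - x) *
         (\<Sum>n. central_weight (k + 2) n * star_sum n (hoffman_dual (take j ms)) 1))"
    unfolding p zeta_star_eq_star_sum
  proof (intro sum.cong refl arg_cong2[where f = "(*)"])
    fix j assume j: "j \<in> {1..length ms}"
    have "polylog_converges (rev (drop j ms)) y"
    proof (cases "drop j ms = []")
      case False
      then have "hd (rev (drop j ms)) = last ms" "length ms \<noteq> 1"
        using j by (auto simp: hd_rev last_drop)
      with conv ms show ?thesis by (simp add: polylog_converges_def word_converges_def)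
    qed (use y in \<open>simp add: polylog_converges_def\<close>)
    then have "polylog_converges (rev (drop j ms)) (1 - x)" by (simp only: y_def)
    then show "multi_polylog (rev (drop j ms)) (1 - x) = polylog (rev (drop j ms)) (1 - x)"
      by (rule multi_polylog_eq_polylog)
    have "composition (take j ms)" "take j ms \<noteq> []" using ms j by auto
    then show "(\<Sum>\<^sub>\<infinity>n\<in>{1..}. star_sum n (hoffman_dual (take j ms)) 1 / (real n ^ (k + 2) * 4 ^ n)
        * real ((2 * n) choose n)) = (\<Sum>n. central_weight (k + 2) n * star_sum n (hoffman_dual (take j ms)) 1)"
      by (intro infsum_central_eq star_sum_nonneg summable_central_star_sum composition_hoffman_dual) auto
  qed
  have central: "(\<Sum>\<^sub>\<infinity>n\<in>{1..}. real ((2 * n) choose n) / (real n ^ (j + 2) * 4 ^ n)) = central_polylog (j + 2) 1" for j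
    using infsum_central_eq[of "\<lambda>_. 1" "j + 2"] summable_central_weight[of j]
    by (simp add: central_polylog_def)
  have third: "(\<Sum>(i, j)\<in>{(i, j). i + j = k \<and> 1 \<le> i}. (-1) ^ i
          * (\<Sum>\<^sub>\<infinity>n\<in>{1..}. real ((2 * n) choose n) / (real n ^ (j + 2) * 4 ^ n))
          * multi_polylog (rev (tl ms) @ [hd ms + 1] @ replicate (i - 1) 1) (1 - x)) =
      (\<Sum>i=1..k. (-1) ^ i * central_polylog (k - i + 2) 1 * li i)"
    unfolding sum_pairs_pos_eq central li_def y_def raised_word_def[symmetric]
    using polylog_converges_raised_word[OF ms conv]
    by (intro sum.cong refl arg_cong2[where f = "(*)"] multi_polylog_eq_polylog) (simp add: y_def)
  have A: "c\<^sub>1 * (\<Sum>(i, j)\<in>{(i, j). i + j = k}. (-1) ^ i * A_integral ms i j (sqrt (1 - x))) =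
      sg * (- 2 * (\<Sum>i\<le>k. (-1) ^ i * ia i))"
  proof -
    \<comment> \<open>The number of labels \<open>0\<close>, one less than the exponent of \<open>2\<close> in \<open>c\<^sub>1\<close>.\<close>
    define e where "e = sum_list ms + 1 - p"
    have e: "sum_list ms + 2 - p = Suc e"
      using T_labels_properties(2)[OF ms] p by (simp add: e_def)
    have "c\<^sub>1 * A_integral ms i (k - i) (sqrt (1 - x)) = - 2 * sg * ia i" for i
    proof -
      have "c\<^sub>1 * A_integral ms i (k - i) (sqrt (1 - x)) = - (2 * (2 ^ e * (1 / 2) ^ e)) * sg * ia i"
        using y unfolding c1 e sg_def ia_def y_def[symmetric]
        by (simp add: A_integral_eq[OF ms] polylog_word_def e_def p)
      also have "(2 :: real) ^ e * (1 / 2) ^ e = 1" by (simp flip: power_mult_distrib)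
      finally show ?thesis by simp
    qed
    then have "(-1) ^ i * (c\<^sub>1 * A_integral ms i (k - i) (sqrt (1 - x))) = sg * (- 2 * ((-1) ^ i * ia i))" for i
      by simp
    then show ?thesis
      unfolding sum_pairs_eq sum_distrib_left by (intro sum.cong refl) (simp add: mult_ac)
  qed
  have B: "c\<^sub>2 * (\<Sum>(i, j)\<in>{(i, j). i + j = k}. (-1) ^ i * B_integral ms i j (1 - x)) =
      sg * (2 * ln 2 * (\<Sum>i\<le>k. (-1) ^ i * ib i))"
    using y unfolding sum_pairs_eq c2 sg_def ib_def y_def[symmetric]
    by (simp add: B_integral_eq[OF ms] polylog_word_def)
  have "(\<lambda>n. central_weight (k + 2) n * (sg * star_remainder n ms y)) sums
      (- (\<Sum>i=1..k. (-1) ^ i * central_polylog (k - i + 2) 1 * li i)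
       - 2 * (\<Sum>i\<le>k. (-1) ^ i * ia i) + 2 * ln 2 * (\<Sum>i\<le>k. (-1) ^ i * ib i))"
    unfolding sg_def p li_def ia_def ib_def by (rule central_star_remainder_sums[OF ms conv])
  then have "(\<lambda>n. sg * (central_weight (k + 2) n * (sg * star_remainder n ms y))) sums
      (sg * (- (\<Sum>i=1..k. (-1) ^ i * central_polylog (k - i + 2) 1 * li i)
       - 2 * (\<Sum>i\<le>k. (-1) ^ i * ia i) + 2 * ln 2 * (\<Sum>i\<le>k. (-1) ^ i * ib i)))"
    by (rule sums_mult)
  moreover have "sg * (central_weight (k + 2) n * (sg * star_remainder n ms y)) =
      central_weight (k + 2) n * star_remainder n ms y" for n
    using sg by (metis mult.assoc mult.left_commute mult_1)
  ultimately have series: "(\<Sum>n. central_weight (k + 2) n * star_remainder n ms y) =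
      sg * (- (\<Sum>i=1..k. (-1) ^ i * central_polylog (k - i + 2) 1 * li i)
       - 2 * (\<Sum>i\<le>k. (-1) ^ i * ia i) + 2 * ln 2 * (\<Sum>i\<le>k. (-1) ^ i * ib i))"
    by (simp only: sums_iff)
  show ?thesis
    unfolding first second third A B star_remainder_series[OF ms assms(4,5), symmetric]
      series[unfolded y_def] sg_def[symmetric]
    by (simp only: algebra_simps)
qed

end
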